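(* Assume $\mathrm{char}(\mathbb F)=p>0$ and $0\ne h\in R=\mathbb F[x]$. Then, as a $\mathsf Z(A_h)$-module, $$\mathrm{Der}_{\mathbb F}(A_h)=\mathsf Z(A_h)D_{\breve q}\oplus\mathsf Z(A_h)\breve F\oplus\Big(\mathcal D_\Theta+\{\mathrm{ad}_a\mid a\in\mathsf N_{A_1}(A_h)\}\Big),$$ where (i) for $r\in R$, $D_r$ is the derivation of $A_h$ with $D_r(x)=0$, $D_r(\hat y)=r$; (ii) $\mathcal D_\Theta=\{D_r\mid r\in\Theta\}$ and $\Theta=\{r\in R\mid \mathsf{Res}(D_r)=0\}$; (iii) $\breve q=-\sum_{i=0}^{p-1}\breve q_i x^{p-1-i}$, where $\breve q_i\in\mathbb F[x^p]$ are such that $\overline h=\sum_{i=0}^{p-1}\breve q_i\overline h_i$; (iv) $\breve F=\mathsf z_hD_{\frac{h'}{\varrho_h}}-\frac{h^p}{\varrho_h}E_x$. Hence $\breve F(x)=-\frac{h^p}{\varrho_h}y^{p-1}$ and $$\breve F(\hat y)=\frac{h^p}{\varrho_h}\sum_{k=1}^{p-2}\frac{(-1)^k}{(k+1)k}h^{(k+1)}y^{p-k}+\frac{h^p}{\varrho_h}\big(\partial_p(h)\,y+\partial_p(h')\big).$$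
   Context: $\mathbb F$ is a field of characteristic $p>0$, $R=\mathbb F[x]$, $0\ne h\in R$. The Weyl algebra $A_1$ is the unital associative $\mathbb F$-algebra with generators $x,y$ and relation $yx-xy=1$. $A_h$ is the unital associative $\mathbb F$-algebra with generators $x,\hat y$ and relation $\hat yx-x\hat y=h$; it is identified with the subalgebra of $A_1$ generated by $x$ and $\hat y=yh$. The center of $A_h$ is $\mathsf Z(A_h)=\mathbb F[x^p,\mathsf z_h]$ with $\mathsf z_h=h^py^p$. $\mathsf{Res}:\mathrm{Der}_{\mathbb F}(A_h)\to\mathrm{Der}_{\mathbb F}(\mathsf Z(A_h))$ is restriction. With $\mathrm{ad}_u(v)=[u,v]=uv-vu$, $\mathsf N_{A_1}(A_h)=\{u\in A_1\mid[u,A_h]\subseteq A_h\}$; for $u$ in it, $\mathrm{ad}_u$ is regarded as a derivation of $A_h$. $E_x\in\mathrm{Der}_{\mathbb F}(A_1)$ is given by $E_x(x)=y^{p-1}$, $E_x(y)=0$; $\frac{h^p}{\varrho_h}E_x$ restricts to a derivation of $A_h$. $\varrho_h$ is the unique monic polynomial of maximal degree in $\mathbb F[x^p]$ dividing $h$ (it also divides $h'$). Write $h^{p-1}=\sum_{i=0}^{p-1}\overline h_ix^i$ with $\overline h_i\in\mathbb F[x^p]$; $\overline h$ is the greatest common divisor in $\mathbb F[x^p]$ of $\overline h_0,\dots,\overline h_{p-1}$. $f^{(k)}=(\frac{d}{dx})^k(f)$ for $f\in R$. $\partial_p:R\to R$ is the $\mathbb F$-linear map $\partial_p\big(\sum_{i=0}^{p-1}r_ix^i\big)=\sum_{i=0}^{p-1}\frac{d}{d(x^p)}(r_i)\,x^i$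 for $r_i\in\mathbb F[x^p]$. *)

theory Defs
  imports
    "HOL-Library.Poly_Mapping"
    "HOL-Library.Function_Algebras"
    "HOL-Computational_Algebra.Computational_Algebra"
begin

section \<open>The first Weyl algebra by generators and relations\<close>

text \<open>Words over an alphabet form the free monoid, written additively because the convolution
  ring \<^typ>\<open>'m \<Rightarrow>\<^sub>0 'a\<close> of finitely supported functions expects its monoid in additive notation.
  Thus \<open>weyl_gen free_word \<Rightarrow>\<^sub>0 'a\<close> is the free unital associative algebra on two generators.\<close>

datatype 'a free_word = Word "'a list"

instantiation free_word :: (type) monoid_add
begin

definition zero_free_word :: "'a free_word" where "0 = Word []"

fun plus_free_word :: "'a free_word \<Rightarrow> 'a free_word \<Rightarrow> 'a free_word" where
  "Word u + Word v = Word (u @ v)"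

instance
proof
  fix a b c :: "'a free_word"
  show "a + b + c = a + (b + c)" by (cases a; cases b; cases c) simp
  show "0 + a = a" by (cases a) (simp add: zero_free_word_def)
  show "a + 0 = a" by (cases a) (simp add: zero_free_word_def)
qed

end

datatype weyl_gen = GX | GY

abbreviation free_X :: "weyl_gen free_word \<Rightarrow>\<^sub>0 'a::field" where
  "free_X \<equiv> Poly_Mapping.single (Word [GX]) 1"

abbreviation free_Y :: "weyl_gen free_word \<Rightarrow>\<^sub>0 'a::field" where
  "free_Y \<equiv> Poly_Mapping.single (Word [GY]) 1"

text \<open>The two-sided ideal generated by $yx - xy - 1$.\<close>

inductive_set weyl_ideal :: "(weyl_gen free_word \<Rightarrow>\<^sub>0 'a::field) set" where
  relator: "free_Y * free_X - free_X * free_Y - 1 \<in> weyl_ideal"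
| zero: "0 \<in> weyl_ideal"
| add: "a \<in> weyl_ideal \<Longrightarrow> b \<in> weyl_ideal \<Longrightarrow> a + b \<in> weyl_ideal"
| mult: "a \<in> weyl_ideal \<Longrightarrow> u * a * v \<in> weyl_ideal"

lemma weyl_ideal_uminus: "a \<in> weyl_ideal \<Longrightarrow> - a \<in> weyl_ideal"
  using weyl_ideal.mult[of a "-1" 1] by simp

lemma weyl_ideal_diff: "a \<in> weyl_ideal \<Longrightarrow> b \<in> weyl_ideal \<Longrightarrow> a - b \<in> weyl_ideal"
  using weyl_ideal.add[of a "- b"] weyl_ideal_uminus[of b] by simp

definition weyl_rel :: "(weyl_gen free_word \<Rightarrow>\<^sub>0 'a::field) \<Rightarrow> (weyl_gen free_word \<Rightarrow>\<^sub>0 'a) \<Rightarrow> bool" where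
  "weyl_rel a b \<longleftrightarrow> a - b \<in> weyl_ideal"

text \<open>The polynomial representation, in which \<open>x\<close> acts by multiplication and \<open>y\<close> by
  differentiation; it is used only to see that the ideal is proper.\<close>

fun act_gen :: "weyl_gen \<Rightarrow> 'a::field poly \<Rightarrow> 'a poly" where
  "act_gen GX f = [:0, 1:] * f"
| "act_gen GY f = pderiv f"

fun act_word :: "weyl_gen free_word \<Rightarrow> 'a::field poly \<Rightarrow> 'a poly" where
  "act_word (Word gs) f = foldr act_gen gs f"

definition act_free :: "(weyl_gen free_word \<Rightarrow>\<^sub>0 'a::field) \<Rightarrow> 'a poly \<Rightarrow> 'a poly" where
  "act_free u f = (\<Sum>w\<in>Poly_Mapping.keys u. smult (Poly_Mapping.lookup u w) (act_word w f))"

lemma act_gen_linear: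
  "act_gen g (f + f') = act_gen g f + act_gen g f'" "act_gen g (smult c f) = smult c (act_gen g f)"
  by (cases g; simp add: pderiv_add pderiv_smult algebra_simps)+

lemma act_word_linear:
  "act_word w (f + f') = act_word w f + act_word w f'"
  "act_word w (smult c f) = smult c (act_word w f)"
proof -
  obtain gs where w: "w = Word gs" by (cases w)
  show "act_word w (f + f') = act_word w f + act_word w f'"
    unfolding w by (induction gs) (simp_all add: act_gen_linear)
  show "act_word w (smult c f) = smult c (act_word w f)"
    unfolding w by (induction gs) (simp_all add: act_gen_linear)
qed

lemma act_word_plus: "act_word (v + w) f = act_word v (act_word w f)"
  by (cases v; cases w) simp

lemma act_free_superset:
  assumes "finite S" "Poly_Mapping.keys u \<subseteq> S"
  shows "act_free u f = (\<Sum>w\<in>S. smult (Poly_Mapping.lookup u w) (act_word w f))"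
  unfolding act_free_def using assms
  by (intro sum.mono_neutral_left) (auto simp: in_keys_iff)

lemma act_free_add: "act_free (u + v) f = act_free u f + act_free v f"
proof -
  let ?S = "Poly_Mapping.keys u \<union> Poly_Mapping.keys v"
  have "Poly_Mapping.keys (u + v) \<subseteq> ?S"
    by (rule Poly_Mapping.keys_add)
  then show ?thesis
    by (simp add: act_free_superset[of ?S] lookup_add smult_add_left sum.distrib)
qed

lemma act_free_single: "act_free (Poly_Mapping.single w c) f = smult c (act_word w f)"
  using act_free_superset[of "{w}" "Poly_Mapping.single w c" f] by (simp split: if_splits)

lemma act_free_zero: "act_free 0 f = 0"
  by (simp add: act_free_def)

lemma smult_sum_right: "smult c (sum f S) = (\<Sum>i\<in>S. smult c (f i))"
  by (induction S rule: infinite_finite_induct) (simp_all add: smult_add_right)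

lemma act_free_linear:
  "act_free u (f + f') = act_free u f + act_free u f'"
  "act_free u (smult c f) = smult c (act_free u f)"
  by (simp_all add: act_free_def act_word_linear smult_add_right sum.distrib smult_sum_right mult.commute)

lemma act_free_arg_zero: "act_free u 0 = 0"
  using act_free_linear(2)[of u 0 0] by simp

lemma poly_mapping_single_induct [case_names zero single add]:
  assumes "P 0" "\<And>k c. P (Poly_Mapping.single k c)"
    and "\<And>f g. P f \<Longrightarrow> P g \<Longrightarrow> P (f + g)"
  shows "P u"
proof (induction u rule: Poly_Mapping.update_induct)
  case const
  show ?case by (rule assms(1))
next
  case (update f a b)
  have "Poly_Mapping.update a b f = f + Poly_Mapping.single a b"
    using update(1)
    by (intro poly_mapping_eqI) (auto simp: lookup_update lookup_add lookup_single in_keys_iff when_def)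
  then show ?case using assms(2,3) update by simp
qed

lemma act_free_single_mult:
  "act_free (Poly_Mapping.single w c * v) f = act_free (Poly_Mapping.single w c) (act_free v f)"
proof (induction v rule: poly_mapping_single_induct)
  case zero
  then show ?case by (simp add: act_free_zero act_free_arg_zero)
next
  case (single k d)
  then show ?case
    by (simp add: mult_single act_free_single act_word_plus act_word_linear)
next
  case (add g h)
  then show ?case
    by (simp add: distrib_left act_free_add act_free_linear)
qed

lemma act_free_mult: "act_free (u * v) f = act_free u (act_free v f)"
proof (induction u rule: poly_mapping_single_induct)
  case zero
  then show ?case by (simp add: act_free_zero)
next
  case (single k d)
  then show ?case by (rule act_free_single_mult)
next
  case (add g h)
  then show ?case by (simp add: distrib_right act_free_add)
qed

lemma act_free_diff: "act_free (u - v) f = act_free u f - act_free v f"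
  using act_free_add[of "u - v" v f] by simp

lemma act_free_one: "act_free 1 f = f"
  using act_free_single[of 0 1 f] by simp (simp add: zero_free_word_def)

lemma act_free_ideal: "a \<in> weyl_ideal \<Longrightarrow> act_free a f = 0"
proof (induction arbitrary: f rule: weyl_ideal.induct)
  case relator
  show ?case
    by (simp add: act_free_diff act_free_mult act_free_single act_free_one pderiv_pCons)
qed (simp_all add: act_free_zero act_free_add act_free_mult act_free_arg_zero)

lemma one_notin_weyl_ideal: "1 \<notin> weyl_ideal"
  using act_free_ideal[of 1 1] by (auto simp: act_free_one)

lemma equivp_weyl_rel: "equivp (weyl_rel :: (weyl_gen free_word \<Rightarrow>\<^sub>0 'a::field) \<Rightarrow> _)"
proof (rule equivpI)
  show "reflp (weyl_rel :: (weyl_gen free_word \<Rightarrow>\<^sub>0 'a) \<Rightarrow> _)"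
    by (rule reflpI) (simp add: weyl_rel_def weyl_ideal.zero)
  show "symp (weyl_rel :: (weyl_gen free_word \<Rightarrow>\<^sub>0 'a) \<Rightarrow> _)"
    by (rule sympI) (metis weyl_rel_def weyl_ideal_uminus minus_diff_eq)
  show "transp (weyl_rel :: (weyl_gen free_word \<Rightarrow>\<^sub>0 'a) \<Rightarrow> _)"
  proof (rule transpI)
    fix a b c :: "weyl_gen free_word \<Rightarrow>\<^sub>0 'a"
    assume "weyl_rel a b" "weyl_rel b c"
    then show "weyl_rel a c"
      unfolding weyl_rel_def using weyl_ideal.add[of "a - b" "b - c"] by simp
  qed
qed

quotient_type (overloaded) 'a weyl = "weyl_gen free_word \<Rightarrow>\<^sub>0 'a::field" / weyl_rel
  by (rule equivp_weyl_rel)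

instantiation weyl :: (field) ring_1
begin

lift_definition zero_weyl :: "'a weyl" is 0 .
lift_definition one_weyl :: "'a weyl" is 1 .

lift_definition plus_weyl :: "'a weyl \<Rightarrow> 'a weyl \<Rightarrow> 'a weyl" is "(+)"
  unfolding weyl_rel_def by (metis weyl_ideal.add add_diff_add)

lift_definition minus_weyl :: "'a weyl \<Rightarrow> 'a weyl \<Rightarrow> 'a weyl" is "(-)"
proof -
  fix a b c d :: "weyl_gen free_word \<Rightarrow>\<^sub>0 'a"
  assume "weyl_rel a b" "weyl_rel c d"
  then have "(a - b) - (c - d) \<in> weyl_ideal"
    unfolding weyl_rel_def by (rule weyl_ideal_diff)
  moreover have "(a - b) - (c - d) = (a - c) - (b - d)"
    by (simp add: algebra_simps)
  ultimately show "weyl_rel (a - c) (b - d)"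
    by (simp add: weyl_rel_def)
qed

lift_definition uminus_weyl :: "'a weyl \<Rightarrow> 'a weyl" is uminus
  unfolding weyl_rel_def by (metis weyl_ideal_uminus minus_diff_minus)

lift_definition times_weyl :: "'a weyl \<Rightarrow> 'a weyl \<Rightarrow> 'a weyl" is "(*)"
proof -
  fix a b c d :: "weyl_gen free_word \<Rightarrow>\<^sub>0 'a"
  assume "weyl_rel a b" "weyl_rel c d"
  then have "1 * (a - b) * c + b * (c - d) * 1 \<in> weyl_ideal"
    unfolding weyl_rel_def by (intro weyl_ideal.add weyl_ideal.mult)
  moreover have "1 * (a - b) * c + b * (c - d) * 1 = a * c - b * d"
    by (simp add: algebra_simps)
  ultimately show "weyl_rel (a * c) (b * d)"
    by (simp add: weyl_rel_def)
qed

instance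
proof
  fix a b c :: "'a weyl"
  note refl = equivp_reflp[OF equivp_weyl_rel]
  show "a * b * c = a * (b * c)" by transfer (simp add: mult.assoc refl)
  show "1 * a = a" by transfer (simp add: refl)
  show "a * 1 = a" by transfer (simp add: refl)
  show "a + b + c = a + (b + c)" by transfer (simp add: add.assoc refl)
  show "a + b = b + a" by transfer (simp add: add.commute refl)
  show "0 + a = a" by transfer (simp add: refl)
  show "- a + a = 0" by transfer (simp add: refl)
  show "a - b = a + - b" by transfer (simp add: refl)
  show "(a + b) * c = a * c + b * c" by transfer (simp add: distrib_right refl)
  show "a * (b + c) = a * b + a * c" by transfer (simp add: distrib_left refl)
  show "(0 :: 'a weyl) \<noteq> 1"
  proof (transfer, unfold weyl_rel_def)
    show "0 - 1 \<notin> (weyl_ideal :: (weyl_gen free_word \<Rightarrow>\<^sub>0 'a) set)"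
      using weyl_ideal_uminus[of "0 - 1"] one_notin_weyl_ideal by auto
  qed
qed

end

lift_definition wX :: "'a::field weyl" is free_X .
lift_definition wY :: "'a::field weyl" is free_Y .
lift_definition wconst :: "'a::field \<Rightarrow> 'a weyl" is "Poly_Mapping.single 0" .

lemma weyl_relation: "wY * wX - wX * wY = (1 :: 'a::field weyl)"
  by transfer (simp add: weyl_rel_def weyl_ideal.relator)

text \<open>The embedding of $R = F[x]$ into the Weyl algebra.\<close>

definition wpoly :: "'a::field poly \<Rightarrow> 'a weyl" where
  "wpoly f = (\<Sum>i\<le>degree f. wconst (coeff f i) * wX ^ i)"

definition wad :: "'a::field weyl \<Rightarrow> 'a weyl \<Rightarrow> 'a weyl" where
  "wad u v = u * v - v * u"


section \<open>The algebra $A_h$\<close>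

definition yhat :: "'a::field poly \<Rightarrow> 'a weyl" where
  "yhat h = wY * wpoly h"

lemma wconst_commute_wX: "wconst c * wX = wX * wconst c"
  by transfer (simp add: mult_single equivp_reflp[OF equivp_weyl_rel])

lemma wX_power_commute: "wX ^ n * wX = wX * (wX ^ n :: 'a::field weyl)"
  by (simp add: power_commutes)

lemma wpoly_commute_wX: "wpoly f * wX = wX * wpoly f"
  unfolding wpoly_def sum_distrib_left sum_distrib_right
  by (intro sum.cong refl) (metis mult.assoc wconst_commute_wX wX_power_commute)

lemma Ah_relation: "yhat h * wX - wX * yhat h = wpoly h"
proof -
  have "yhat h * wX - wX * yhat h = (wY * wX - wX * wY) * wpoly h"
    unfolding yhat_def by (simp add: mult.assoc wpoly_commute_wX left_diff_distrib)
  then show ?thesis by (simp add: weyl_relation)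
qed

text \<open>$A_h$ as the unital subalgebra generated by $x$ and $\hat y = yh$.\<close>

inductive_set Ah :: "'a::field poly \<Rightarrow> 'a weyl set" for h where
  x: "wX \<in> Ah h"
| yhat: "yhat h \<in> Ah h"
| const: "wconst c \<in> Ah h"
| add: "a \<in> Ah h \<Longrightarrow> b \<in> Ah h \<Longrightarrow> a + b \<in> Ah h"
| mult: "a \<in> Ah h \<Longrightarrow> b \<in> Ah h \<Longrightarrow> a * b \<in> Ah h"

definition weyl_center :: "'a::field weyl set \<Rightarrow> 'a weyl set" where
  "weyl_center A = {z \<in> A. \<forall>a\<in>A. z * a = a * z}"

definition weyl_normalizer :: "'a::field weyl set \<Rightarrow> 'a weyl set" where
  "weyl_normalizer A = {u. \<forall>a\<in>A. wad u a \<in> A}"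


section \<open>Derivations\<close>

text \<open>Maps on a subalgebra \<open>A\<close> are represented by total functions vanishing outside \<open>A\<close>, so that
  equality and the pointwise operations of \<^theory>\<open>HOL-Library.Function_Algebras\<close> on these
  functions are those of maps on \<open>A\<close>.\<close>

definition restr :: "'a::field weyl set \<Rightarrow> ('a weyl \<Rightarrow> 'a weyl) \<Rightarrow> 'a weyl \<Rightarrow> 'a weyl" where
  "restr A D = (\<lambda>a. if a \<in> A then D a else 0)"

definition Der :: "'a::field weyl set \<Rightarrow> ('a weyl \<Rightarrow> 'a weyl) set" where
  "Der A = {D. (\<forall>a. a \<notin> A \<longrightarrow> D a = 0) \<and> (\<forall>a\<in>A. D a \<in> A) \<and>
     (\<forall>a\<in>A. \<forall>b\<in>A. D (a + b) = D a + D b) \<and>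
     (\<forall>c. \<forall>a\<in>A. D (wconst c * a) = wconst c * D a) \<and>
     (\<forall>a\<in>A. \<forall>b\<in>A. D (a * b) = D a * b + a * D b)}"

definition dscale :: "'a::field weyl \<Rightarrow> ('a weyl \<Rightarrow> 'a weyl) \<Rightarrow> 'a weyl \<Rightarrow> 'a weyl" where
  "dscale z D = (\<lambda>a. z * D a)"

definition dsubmodule :: "'a::field weyl set \<Rightarrow> ('a weyl \<Rightarrow> 'a weyl) set \<Rightarrow> bool" where
  "dsubmodule Z N \<longleftrightarrow> 0 \<in> N \<and> (\<forall>D\<in>N. \<forall>E\<in>N. D + E \<in> N) \<and> (\<forall>z\<in>Z. \<forall>D\<in>N. dscale z D \<in> N)"

text \<open>\<open>M\<close> is, as a \<open>Z\<close>-module, the internal direct sum of its submodules \<open>N1\<close>, \<open>N2\<close>, \<open>N3\<close>.\<close>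

definition is_direct_sum3 ::
  "'a::field weyl set \<Rightarrow> ('a weyl \<Rightarrow> 'a weyl) set \<Rightarrow> ('a weyl \<Rightarrow> 'a weyl) set \<Rightarrow>
   ('a weyl \<Rightarrow> 'a weyl) set \<Rightarrow> ('a weyl \<Rightarrow> 'a weyl) set \<Rightarrow> bool" where
  "is_direct_sum3 Z M N1 N2 N3 \<longleftrightarrow>
     dsubmodule Z M \<and> dsubmodule Z N1 \<and> dsubmodule Z N2 \<and> dsubmodule Z N3 \<and>
     N1 \<subseteq> M \<and> N2 \<subseteq> M \<and> N3 \<subseteq> M \<and>
     (\<forall>D\<in>M. \<exists>!(D1, D2, D3). D1 \<in> N1 \<and> D2 \<in> N2 \<and> D3 \<in> N3 \<and> D = D1 + D2 + D3)"

definition Dr :: "'a::field poly \<Rightarrow> 'a poly \<Rightarrow> 'a weyl \<Rightarrow> 'a weyl" where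
  "Dr h r = (THE D. D \<in> Der (Ah h) \<and> D wX = 0 \<and> D (yhat h) = wpoly r)"

definition Ex :: "nat \<Rightarrow> 'a::field weyl \<Rightarrow> 'a weyl" where
  "Ex p = (THE D. D \<in> Der UNIV \<and> D wX = wY ^ (p - 1) \<and> D wY = 0)"

definition Res :: "'a::field poly \<Rightarrow> ('a weyl \<Rightarrow> 'a weyl) \<Rightarrow> 'a weyl \<Rightarrow> 'a weyl" where
  "Res h D = restr (weyl_center (Ah h)) D"

definition Theta :: "'a::field poly \<Rightarrow> 'a poly set" where
  "Theta h = {r. Res h (Dr h r) = 0}"

definition D_Theta :: "'a::field poly \<Rightarrow> ('a weyl \<Rightarrow> 'a weyl) set" where
  "D_Theta h = Dr h ` Theta h"

definition ad_normalizer :: "'a::field poly \<Rightarrow> ('a weyl \<Rightarrow> 'a weyl) set" where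
  "ad_normalizer h = (\<lambda>a. restr (Ah h) (wad a)) ` weyl_normalizer (Ah h)"


section \<open>$F[x]$ as a module over $F[x^p]$\<close>

definition at_xp :: "nat \<Rightarrow> 'a::field poly \<Rightarrow> 'a poly" where
  "at_xp p g = pcompose g (monom 1 p)"

definition Fxp :: "nat \<Rightarrow> 'a::field poly set" where
  "Fxp p = range (at_xp p)"

text \<open>The polynomial $g_i$ in the unique expansion $f = \sum_{i<p} g_i(x^p) x^i$.\<close>

definition xp_part :: "nat \<Rightarrow> nat \<Rightarrow> 'a::field poly \<Rightarrow> 'a poly" where
  "xp_part p i f = Abs_poly (\<lambda>j. coeff f (i + p * j))"

lemma coeff_xp_part:
  assumes "p > 0"
  shows "coeff (xp_part p i f) j = coeff f (i + p * j)"
proof -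
  have "coeff f (i + p * j) = 0" if "j > degree f" for j
  proof (rule coeff_eq_0)
    have "j \<le> p * j" using assms by simp
    then show "degree f < i + p * j" using that by linarith
  qed
  then show ?thesis
    unfolding xp_part_def by (subst coeff_Abs_poly[where n = "degree f"]) auto
qed

lemma coeff_at_xp:
  assumes "p > 0"
  shows "coeff (at_xp p g) n = (if p dvd n then coeff g (n div p) else 0)"
proof -
  have "at_xp p g = (\<Sum>i\<le>degree g. monom (coeff g i) (p * i))"
    unfolding at_xp_def pcompose_altdef poly_altdef
    by (simp add: coeff_map_poly degree_map_poly monom_power smult_monom)
  then have *: "coeff (at_xp p g) n = (\<Sum>i\<le>degree g. if p * i = n then coeff g i else 0)"
    by (simp add: coeff_sum)
  show ?thesis
  proof (cases "p dvd n")
    case True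
    then obtain k where k: "n = p * k" by blast
    show ?thesis unfolding * using assms k
      by (simp add: coeff_eq_0)
  next
    case False
    then show ?thesis unfolding * by (auto intro!: sum.neutral)
  qed
qed

lemma xp_expansion:
  assumes "p > 0"
  shows "f = (\<Sum>i<p. at_xp p (xp_part p i f) * monom 1 i)"
proof (rule poly_eqI)
  fix n
  have "coeff (\<Sum>i<p. at_xp p (xp_part p i f) * monom 1 i) n =
      (\<Sum>i<p. if n mod p = i then coeff f n else 0)"
    unfolding coeff_sum
  proof (rule sum.cong)
    fix i assume i: "i \<in> {..<p}"
    have "p dvd n - i \<and> i \<le> n \<longleftrightarrow> n mod p = i"
      using i by (metis lessThan_iff mod_eq_dvd_iff_nat mod_less mod_less_eq_dividend)
    moreover have "i + p * ((n - i) div p) = n" if "p dvd n - i" "i \<le> n"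
      using that by simp
    ultimately show "coeff (at_xp p (xp_part p i f) * monom 1 i) n =
        (if n mod p = i then coeff f n else 0)"
      using assms
      by (auto simp: mult.commute[of _ "monom 1 i"] coeff_monom_mult coeff_at_xp coeff_xp_part)
  qed simp
  then show "coeff f n = coeff (\<Sum>i<p. at_xp p (xp_part p i f) * monom 1 i) n"
    using assms by simp
qed

definition dp :: "nat \<Rightarrow> 'a::field poly \<Rightarrow> 'a poly" where
  "dp p f = (\<Sum>i<p. at_xp p (pderiv (xp_part p i f)) * monom 1 i)"

definition rho :: "nat \<Rightarrow> 'a::field poly \<Rightarrow> 'a poly" where
  "rho p h = (THE g. g \<in> Fxp p \<and> lead_coeff g = 1 \<and> g dvd h \<and>
     (\<forall>g'\<in>Fxp p. g' dvd h \<longrightarrow> degree g' \<le> degree g))"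

definition hbar_part :: "nat \<Rightarrow> 'a::field poly \<Rightarrow> nat \<Rightarrow> 'a poly" where
  "hbar_part p h i = at_xp p (xp_part p i (h ^ (p - 1)))"

definition Fxp_dvd :: "nat \<Rightarrow> 'a::field poly \<Rightarrow> 'a poly \<Rightarrow> bool" where
  "Fxp_dvd p a b \<longleftrightarrow> (\<exists>c\<in>Fxp p. b = a * c)"

text \<open>The greatest common divisor, in the ring $F[x^p]$, normalised to be monic.\<close>

definition hbar :: "nat \<Rightarrow> 'a::field poly \<Rightarrow> 'a poly" where
  "hbar p h = (THE g. g \<in> Fxp p \<and> lead_coeff g = 1 \<and> (\<forall>i<p. Fxp_dvd p g (hbar_part p h i)) \<and>
     (\<forall>d\<in>Fxp p. (\<forall>i<p. Fxp_dvd p d (hbar_part p h i)) \<longrightarrow> Fxp_dvd p d g))"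


section \<open>The distinguished derivations\<close>

definition z_h :: "nat \<Rightarrow> 'a::field poly \<Rightarrow> 'a weyl" where
  "z_h p h = wpoly (h ^ p) * wY ^ p"

definition qbreve :: "nat \<Rightarrow> (nat \<Rightarrow> 'a::field poly) \<Rightarrow> 'a poly" where
  "qbreve p q = - (\<Sum>i<p. q i * monom 1 (p - 1 - i))"

text \<open>Both polynomial divisions are exact, since \<open>rho p h\<close> divides \<open>h\<close> and \<open>pderiv h\<close>.\<close>

definition Fbreve :: "nat \<Rightarrow> 'a::field poly \<Rightarrow> 'a weyl \<Rightarrow> 'a weyl" where
  "Fbreve p h = dscale (z_h p h) (Dr h (pderiv h div rho p h))
     - restr (Ah h) (dscale (wpoly (h ^ p div rho p h)) (Ex p))"

end

theory Submission
  imports "HOL-Number_Theory.Residues" Defs "HOL-Library.Product_Plus"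
begin

text \<open>
Derivations of \<open>A\<^sub>h\<close> are compared through their restrictions to the centre \<open>Z\<close>, which is generated by
the constants, \<open>x\<^sup>p\<close> and \<open>z\<^sub>h = h\<^sup>p y\<^sup>p\<close>. All computations use the normal form
\<open>\<Sum>\<^sub>j f\<^sub>j y\<^sup>j\<close> with \<open>f\<^sub>j\<close> in \<open>F[x]\<close>, in which \<open>A\<^sub>h\<close> is described by \<open>h\<^sup>j dvd f\<^sub>j\<close> (\<open>Ah_iff\<close>),
and the rule that a derivation sends \<open>a\<^sup>p\<close> to a \<open>(p - 1)\<close>-fold iterated commutator of its value at
\<open>a\<close> with \<open>a\<close> (\<open>derivation_on_power_p\<close>).

The restrictions to \<open>Z\<close> form a triangular system. By the power rule, the coefficients of \<open>D (x\<^sup>p)\<close> are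
up to sign coefficients of \<open>D x\<close> with index shifted by \<open>p - 1\<close>. They therefore carry an extra factor
\<open>h\<^sup>p\<^sup>-\<^sup>1\<close>, and since \<open>D (x\<^sup>p)\<close> is central they lie in \<open>F[x\<^sup>p]\<close>. An element of \<open>F[x\<^sup>p]\<close> divisible by
\<open>h\<^sup>p\<^sup>-\<^sup>1\<close> is divisible by \<open>h\<^sup>p / \<rho>\<close> with \<open>\<rho> = rho p h\<close> (\<open>power_div_rho_dvd\<close>), so \<open>D (x\<^sup>p)\<close> is a \<open>Z\<close>-multiple of
\<open>h\<^sup>p / \<rho>\<close>, the value of \<open>Fbreve\<close> (\<open>Der_wX_power_p\<close>, \<open>Fbreve_wX_power_p\<close>). If \<open>D (x\<^sup>p) = 0\<close>, then
\<open>D x\<close> is a commutator \<open>[a, x]\<close> with \<open>a\<close> in the Weyl algebra (\<open>Der_reduce_by_wad\<close>). What remains of \<open>D\<close>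
kills \<open>x\<close> and sends \<open>yhat h\<close> to some \<open>w\<close>; passing to the Weyl algebra with the denominator \<open>h\<close>
cleared shows that it sends \<open>z\<^sub>h\<close> to the derivative of order \<open>p - 1\<close> of \<open>h\<^sup>p\<^sup>-\<^sup>1 w\<close>
(\<open>wc_derivation_z_h\<close>). This operator extracts the component of index \<open>p - 1\<close> over \<open>F[x\<^sup>p]\<close>, so its
values are multiples of \<open>hbar\<close>, and the Bezout identity for \<open>hbar\<close> says that \<open>D\<^sub>q\<close> attains \<open>hbar\<close>
itself when \<open>q\<close> is the polynomial \<open>qbreve\<close> (\<open>Der_z_h\<close>, \<open>higher_pderiv_power_qbreve\<close>).

It remains to identify the derivations that vanish on \<open>Z\<close>. If \<open>D (z\<^sub>h) = 0\<close> as well, then each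
coefficient of \<open>h\<^sup>p\<^sup>-\<^sup>1 w\<close> is a derivative, and integration exhibits every term of \<open>w\<close> except the
constant one as a commutator with \<open>yhat h\<close>. Hence \<open>D = D\<^sub>r + ad\<^sub>a\<close> for a polynomial \<open>r\<close> and some
\<open>a\<close> in the Weyl algebra (\<open>Der_zero_on_center_generators\<close>); as \<open>D\<close> and \<open>D\<^sub>r\<close> preserve \<open>A\<^sub>h\<close>, so does
\<open>ad\<^sub>a\<close> (\<open>Res_kernel_eq\<close>).

The formula for \<open>Fbreve\<close> rests on the values of \<open>E\<^sub>x\<close> on \<open>F[x]\<close> (\<open>wc_Ex_wpoly\<close>), which are the
reductions modulo \<open>p\<close> of the commutator with \<open>y\<^sup>p\<close> divided by \<open>p\<close>.
\<close>


section \<open>Representations of the Weyl algebra\<close>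

lemma weyl_abs_cases: obtains u where "a = abs_weyl u"
  by (metis Quotient3_abs_rep[OF Quotient3_weyl])

text \<open>The universal property of the Weyl algebra. It is applied to two modules: to polynomials in \<open>y\<close>
over \<open>F[x]\<close>, which yields the normal form, and to pairs of elements of the Weyl algebra, which
yields derivations.\<close>

locale weyl_action = Modules.module scale
  for scale :: "'a::field \<Rightarrow> 'v::ab_group_add \<Rightarrow> 'v" +
  fixes X Y :: "'v \<Rightarrow> 'v"
  assumes X_add: "X (v + w) = X v + X w" and X_scale: "X (scale c v) = scale c (X v)"
    and Y_add: "Y (v + w) = Y v + Y w" and Y_scale: "Y (scale c v) = scale c (Y v)"
    and rel: "Y (X v) - X (Y v) = v"
begin

definition letter :: "weyl_gen \<Rightarrow> 'v \<Rightarrow> 'v" where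
  "letter g = (case g of GX \<Rightarrow> X | GY \<Rightarrow> Y)"

definition word :: "weyl_gen free_word \<Rightarrow> 'v \<Rightarrow> 'v" where
  "word w = (case w of Word gs \<Rightarrow> foldr letter gs)"

definition free :: "(weyl_gen free_word \<Rightarrow>\<^sub>0 'a) \<Rightarrow> 'v \<Rightarrow> 'v" where
  "free u v = (\<Sum>w\<in>Poly_Mapping.keys u. scale (Poly_Mapping.lookup u w) (word w v))"

definition act :: "'a weyl \<Rightarrow> 'v \<Rightarrow> 'v" where
  "act a = free (rep_weyl a)"

lemma letter_linear:
  "letter g (v + w) = letter g v + letter g w" "letter g (scale c v) = scale c (letter g v)"
  by (cases g; simp add: letter_def X_add X_scale Y_add Y_scale)+

lemma word_linear:
  "word w (v + v') = word w v + word w v'" "word w (scale c v) = scale c (word w v)"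
proof -
  obtain gs where w: "w = Word gs" by (cases w)
  show "word w (v + v') = word w v + word w v'"
    unfolding w word_def by (induction gs) (simp_all add: letter_linear)
  show "word w (scale c v) = scale c (word w v)"
    unfolding w word_def by (induction gs) (simp_all add: letter_linear)
qed

lemma word_plus: "word (v + w) f = word v (word w f)"
  by (cases v; cases w) (simp add: word_def)

lemma free_superset:
  assumes "finite S" "Poly_Mapping.keys u \<subseteq> S"
  shows "free u v = (\<Sum>w\<in>S. scale (Poly_Mapping.lookup u w) (word w v))"
  unfolding free_def using assms
  by (intro sum.mono_neutral_left) (auto simp: in_keys_iff)

lemma free_add: "free (u + v) f = free u f + free v f"
proof -
  let ?S = "Poly_Mapping.keys u \<union> Poly_Mapping.keys v"
  have "Poly_Mapping.keys (u + v) \<subseteq> ?S"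
    by (rule Poly_Mapping.keys_add)
  then show ?thesis
    by (simp add: free_superset[of ?S] lookup_add scale_left_distrib sum.distrib)
qed

lemma free_single: "free (Poly_Mapping.single w c) f = scale c (word w f)"
  using free_superset[of "{w}" "Poly_Mapping.single w c" f] by (simp split: if_splits)

lemma free_zero: "free 0 f = 0"
  by (simp add: free_def)

lemma free_linear:
  "free u (f + f') = free u f + free u f'" "free u (scale c f) = scale c (free u f)"
  by (simp_all add: free_def word_linear scale_right_distrib sum.distrib scale_sum_right
      mult.commute)

lemma free_arg_zero: "free u 0 = 0"
  using free_linear(2)[of u 0 0] by simp

lemma free_mult: "free (u * v) f = free u (free v f)"
proof (induction u rule: poly_mapping_single_induct)
  case zero
  then show ?case by (simp add: free_zero)
next
  case (single k d)
  show ?case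
  proof (induction v rule: poly_mapping_single_induct)
    case zero
    then show ?case by (simp add: free_zero free_arg_zero)
  next
    case (single l c)
    then show ?case
      by (simp add: mult_single free_single word_plus word_linear)
  next
    case (add g h)
    then show ?case
      by (simp add: distrib_left free_add free_linear)
  qed
next
  case (add g h)
  then show ?case by (simp add: distrib_right free_add)
qed

lemma free_diff: "free (u - v) f = free u f - free v f"
  using free_add[of "u - v" v f] by simp

lemma free_one: "free 1 f = f"
  using free_single[of 0 1 f] by simp (simp add: zero_free_word_def word_def)

lemma free_ideal: "a \<in> weyl_ideal \<Longrightarrow> free a f = 0"
proof (induction arbitrary: f rule: weyl_ideal.induct)
  case relator
  show ?case
    by (simp add: free_diff free_mult free_single free_one)
      (simp add: word_def letter_def rel)
qed (simp_all add: free_zero free_add free_mult free_arg_zero)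

lemma act_abs: "act (abs_weyl u) = free u"
proof
  fix v
  have "abs_weyl (rep_weyl (abs_weyl u)) = abs_weyl u"
    by (rule Quotient3_abs_rep[OF Quotient3_weyl])
  then have "rep_weyl (abs_weyl u) - u \<in> weyl_ideal"
    by (simp add: weyl.abs_eq_iff weyl_rel_def)
  then have "free (rep_weyl (abs_weyl u) - u) v = 0" by (rule free_ideal)
  then show "act (abs_weyl u) v = free u v" by (simp add: act_def free_diff)
qed

lemma act_add: "act (a + b) v = act a v + act b v"
proof -
  obtain s t where "a = abs_weyl s" "b = abs_weyl t" by (meson weyl_abs_cases)
  then show ?thesis by (simp add: plus_weyl.abs_eq act_abs free_add)
qed

lemma act_mult: "act (a * b) v = act a (act b v)"
proof -
  obtain s t where "a = abs_weyl s" "b = abs_weyl t" by (meson weyl_abs_cases)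
  then show ?thesis by (simp add: times_weyl.abs_eq act_abs free_mult)
qed

lemma act_wconst: "act (wconst c) v = scale c v"
  by (simp add: wconst.abs_eq act_abs free_single) (simp add: zero_free_word_def word_def)

lemma act_wX: "act wX v = X v"
  by (simp add: wX.abs_eq act_abs free_single) (simp add: word_def letter_def)

lemma act_wY: "act wY v = Y v"
  by (simp add: wY.abs_eq act_abs free_single) (simp add: word_def letter_def)

end

lemma wconst_add: "wconst (c + d) = wconst c + wconst d"
  by transfer (simp add: single_add equivp_reflp[OF equivp_weyl_rel])

lemma wconst_mult: "wconst (c * d) = wconst c * wconst d"
  by transfer (simp add: mult_single equivp_reflp[OF equivp_weyl_rel])

lemma wconst_1 [simp]: "wconst 1 = 1"
  by transfer (simp add: equivp_reflp[OF equivp_weyl_rel])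

lemma wconst_0 [simp]: "wconst 0 = 0"
  by transfer (simp add: equivp_reflp[OF equivp_weyl_rel])

lemma wconst_uminus: "wconst (- c) = - wconst c"
  using wconst_add[of c "- c"] by (simp add: eq_neg_iff_add_eq_0 add.commute)

text \<open>Left multiplication by the generators suffices, because a word is built from the right by
prepending letters.\<close>

lemma weyl_induct [case_names const add X Y]:
  fixes a :: "'a::field weyl"
  assumes const: "\<And>c. P (wconst c)" and add: "\<And>a b. P a \<Longrightarrow> P b \<Longrightarrow> P (a + b)"
    and X: "\<And>a. P a \<Longrightarrow> P (wX * a)" and Y: "\<And>a. P a \<Longrightarrow> P (wY * a)"
  shows "P a"
proof -
  have "P (abs_weyl u)" for u :: "weyl_gen free_word \<Rightarrow>\<^sub>0 'a"
  proof (induction u rule: poly_mapping_single_induct)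
    case zero
    then show ?case using const[of 0] by (simp add: zero_weyl.abs_eq flip: zero_weyl.abs_eq)
  next
    case (single w c)
    obtain gs where w: "w = Word gs" by (cases w)
    have "P (abs_weyl (Poly_Mapping.single (Word gs) c))"
    proof (induction gs)
      case Nil
      then show ?case using const[of c] by (simp add: wconst.abs_eq zero_free_word_def)
    next
      case (Cons g gs)
      have "Poly_Mapping.single (Word (g # gs)) c =
          Poly_Mapping.single (Word [g]) 1 * Poly_Mapping.single (Word gs) c"
        by (simp add: mult_single)
      then show ?case using X[OF Cons] Y[OF Cons]
        by (cases g) (simp_all add: wX.abs_eq wY.abs_eq times_weyl.abs_eq)
    qed
    then show ?case by (simp add: w)
  next
    case (add f g)
    then show ?case using assms(2) by (simp flip: plus_weyl.abs_eq)
  qed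
  then show ?thesis by (metis weyl.abs_induct)
qed


section \<open>Normal forms in the Weyl algebra\<close>

lemma sum_atMost_degree_extend:
  fixes t :: "nat \<Rightarrow> 'a::zero \<Rightarrow> 'b::comm_monoid_add"
  assumes "degree f \<le> n" "\<And>i. t i 0 = 0"
  shows "(\<Sum>i\<le>degree f. t i (coeff f i)) = (\<Sum>i\<le>n. t i (coeff f i))"
  using assms by (intro sum.mono_neutral_left) (auto simp: coeff_eq_0)

lemma wX_commute_wconst: "wX * wconst c = wconst c * wX"
  by (rule wconst_commute_wX[symmetric])

lemma wY_commute_wconst: "wY * wconst c = wconst c * wY"
  by transfer (simp add: mult_single equivp_reflp[OF equivp_weyl_rel])

lemma wpoly_0 [simp]: "wpoly 0 = 0"
  by (simp add: wpoly_def)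

lemma wpoly_pCons: "wpoly (pCons c f) = wconst c + wX * wpoly f"
proof -
  let ?t = "\<lambda>i c. wconst c * wX ^ i"
  have "wpoly (pCons c f) = (\<Sum>i\<le>Suc (degree f). ?t i (coeff (pCons c f) i))"
    unfolding wpoly_def by (rule sum_atMost_degree_extend) (simp_all add: degree_pCons_le)
  also have "\<dots> = wconst c + (\<Sum>i\<le>degree f. ?t (Suc i) (coeff f i))"
    by (subst sum.atMost_Suc_shift) simp
  also have "(\<Sum>i\<le>degree f. ?t (Suc i) (coeff f i)) = wX * wpoly f"
    unfolding wpoly_def sum_distrib_left
    by (intro sum.cong refl) (simp flip: mult.assoc add: wX_commute_wconst)
  finally show ?thesis .
qed

lemma wpoly_add: "wpoly (f + g) = wpoly f + wpoly g"
  by (induction f g rule: poly_induct2) (simp_all add: wpoly_pCons wconst_add algebra_simps)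

lemma wpoly_smult: "wpoly (smult c f) = wconst c * wpoly f"
proof (induction f)
  case (pCons a f)
  have "wX * (wconst c * wpoly f) = wconst c * (wX * wpoly f)"
    by (simp add: wX_commute_wconst flip: mult.assoc)
  then show ?case using pCons by (simp add: wpoly_pCons wconst_mult distrib_left)
qed simp

lemma wpoly_mult: "wpoly (f * g) = wpoly f * wpoly g"
  by (induction f)
    (simp_all add: wpoly_pCons wpoly_add wpoly_smult distrib_right mult.assoc)

lemma wpoly_1 [simp]: "wpoly 1 = 1"
  by (simp add: wpoly_pCons one_pCons)

lemma wpoly_const: "wpoly [:c:] = wconst c"
  by (simp add: wpoly_pCons)

lemma wpoly_X: "wpoly [:0, 1:] = wX"
  by (simp add: wpoly_pCons)

lemma wpoly_uminus: "wpoly (- f) = - wpoly f"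
  using wpoly_add[of f "- f"] by (simp add: eq_neg_iff_add_eq_0 add.commute)

lemma wpoly_power: "wpoly (f ^ n) = wpoly f ^ n"
  by (induction n) (simp_all add: wpoly_mult)

lemma wpoly_commute: "wpoly f * wpoly g = wpoly g * wpoly f"
  by (simp add: mult.commute flip: wpoly_mult)

lemma wY_wpoly: "wY * wpoly f = wpoly f * wY + wpoly (pderiv f)"
proof (induction f)
  case (pCons a f)
  have "wY * (wX * wpoly f) = (wX * wY + 1) * wpoly f"
    using weyl_relation by (metis add.commute diff_add_cancel mult.assoc)
  also have "\<dots> = wX * (wY * wpoly f) + wpoly f"
    by (simp add: distrib_right mult.assoc)
  finally show ?case
    by (simp add: wpoly_pCons distrib_left distrib_right pCons wpoly_add pderiv_pCons
        wY_commute_wconst mult.assoc add_ac)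
qed simp

text \<open>Every element is a unique sum of terms \<open>f\<^sub>j y\<^sup>j\<close> with the coefficients on the left.
Existence follows from \<open>y f = f y + f'\<close>. For uniqueness the action on \<open>F[x]\<close> does not suffice, as
\<open>y\<^sup>p\<close> acts by zero in characteristic \<open>p\<close>. Instead \<open>y\<close> acts on \<open>F[x][t]\<close> by \<open>d/dx + t\<close>: this is
left multiplication by \<open>y\<close> on normal forms, and applying an element to the constant \<open>1\<close> returns
its coefficients.\<close>

definition wnorm :: "'a::field poly poly \<Rightarrow> 'a weyl" where
  "wnorm P = (\<Sum>j\<le>degree P. wpoly (coeff P j) * wY ^ j)"

lemma wnorm_0 [simp]: "wnorm 0 = 0"
  by (simp add: wnorm_def)

lemma wnorm_pCons: "wnorm (pCons f P) = wpoly f + wnorm P * wY"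
proof -
  let ?t = "\<lambda>j f. wpoly f * wY ^ j"
  have "wnorm (pCons f P) = (\<Sum>i\<le>Suc (degree P). ?t i (coeff (pCons f P) i))"
    unfolding wnorm_def by (rule sum_atMost_degree_extend) (simp_all add: degree_pCons_le)
  also have "\<dots> = wpoly f + (\<Sum>i\<le>degree P. ?t (Suc i) (coeff P i))"
    by (subst sum.atMost_Suc_shift) simp
  also have "(\<Sum>i\<le>degree P. ?t (Suc i) (coeff P i)) = wnorm P * wY"
    unfolding wnorm_def sum_distrib_right
    by (intro sum.cong refl) (simp add: power_commutes mult.assoc)
  finally show ?thesis .
qed

lemma wnorm_add: "wnorm (P + Q) = wnorm P + wnorm Q"
  by (induction P Q rule: poly_induct2) (simp_all add: wnorm_pCons wpoly_add algebra_simps)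

lemma wnorm_smult: "wnorm (smult f P) = wpoly f * wnorm P"
  by (induction P) (simp_all add: wnorm_pCons wpoly_mult distrib_left mult.assoc)

definition ore_Y :: "'a::field poly poly \<Rightarrow> 'a poly poly" where
  "ore_Y P = map_poly pderiv P + pCons 0 P"

lemma coeff_ore_Y:
  "coeff (ore_Y P) j = pderiv (coeff P j) + (case j of 0 \<Rightarrow> 0 | Suc i \<Rightarrow> coeff P i)"
  by (simp add: ore_Y_def coeff_map_poly coeff_pCons)

lemma ore_Y_pCons: "ore_Y (pCons f P) = pCons (pderiv f) (ore_Y P + [:f:])"
  by (rule poly_eqI) (auto simp: coeff_ore_Y coeff_pCons split: nat.splits)

lemma ore_Y_0 [simp]: "ore_Y 0 = 0"
  by (simp add: ore_Y_def)

lemma wY_wnorm: "wY * wnorm P = wnorm (ore_Y P)"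
proof (induction P)
  case (pCons f P)
  have "wY * wnorm (pCons f P) = wY * wpoly f + wY * wnorm P * wY"
    by (simp add: wnorm_pCons distrib_left mult.assoc)
  also have "\<dots> = wnorm (ore_Y (pCons f P))"
    by (simp add: pCons ore_Y_pCons wnorm_pCons wnorm_add wY_wpoly distrib_right)
  finally show ?case .
qed simp

interpretation sym: weyl_action "\<lambda>c. smult [:c::'a::field:]" "smult [:0, 1:]" ore_Y
proof
  fix P :: "'a poly poly"
  show "ore_Y (smult [:0, 1:] P) - smult [:0, 1:] (ore_Y P) = P"
    by (rule poly_eqI)
      (auto simp: coeff_ore_Y pderiv_pCons pderiv_mult algebra_simps split: nat.splits)
next
  fix P Q :: "'a poly poly"
  show "ore_Y (P + Q) = ore_Y P + ore_Y Q"
    by (rule poly_eqI) (auto simp: coeff_ore_Y pderiv_add split: nat.splits)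
next
  fix c :: 'a and P
  show "ore_Y (smult [:c:] P) = smult [:c:] (ore_Y P)"
    by (rule poly_eqI)
      (auto simp: coeff_ore_Y pderiv_smult smult_add_right split: nat.splits)
next
  fix a b :: 'a and P :: "'a poly poly"
  show "smult [:a + b:] P = smult [:a:] P + smult [:b:] P"
    by (simp flip: smult_add_left)
qed (simp_all add: smult_add_right mult.commute flip: one_pCons)

definition wcoeffs :: "'a::field weyl \<Rightarrow> 'a poly poly" where
  "wcoeffs a = sym.act a 1"

lemma wcoeffs_add: "wcoeffs (a + b) = wcoeffs a + wcoeffs b"
  by (simp add: wcoeffs_def sym.act_add)

lemma act_pCons_0: "sym.act a (pCons 0 P) = pCons 0 (sym.act a P)"
proof (induction a rule: weyl_induct)
  case (Y a)
  then show ?case by (simp add: sym.act_mult sym.act_wY ore_Y_pCons)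
qed (simp_all add: sym.act_mult sym.act_add sym.act_wX sym.act_wconst)

lemma act_wpoly: "sym.act (wpoly f) P = smult f P"
proof (induction f)
  case 0
  show ?case using sym.act_wconst[of 0 P] by simp
next
  case (pCons c f)
  have "smult (pCons c f) P = smult [:c:] P + smult [:0, 1:] (smult f P)"
    by (simp flip: smult_add_left)
  then show ?case
    using pCons by (simp only: wpoly_pCons sym.act_mult sym.act_add sym.act_wX sym.act_wconst)
qed

lemma wcoeffs_wpoly_mult: "wcoeffs (wpoly f * a) = smult f (wcoeffs a)"
  by (simp add: wcoeffs_def sym.act_mult act_wpoly)

lemma wcoeffs_mult_wY: "wcoeffs (a * wY) = pCons 0 (wcoeffs a)"
  by (simp add: wcoeffs_def sym.act_mult sym.act_wY act_pCons_0 flip: act_pCons_0)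
    (simp add: one_pCons ore_Y_pCons flip: act_pCons_0)

lemma wcoeffs_wpoly: "wcoeffs (wpoly f) = [:f:]"
  by (simp add: wcoeffs_def act_wpoly one_pCons)

lemma wcoeffs_wnorm: "wcoeffs (wnorm P) = P"
proof (induction P)
  case 0
  show ?case using wcoeffs_wpoly[of 0] by simp
qed (simp add: wnorm_pCons wcoeffs_add wcoeffs_wpoly wcoeffs_mult_wY)

lemma wnorm_wcoeffs: "wnorm (wcoeffs a) = a"
proof (induction a rule: weyl_induct)
  case (const c)
  then show ?case using wcoeffs_wpoly[of "[:c:]"] by (simp add: wpoly_const wnorm_pCons)
next
  case (add a b)
  then show ?case by (simp add: wcoeffs_add wnorm_add)
next
  case (X a)
  then show ?case using wcoeffs_wpoly_mult[of "[:0, 1:]" a] wnorm_smult[of "[:0,1:]" "wcoeffs a"]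
    by (simp add: wpoly_X)
next
  case (Y a)
  have "wcoeffs (wY * a) = ore_Y (wcoeffs a)" by (simp add: wcoeffs_def sym.act_mult sym.act_wY)
  then show ?case by (simp add: Y flip: wY_wnorm)
qed

text \<open>The coefficient of \<open>y\<^sup>j\<close>. The commutator with \<open>x\<close> differentiates with respect to \<open>y\<close>, and the
commutator with \<open>y\<close> differentiates the coefficients with respect to \<open>x\<close>.\<close>

definition wc :: "'a::field weyl \<Rightarrow> nat \<Rightarrow> 'a poly" where
  "wc a j = coeff (wcoeffs a) j"

lemma wc_ext: "(\<And>j. wc a j = wc b j) \<Longrightarrow> a = b"
  by (metis poly_eqI wc_def wnorm_wcoeffs)

lemma wc_add: "wc (a + b) j = wc a j + wc b j"
  by (simp add: wc_def wcoeffs_add)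

lemma wc_0 [simp]: "wc 0 j = 0"
  by (simp add: wc_def wcoeffs_wpoly[of 0, simplified])

lemma wc_uminus: "wc (- a) j = - wc a j"
  using wc_add[of a "- a" j] by (simp add: eq_neg_iff_add_eq_0 add.commute)

lemma wc_diff: "wc (a - b) j = wc a j - wc b j"
  using wc_add[of "a - b" b j] by simp

lemma wc_sum: "wc (sum f A) j = (\<Sum>i\<in>A. wc (f i) j)"
  by (induction A rule: infinite_finite_induct) (simp_all add: wc_add)

lemma wc_wpoly_mult: "wc (wpoly f * a) j = f * wc a j"
  by (simp add: wc_def wcoeffs_wpoly_mult)

lemma wc_wpoly: "wc (wpoly f) j = (if j = 0 then f else 0)"
  by (simp add: wc_def wcoeffs_wpoly coeff_pCons split: nat.splits)

lemma wc_wX_mult: "wc (wX * a) j = [:0, 1:] * wc a j"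
  using wc_wpoly_mult[of "[:0, 1:]" a j] by (simp add: wpoly_X)

lemma wc_wconst_mult: "wc (wconst c * a) j = smult c (wc a j)"
  using wc_wpoly_mult[of "[:c:]" a j] by (simp add: wpoly_const)

lemma wc_mult_wY: "wc (a * wY) j = (if j = 0 then 0 else wc a (j - 1))"
  by (simp add: wc_def wcoeffs_mult_wY coeff_pCons split: nat.splits)

lemma wc_mult_wY_power: "wc (a * wY ^ n) j = (if j < n then 0 else wc a (j - n))"
proof (induction n arbitrary: j)
  case (Suc n)
  have "wc (a * wY ^ Suc n) j = wc (a * wY ^ n * wY) j"
    by (simp only: power_Suc2 mult.assoc)
  then show ?case by (auto simp: wc_mult_wY Suc)
qed simp

lemma wc_monomial: "wc (wpoly f * wY ^ n) j = (if j = n then f else 0)"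
  by (auto simp: wc_mult_wY_power wc_wpoly)

lemma wc_wY_mult: "wc (wY * a) j = pderiv (wc a j) + (if j = 0 then 0 else wc a (j - 1))"
proof -
  have "wcoeffs (wY * a) = ore_Y (wcoeffs a)" by (simp add: wcoeffs_def sym.act_mult sym.act_wY)
  then show ?thesis by (simp add: wc_def coeff_ore_Y split: nat.splits)
qed

lemma wc_exists:
  assumes "\<And>j. n < j \<Longrightarrow> g j = 0"
  obtains a where "\<And>j. wc a j = g j"
proof
  fix j
  show "wc (wnorm (Abs_poly g)) j = g j"
    using coeff_Abs_poly[of n g] assms by (simp add: wc_def wcoeffs_wnorm)
qed

lemma wc_bound: obtains n where "\<And>j. n < j \<Longrightarrow> wc a j = 0"
  by (rule that[of "degree (wcoeffs a)"]) (simp add: wc_def coeff_eq_0)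

lemma wc_expansion:
  assumes "\<And>j. n < j \<Longrightarrow> wc a j = 0"
  shows "a = (\<Sum>j\<le>n. wpoly (wc a j) * wY ^ j)"
  by (rule wc_ext) (use assms in \<open>auto simp: wc_sum wc_monomial not_le\<close>)

lemma wpoly_mult_cancel:
  assumes "f \<noteq> 0" "wpoly f * a = wpoly f * b"
  shows "a = b"
proof (rule wc_ext)
  fix j
  show "wc a j = wc b j"
    using arg_cong[OF assms(2), of "\<lambda>a. wc a j"] assms(1) by (simp add: wc_wpoly_mult)
qed

lemma wc_wad_wX: "wc (wad a wX) j = of_nat (Suc j) * wc a (Suc j)"
proof -
  have "wad (wnorm P) wX = wnorm (pderiv P)" for P :: "'a poly poly"
  proof (induction P)
    case (pCons f P)
    have "wad (wpoly f + wnorm P * wY) wX = wnorm P * (wY * wX - wX * wY) + wad (wnorm P) wX * wY"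
      by (simp add: wad_def algebra_simps wpoly_commute_wX)
    then show ?case
      by (simp add: wnorm_pCons pderiv_pCons wnorm_add pCons weyl_relation)
  qed (simp add: wad_def)
  from this[of "wcoeffs a"] show ?thesis
    by (simp add: wnorm_wcoeffs wc_def wcoeffs_wnorm coeff_pderiv)
qed

lemma wc_wad_wY: "wc (wad wY a) j = pderiv (wc a j)"
  by (simp add: wad_def wc_diff wc_wY_mult wc_mult_wY)


section \<open>Derivations of subalgebras of the Weyl algebra\<close>

lemma wconst_commute: "wconst c * a = a * wconst c"
proof (induction a rule: weyl_induct)
  case (const d)
  show ?case by (simp add: mult.commute flip: wconst_mult)
next
  case (X a)
  then show ?case by (metis mult.assoc wconst_commute_wX)
next
  case (Y a)
  then show ?case by (metis mult.assoc wY_commute_wconst)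
qed (simp add: distrib_left distrib_right)

lemma of_nat_weyl: "of_nat n = wconst (of_nat n)"
  by (induction n) (simp_all add: wconst_add)

lemma of_nat_CHAR_weyl: "of_nat CHAR('a) = (0 :: 'a::field weyl)"
  by (simp add: of_nat_weyl)

text \<open>Derivations of \<open>A\<close> with values in the whole Weyl algebra. The inner derivations by elements
  of the Weyl algebra are of this kind, even when they do not preserve \<open>A\<close>.\<close>

definition derivation_on :: "'a::field weyl set \<Rightarrow> ('a weyl \<Rightarrow> 'a weyl) \<Rightarrow> bool" where
  "derivation_on A D \<longleftrightarrow>
     (\<forall>a\<in>A. \<forall>b\<in>A. D (a + b) = D a + D b) \<and>
     (\<forall>c. \<forall>a\<in>A. D (wconst c * a) = wconst c * D a) \<and>
     (\<forall>a\<in>A. \<forall>b\<in>A. D (a * b) = D a * b + a * D b)"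

lemma derivation_onI:
  assumes "\<And>a b. a \<in> A \<Longrightarrow> b \<in> A \<Longrightarrow> D (a + b) = D a + D b"
    and "\<And>c a. a \<in> A \<Longrightarrow> D (wconst c * a) = wconst c * D a"
    and "\<And>a b. a \<in> A \<Longrightarrow> b \<in> A \<Longrightarrow> D (a * b) = D a * b + a * D b"
  shows "derivation_on A D"
  using assms unfolding derivation_on_def by blast

lemma derivation_onD:
  assumes "derivation_on A D"
  shows derivation_on_add: "a \<in> A \<Longrightarrow> b \<in> A \<Longrightarrow> D (a + b) = D a + D b"
    and derivation_on_scale: "a \<in> A \<Longrightarrow> D (wconst c * a) = wconst c * D a"
    and derivation_on_mult: "a \<in> A \<Longrightarrow> b \<in> A \<Longrightarrow> D (a * b) = D a * b + a * D b"
  using assms unfolding derivation_on_def by blast+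

lemma Der_iff:
  "D \<in> Der A \<longleftrightarrow> (\<forall>a. a \<notin> A \<longrightarrow> D a = 0) \<and> (\<forall>a\<in>A. D a \<in> A) \<and> derivation_on A D"
  unfolding Der_def derivation_on_def by blast

lemma derivation_on_subset: "derivation_on A D \<Longrightarrow> B \<subseteq> A \<Longrightarrow> derivation_on B D"
  unfolding derivation_on_def by blast

lemma derivation_on_wad: "derivation_on A (wad u)"
proof (rule derivation_onI)
  fix c a
  show "wad u (wconst c * a) = wconst c * wad u a"
    unfolding wad_def right_diff_distrib by (metis mult.assoc wconst_commute)
qed (simp_all add: wad_def algebra_simps)

lemma derivation_on_plus:
  "derivation_on A D \<Longrightarrow> derivation_on A E \<Longrightarrow> derivation_on A (\<lambda>a. D a + E a)"
  by (rule derivation_onI) (simp_all add: derivation_onD algebra_simps)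

lemma derivation_on_minus:
  "derivation_on A D \<Longrightarrow> derivation_on A E \<Longrightarrow> derivation_on A (\<lambda>a. D a - E a)"
  by (rule derivation_onI) (simp_all add: derivation_onD algebra_simps)

lemma derivation_on_lmult:
  assumes "derivation_on A D" "\<And>a. a \<in> A \<Longrightarrow> z * a = a * z"
  shows "derivation_on A (\<lambda>a. z * D a)"
proof (rule derivation_onI)
  fix c a assume "a \<in> A"
  then show "z * D (wconst c * a) = wconst c * (z * D a)"
    using assms(1) by (metis derivation_on_scale mult.assoc wconst_commute)
next
  fix a b assume ab: "a \<in> A" "b \<in> A"
  then have "z * D (a * b) = z * D a * b + z * a * D b"
    using assms(1) by (simp add: derivation_on_mult distrib_left mult.assoc)
  then show "z * D (a * b) = z * D a * b + a * (z * D b)"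
    using assms(2)[OF ab(1)] by (simp add: mult.assoc)
qed (simp add: derivation_on_add[OF assms(1)] distrib_left)

lemma derivation_on_cong:
  assumes "derivation_on A D" "\<And>a. a \<in> A \<Longrightarrow> D a = E a"
    "\<And>a b. a \<in> A \<Longrightarrow> b \<in> A \<Longrightarrow> a + b \<in> A" "\<And>a b. a \<in> A \<Longrightarrow> b \<in> A \<Longrightarrow> a * b \<in> A"
    "\<And>c. wconst c \<in> A"
  shows "derivation_on A E"
  using assms by (intro derivation_onI) (metis derivation_onD)+

text \<open>The derivation is read off from the representation on pairs by the matrices with rows \<open>a, 0\<close> and
\<open>D a, a\<close>. The matrices assigned to the generators satisfy the defining relation exactly when the
prescribed values are compatible with it.\<close>

lemma weyl_derivation_exists:
  fixes u v :: "'a::field weyl"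
  assumes "wad v wX = wad u wY"
  obtains D where "D \<in> Der UNIV" "D wX = u" "D wY = v"
proof -
  define sc :: "'a \<Rightarrow> 'a weyl \<times> 'a weyl \<Rightarrow> 'a weyl \<times> 'a weyl"
    where "sc = (\<lambda>c (a, b). (wconst c * a, wconst c * b))"
  define mX where "mX = (\<lambda>(a, b). (wX * a, u * a + wX * b))"
  define mY where "mY = (\<lambda>(a, b). (wY * a, v * a + wY * b))"
  have wconst_left: "a * (wconst c * b) = wconst c * (a * b)" for a b :: "'a weyl" and c
    by (simp only: wconst_commute[of c a] flip: mult.assoc)
  interpret m: weyl_action sc mX mY
  proof
    fix c and w :: "'a weyl \<times> 'a weyl"
    show "mX (sc c w) = sc c (mX w)" "mY (sc c w) = sc c (mY w)"
      by (cases w; simp add: sc_def mX_def mY_def distrib_left wconst_left[of u] wconst_left[of v]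
          wconst_left[of wX] wconst_left[of wY])+
  next
    fix w :: "'a weyl \<times> 'a weyl"
    obtain a b where w: "w = (a, b)" by (cases w)
    have yx: "wY * (wX * c) = c + wX * (wY * c)" for c :: "'a weyl"
    proof -
      have "wY * (wX * c) - wX * (wY * c) = (wY * wX - wX * wY) * c"
        by (simp only: left_diff_distrib mult.assoc)
      then show ?thesis by (simp add: weyl_relation diff_eq_eq)
    qed
    have "(v * wX - wX * v) * a = (u * wY - wY * u) * a"
      using assms by (simp add: wad_def)
    then have "v * (wX * a) - wX * (v * a) = u * (wY * a) - wY * (u * a)"
      by (simp only: left_diff_distrib mult.assoc)
    then show "mY (mX w) - mX (mY w) = w"
      by (simp add: w mX_def mY_def distrib_left yx)
        (simp add: algebra_simps)
  qed (auto simp: sc_def mX_def mY_def distrib_left distrib_right wconst_add wconst_mult mult.assoc)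
  define D where "D a = snd (m.act a (1, 0))" for a
  have act: "m.act a (b, c) = (a * b, D a * b + a * c)" for a b c
  proof (induction a arbitrary: b c rule: weyl_induct)
    case (const d)
    have "D (wconst d) = 0" unfolding D_def m.act_wconst by (simp add: sc_def)
    then show ?case unfolding m.act_wconst by (simp add: sc_def)
  next
    case (add a1 a2)
    have "D (a1 + a2) = D a1 + D a2"
      by (simp only: D_def m.act_add snd_add)
    with add show ?case by (simp add: m.act_add distrib_right)
  next
    case (X a)
    have "D (wX * a) = snd (mX (m.act a (1, 0)))"
      by (simp only: D_def m.act_mult m.act_wX)
    also have "\<dots> = u * a + wX * D a"
      unfolding X by (simp add: mX_def)
    finally have "D (wX * a) = u * a + wX * D a" .
    then show ?case
      unfolding m.act_mult m.act_wX X by (simp add: mX_def algebra_simps)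
  next
    case (Y a)
    have "D (wY * a) = snd (mY (m.act a (1, 0)))"
      by (simp only: D_def m.act_mult m.act_wY)
    also have "\<dots> = v * a + wY * D a"
      unfolding Y by (simp add: mY_def)
    finally have "D (wY * a) = v * a + wY * D a" .
    then show ?case
      unfolding m.act_mult m.act_wY Y by (simp add: mY_def algebra_simps)
  qed
  have mult: "D (a * b) = D a * b + a * D b" for a b
  proof -
    have "D (a * b) = snd (m.act a (m.act b (1, 0)))"
      by (simp only: D_def m.act_mult)
    also have "\<dots> = D a * b + a * D b"
      unfolding act by simp
    finally show ?thesis .
  qed
  show ?thesis
  proof
    have "D (wconst c) = 0" for c
      unfolding D_def m.act_wconst by (simp add: sc_def)
    then have "D (wconst c * a) = wconst c * D a" for c a
      by (simp add: mult)
    moreover have "D (a + b) = D a + D b" for a b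
      by (simp only: D_def m.act_add snd_add)
    ultimately show "D \<in> Der UNIV"
      by (simp add: Der_iff derivation_on_def mult)
    show "D wX = u" "D wY = v"
      unfolding D_def m.act_wX m.act_wY by (simp_all add: mX_def mY_def)
  qed
qed

text \<open>The recursion is that of \<open>S n = D (x\<^sup>n)\<close> for a derivation \<open>D\<close> with \<open>D x = u\<close>. Moving all powers of
\<open>x\<close> to the left gives binomial coefficients. For \<open>n = p\<close> in characteristic \<open>p\<close> only the last one
survives, so that \<open>D (x\<^sup>p)\<close> is an iterated commutator.\<close>

lemma power_rule_commutator:
  fixes x u :: "'r::ring_1" and S :: "nat \<Rightarrow> 'r"
  assumes "S 0 = 0" "\<And>n. S (Suc n) = S n * x + x ^ n * u"
  shows "S n = (\<Sum>i<n. of_nat (n choose Suc i) * x ^ (n - Suc i) * ((\<lambda>v. v * x - x * v) ^^ i) u)"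
proof (induction n)
  case (Suc n)
  define d where "d i = ((\<lambda>v. v * x - x * v) ^^ i) u" for i
  have step: "d i * x = x * d i + d (Suc i)" for i
    by (simp add: d_def)
  have d_0: "d 0 = u"
    by (simp add: d_def)
  have "S n * x = (\<Sum>i<n. of_nat (n choose Suc i) * x ^ (n - Suc i) * (d i * x))"
    unfolding Suc d_def by (simp only: sum_distrib_right mult.assoc)
  also have "\<dots> = (\<Sum>i<n. of_nat (n choose Suc i) * x ^ (n - i) * d i) +
      (\<Sum>i<n. of_nat (n choose Suc i) * x ^ (n - Suc i) * d (Suc i))"
    unfolding sum.distrib[symmetric]
  proof (intro sum.cong refl)
    fix i assume "i \<in> {..<n}"
    then have "x ^ (n - i) = x ^ (n - Suc i) * x"
      by (metis Suc_diff_Suc lessThan_iff power_Suc2)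
    then show "of_nat (n choose Suc i) * x ^ (n - Suc i) * (d i * x) =
        of_nat (n choose Suc i) * x ^ (n - i) * d i +
        of_nat (n choose Suc i) * x ^ (n - Suc i) * d (Suc i)"
      by (simp only: step distrib_left mult.assoc)
  qed
  finally have "S (Suc n) = (\<Sum>i<n. of_nat (n choose Suc i) * x ^ (n - i) * d i) +
      ((\<Sum>i<n. of_nat (n choose Suc i) * x ^ (n - Suc i) * d (Suc i)) + x ^ n * u)"
    by (simp only: assms(2) add.assoc)
  also have "(\<Sum>i<n. of_nat (n choose Suc i) * x ^ (n - Suc i) * d (Suc i)) + x ^ n * u =
      (\<Sum>i<Suc n. of_nat (n choose i) * x ^ (n - i) * d i)"
    by (subst sum.lessThan_Suc_shift) (simp add: d_0)
  also have "(\<Sum>i<n. of_nat (n choose Suc i) * x ^ (n - i) * d i) =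
      (\<Sum>i<Suc n. of_nat (n choose Suc i) * x ^ (n - i) * d i)"
    by (simp only: sum.lessThan_Suc binomial_eq_0[OF lessI]) simp
  also have "\<dots> + (\<Sum>i<Suc n. of_nat (n choose i) * x ^ (n - i) * d i) =
      (\<Sum>i<Suc n. of_nat (Suc n choose Suc i) * x ^ (n - i) * d i)"
    unfolding sum.distrib[symmetric] by (intro sum.cong refl) (simp add: distrib_right add.commute)
  finally show ?case by (simp only: d_def diff_Suc_Suc)
qed (simp add: assms)

lemma prime_power_rule_commutator:
  fixes x u :: "'r::ring_1" and S :: "nat \<Rightarrow> 'r"
  assumes "S 0 = 0" "\<And>n. S (Suc n) = S n * x + x ^ n * u"
    and p: "prime p" "of_nat p = (0::'r)"
  shows "S p = ((\<lambda>v. v * x - x * v) ^^ (p - 1)) u"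
proof -
  have *: "of_nat (p choose k) = (0::'r)" if "0 < k" "k < p" for k
  proof -
    have "p dvd (p choose k)" using that p(1) by (intro dvd_choose_prime) auto
    then obtain m where "p choose k = p * m" by blast
    then show ?thesis by (simp add: p(2))
  qed
  have p0: "0 < p" using p(1) by (rule prime_gt_0_nat)
  have middle: "of_nat (p choose Suc i) * x ^ (p - Suc i) * ((\<lambda>v. v * x - x * v) ^^ i) u =
      (if i = p - 1 then ((\<lambda>v. v * x - x * v) ^^ (p - 1)) u else 0)" if "i < p" for i
  proof (cases "i = p - 1")
    case True
    then have "Suc i = p" using p0 by simp
    then have "of_nat (p choose Suc i) * x ^ (p - Suc i) = 1" by simp
    then show ?thesis using True by simp
  next
    case False
    then show ?thesis using *[of "Suc i"] that by simp
  qed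
  have "S p = (\<Sum>i<p. of_nat (p choose Suc i) * x ^ (p - Suc i) *
      ((\<lambda>v. v * x - x * v) ^^ i) u)"
    by (rule power_rule_commutator) (rule assms)+
  also have "\<dots> = (\<Sum>i<p. if i = p - 1 then ((\<lambda>v. v * x - x * v) ^^ (p - 1)) u else 0)"
    by (rule sum.cong[OF refl]) (simp only: lessThan_iff middle)
  also have "\<dots> = ((\<lambda>v. v * x - x * v) ^^ (p - 1)) u"
    by (subst sum.delta) (simp_all add: p0)
  finally show ?thesis .
qed

section \<open>The subalgebras \<open>A\<^sub>h\<close>\<close>

lemma Ah_0: "0 \<in> Ah h" and Ah_1: "1 \<in> Ah h"
  using Ah.const[of 0 h] Ah.const[of 1 h] by simp_all

lemma Ah_uminus: "a \<in> Ah h \<Longrightarrow> - a \<in> Ah h"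
  using Ah.mult[OF Ah.const[of "-1"]] by (simp add: wconst_uminus)

lemma Ah_diff: "a \<in> Ah h \<Longrightarrow> b \<in> Ah h \<Longrightarrow> a - b \<in> Ah h"
  using Ah.add[OF _ Ah_uminus, of a h b] by simp

lemma Ah_sum: "(\<And>i. i \<in> I \<Longrightarrow> f i \<in> Ah h) \<Longrightarrow> sum f I \<in> Ah h"
  by (induction I rule: infinite_finite_induct) (auto intro: Ah_0 Ah.add)

lemma Ah_wpoly: "wpoly f \<in> Ah h"
  by (induction f) (auto simp: wpoly_pCons intro: Ah_0 Ah.intros)

lemma Ah_power: "a \<in> Ah h \<Longrightarrow> a ^ n \<in> Ah h"
  by (induction n) (auto intro: Ah_1 Ah.mult)

lemma yhat_eq: "yhat h = wpoly h * wY + wpoly (pderiv h)"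
  by (simp add: yhat_def wY_wpoly)

lemma yhat_mult: "yhat h * a = wpoly h * (wY * a) + wpoly (pderiv h) * a"
  by (simp add: yhat_eq distrib_right mult.assoc)

lemma power_dvd_mult_pderiv:
  fixes f h :: "'a::field poly"
  assumes "h ^ j dvd f"
  shows "h ^ j dvd h * pderiv f"
proof -
  obtain g where f: "f = h ^ j * g" using assms by (elim dvdE)
  show ?thesis
  proof (cases j)
    case (Suc n)
    have "h * pderiv f = h ^ j * (h * pderiv g + of_nat j * pderiv h * g)"
      unfolding f Suc pderiv_mult pderiv_power_Suc
      by (simp add: algebra_simps of_nat_poly smult_add_left)
    then show ?thesis by simp
  qed simp
qed

text \<open>Left multiplication by \<open>yhat h = h y + h'\<close> turns \<open>f y\<^sup>j\<close> into
\<open>h f y\<^sup>j\<^sup>+\<^sup>1 + (h f' + h' f) y\<^sup>j\<close>, and \<open>h f'\<close> is divisible by \<open>h\<^sup>j\<close> along with \<open>f\<close>; so the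
divisibility condition is preserved. Conversely \<open>h\<^sup>j\<^sup>+\<^sup>1 y\<^sup>j\<^sup>+\<^sup>1\<close> is
\<open>(h y) (h\<^sup>j y\<^sup>j) - j h' h\<^sup>j y\<^sup>j\<close>, hence all monomials \<open>h\<^sup>j y\<^sup>j\<close> belong to the subalgebra.\<close>

lemma Ah_iff: "a \<in> Ah h \<longleftrightarrow> (\<forall>j. h ^ j dvd wc a j)"
proof
  assume "a \<in> Ah h"
  then have "\<forall>j. h ^ j dvd wc (a * b) j" if "\<forall>j. h ^ j dvd wc b j" for b
    using that
  proof (induction arbitrary: b rule: Ah.induct)
    case x
    then show ?case by (simp add: wc_wX_mult del: mult_pCons_left)
  next
    case yhat
    have "h ^ j dvd h * wc b (j - 1)" if "j \<noteq> 0" for j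
      using yhat[rule_format, of "j - 1"] that by (cases j) auto
    with yhat show ?case
      by (auto simp: yhat_mult wc_add wc_wpoly_mult wc_wY_mult distrib_left
          intro!: dvd_add power_dvd_mult_pderiv)
  next
    case (add a1 a2)
    then show ?case by (auto simp: distrib_right wc_add)
  next
    case (mult a1 a2)
    then show ?case by (simp add: mult.assoc)
  qed (auto simp: wc_wconst_mult intro: dvd_smult)
  from this[of 1] show "\<forall>j. h ^ j dvd wc a j"
    by (simp add: wc_wpoly[of 1, simplified])
next
  assume *: "\<forall>j. h ^ j dvd wc a j"
  have monom: "wpoly (h ^ j) * wY ^ j \<in> Ah h" for j
  proof (induction j)
    case (Suc j)
    have "wpoly h * wY \<in> Ah h"
      using Ah_diff[OF Ah.yhat[of h] Ah_wpoly[of "pderiv h"]] by (simp add: yhat_eq)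
    then have "(wpoly h * wY) * (wpoly (h ^ j) * wY ^ j) -
        wpoly (of_nat j * pderiv h) * (wpoly (h ^ j) * wY ^ j) \<in> Ah h"
      by (rule Ah_diff[OF Ah.mult[OF _ Suc] Ah.mult[OF Ah_wpoly Suc]])
    also have "(wpoly h * wY) * (wpoly (h ^ j) * wY ^ j) -
        wpoly (of_nat j * pderiv h) * (wpoly (h ^ j) * wY ^ j) = wpoly (h ^ Suc j) * wY ^ Suc j"
    proof -
      have "h * pderiv (h ^ j) = of_nat j * pderiv h * h ^ j"
      proof (cases j)
        case (Suc n)
        show ?thesis
          unfolding Suc pderiv_power_Suc by (simp add: of_nat_poly mult_ac)
      qed simp
      then have e: "wpoly h * wpoly (pderiv (h ^ j)) = wpoly (of_nat j * pderiv h) * wpoly (h ^ j)"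
        by (metis wpoly_mult)
      have "(wpoly h * wY) * (wpoly (h ^ j) * wY ^ j) =
          wpoly h * (wY * wpoly (h ^ j)) * wY ^ j" by (simp only: mult.assoc)
      also have "\<dots> = wpoly h * wpoly (h ^ j) * (wY * wY ^ j) +
          wpoly h * wpoly (pderiv (h ^ j)) * wY ^ j"
        by (simp only: wY_wpoly distrib_left distrib_right mult.assoc)
      finally show ?thesis by (simp add: e wpoly_mult mult.assoc)
    qed
    finally show ?case .
  qed (simp_all add: Ah_1)
  obtain n where n: "\<And>j. n < j \<Longrightarrow> wc a j = 0" using wc_bound[of a] by blast
  have "wpoly (wc a j) * wY ^ j \<in> Ah h" for j
  proof -
    obtain g where "wc a j = g * h ^ j" using *[rule_format, of j] by (metis dvdE mult.commute)
    then show ?thesis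
      using Ah.mult[OF Ah_wpoly[of g] monom[of j]] by (simp add: wpoly_mult mult.assoc)
  qed
  then have "(\<Sum>j\<le>n. wpoly (wc a j) * wY ^ j) \<in> Ah h"
    by (intro Ah_sum)
  then show "a \<in> Ah h"
    using wc_expansion[of n a, OF n] by simp
qed

text \<open>The Weyl algebra is the case \<open>h = 1\<close>, so statements about derivations of \<open>A\<^sub>h\<close> apply to it.\<close>

lemma Ah_one: "Ah 1 = UNIV"
  by (auto simp: Ah_iff)

lemma derivation_on_wconst:
  assumes "derivation_on (Ah h) D"
  shows "D (wconst c) = 0"
proof -
  have "D 1 = 0"
    using derivation_on_mult[OF assms Ah_1 Ah_1] by simp
  then show ?thesis
    using derivation_on_scale[OF assms Ah_1, of c] by simp
qed

lemma derivation_on_Ah_eq: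
  assumes "derivation_on (Ah h) D" "derivation_on (Ah h) E"
    and "D wX = E wX" "D (yhat h) = E (yhat h)" "a \<in> Ah h"
  shows "D a = E a"
  using assms(5)
proof (induction rule: Ah.induct)
  case (const c)
  show ?case using assms by (simp add: derivation_on_wconst)
next
  case (add a b)
  then show ?case using assms(1,2) by (simp add: derivation_on_add)
next
  case (mult a b)
  then show ?case using assms(1,2) by (simp add: derivation_on_mult)
qed (use assms in auto)

lemma Der_Ah_eqI:
  assumes "D \<in> Der (Ah h)" "E \<in> Der (Ah h)" "D wX = E wX" "D (yhat h) = E (yhat h)"
  shows "D = E"
proof
  fix a
  show "D a = E a"
    using assms derivation_on_Ah_eq[of h D E a] by (cases "a \<in> Ah h") (auto simp: Der_iff)
qed

lemma restr_in_Der: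
  assumes "derivation_on (Ah h) D" "D wX \<in> Ah h" "D (yhat h) \<in> Ah h"
  shows "restr (Ah h) D \<in> Der (Ah h)"
proof -
  have "D a \<in> Ah h" if "a \<in> Ah h" for a
    using that
  proof (induction rule: Ah.induct)
    case (const c)
    show ?case using derivation_on_wconst[OF assms(1)] by (simp add: Ah_0)
  qed (use assms in \<open>auto simp: derivation_onD[OF assms(1)] intro!: Ah.add Ah.mult\<close>)
  moreover have "derivation_on (Ah h) (restr (Ah h) D)"
    by (rule derivation_on_cong[OF assms(1)]) (auto simp: restr_def intro: Ah.intros)
  ultimately show ?thesis by (auto simp: Der_iff restr_def)
qed

lemma derivation_on_wpoly_zero:
  assumes "derivation_on (Ah h) D" "D wX = 0"
  shows "D (wpoly f) = 0"
proof (induction f)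
  case (pCons c f)
  then show ?case
    by (simp add: wpoly_pCons derivation_onD[OF assms(1)] derivation_on_wconst[OF assms(1)]
        Ah.intros Ah_wpoly assms(2))
qed (use derivation_on_wconst[OF assms(1), of 0] in simp)

text \<open>The element \<open>h\<close> is normal in \<open>A\<^sub>h\<close>, so its right multiples form a two-sided ideal. This ideal
contains the commutator \<open>h\<close> of the two generators, and therefore all commutators.\<close>

lemma Ah_mult_h:
  assumes "a \<in> Ah h" obtains b where "b \<in> Ah h" "a * wpoly h = wpoly h * b"
proof -
  from assms have "\<exists>b\<in>Ah h. a * wpoly h = wpoly h * b"
  proof (induction rule: Ah.induct)
    case x
    then show ?case by (metis Ah.x wpoly_commute_wX)
  next
    case yhat
    have "yhat h * wpoly h = wpoly h * (yhat h + wpoly (pderiv h))"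
      by (simp add: yhat_eq wY_wpoly distrib_left distrib_right mult.assoc
          wpoly_commute[of "pderiv h"])
    then show ?case by (metis Ah.add Ah.yhat Ah_wpoly)
  next
    case (const c)
    then show ?case by (metis Ah.const wconst_commute)
  next
    case (add a b)
    then show ?case by (metis Ah.add distrib_left distrib_right)
  next
    case (mult a b)
    then show ?case by (metis Ah.mult mult.assoc)
  qed
  then show ?thesis using that by blast
qed

lemma Ah_commutator:
  assumes "a \<in> Ah h" "b \<in> Ah h" obtains c where "c \<in> Ah h" "wad a b = wpoly h * c"
proof -
  define J where "J = {wpoly h * c | c. c \<in> Ah h}"
  have J_add: "c + d \<in> J" if "c \<in> J" "d \<in> J" for c d
  proof -
    from that obtain c' d' where "c' \<in> Ah h" "d' \<in> Ah h" "c = wpoly h * c'" "d = wpoly h * d'"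
      unfolding J_def by blast
    then have "c + d = wpoly h * (c' + d')" "c' + d' \<in> Ah h"
      by (simp_all add: distrib_left Ah.add)
    then show ?thesis unfolding J_def by blast
  qed
  have J_uminus: "- c \<in> J" if "c \<in> J" for c
  proof -
    from that obtain c' where "c' \<in> Ah h" "c = wpoly h * c'"
      unfolding J_def by blast
    then have "- c = wpoly h * (- c')" "- c' \<in> Ah h"
      by (simp_all add: Ah_uminus)
    then show ?thesis unfolding J_def by blast
  qed
  have J_right: "c * d \<in> J" if "c \<in> J" "d \<in> Ah h" for c d
  proof -
    from that obtain c' where "c' \<in> Ah h" "c = wpoly h * c'"
      unfolding J_def by blast
    then have "c * d = wpoly h * (c' * d)" "c' * d \<in> Ah h"
      using that(2) by (simp_all add: mult.assoc Ah.mult)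
    then show ?thesis unfolding J_def by blast
  qed
  have J_left: "d * c \<in> J" if "c \<in> J" "d \<in> Ah h" for c d
  proof -
    from that obtain c' where c': "c' \<in> Ah h" "c = wpoly h * c'"
      unfolding J_def by blast
    from that(2) obtain d' where d': "d' \<in> Ah h" "d * wpoly h = wpoly h * d'"
      by (rule Ah_mult_h)
    have "d * c = (d * wpoly h) * c'" by (simp only: c' mult.assoc)
    also have "\<dots> = wpoly h * (d' * c')" by (simp only: d' mult.assoc)
    finally have "d * c = wpoly h * (d' * c')" .
    with Ah.mult[OF d'(1) c'(1)] show ?thesis unfolding J_def by blast
  qed
  have J_0: "0 \<in> J"
    using Ah_0[of h] mult_zero_right[of "wpoly h"] unfolding J_def by (metis (mono_tags, lifting) mem_Collect_eq)
  have anti: "wad c d = - wad d c" for c d :: "'a weyl" by (simp add: wad_def)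
  have by_generators: "wad c d \<in> J" if "wad c wX \<in> J" "wad c (yhat h) \<in> J" "d \<in> Ah h" for c d
    using that(3)
  proof (induction rule: Ah.induct)
    case (const k)
    have "wad c (wconst k) = 0" by (simp add: wad_def wconst_commute[of k c])
    then show ?case using J_0 by simp
  next
    case (add a b)
    have "wad c (a + b) = wad c a + wad c b"
      by (simp add: wad_def algebra_simps)
    then show ?case using J_add[OF add.IH] by simp
  next
    case (mult a b)
    have "wad c (a * b) = wad c a * b + a * wad c b"
      by (simp add: wad_def algebra_simps)
    then show ?case
      using J_add[OF J_right[OF mult.IH(1) mult.hyps(2)] J_left[OF mult.IH(2) mult.hyps(1)]] by simp
  qed (rule that)+
  have yx: "wad (yhat h) wX \<in> J"
  proof -
    have "wad (yhat h) wX = wpoly h * 1" by (simp add: wad_def Ah_relation)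
    with Ah_1[of h] show ?thesis unfolding J_def by blast
  qed
  have xy: "wad wX (yhat h) \<in> J"
    using J_uminus[OF yx] by (simp add: wad_def)
  have self: "wad c c \<in> J" for c :: "'a weyl" using J_0 by (simp add: wad_def)
  have "wad wX a \<in> J" by (rule by_generators[OF self xy assms(1)])
  moreover have "wad (yhat h) a \<in> J" by (rule by_generators[OF yx self assms(1)])
  ultimately have "wad a wX \<in> J" "wad a (yhat h) \<in> J"
    using J_uminus anti[of a] by simp_all
  then have "wad a b \<in> J" using assms(2) by (rule by_generators)
  then show ?thesis using that unfolding J_def by blast
qed

lemma commutes_wpoly:
  assumes "wad z wX = 0"
  shows "z * wpoly f = wpoly f * z"
proof (induction f)
  case (pCons c f)
  have "z * wX = wX * z" using assms by (simp add: wad_def)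
  then show ?case using pCons
    by (simp add: wpoly_pCons distrib_left distrib_right) (metis mult.assoc wconst_commute)
qed simp

lemma weyl_center_UNIV_iff: "z \<in> weyl_center UNIV \<longleftrightarrow> wad z wX = 0 \<and> wad wY z = 0"
proof
  assume *: "wad z wX = 0 \<and> wad wY z = 0"
  have "z * a = a * z" for a
  proof (induction a rule: weyl_induct)
    case (X a)
    then show ?case using * by (metis eq_iff_diff_eq_0 mult.assoc wad_def)
  next
    case (Y a)
    then show ?case using * by (metis eq_iff_diff_eq_0 mult.assoc wad_def)
  qed (simp_all add: wconst_commute algebra_simps)
  then show "z \<in> weyl_center UNIV" by (simp add: weyl_center_def)
qed (simp add: weyl_center_def wad_def)

lemma wad_yhat_commuting:
  assumes "wad z wX = 0"
  shows "wad z (yhat h) = - (wpoly h * wad wY z)"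
  using commutes_wpoly[OF assms, of h] commutes_wpoly[OF assms, of "pderiv h"]
  by (simp add: yhat_eq wad_def algebra_simps) (metis mult.assoc)

text \<open>An element that commutes with \<open>x\<close> commutes with \<open>h\<close>, so its commutator with \<open>yhat h = y h\<close> is a
multiple by \<open>h\<close> of its commutator with \<open>y\<close>. As \<open>h\<close> can be cancelled, the centre of \<open>A\<^sub>h\<close> consists of
central elements of the Weyl algebra.\<close>

lemma weyl_center_Ah:
  assumes "h \<noteq> 0"
  shows "weyl_center (Ah h) = Ah h \<inter> weyl_center UNIV"
proof -
  have "z \<in> weyl_center UNIV" if z: "z \<in> weyl_center (Ah h)" for z
  proof -
    have x: "wad z wX = 0" and "wad z (yhat h) = 0"
      using z by (auto simp: weyl_center_def wad_def Ah.intros)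
    then have "wpoly h * wad wY z = wpoly h * 0"
      using wad_yhat_commuting[OF x, of h] by simp
    then have "wad wY z = 0" using assms wpoly_mult_cancel by blast
    with x show ?thesis by (simp add: weyl_center_UNIV_iff)
  qed
  then show ?thesis by (auto simp: weyl_center_def)
qed

lemma weyl_center_UNIV_mult: "z \<in> weyl_center UNIV \<Longrightarrow> z * a = a * z"
  by (simp add: weyl_center_def)


section \<open>The ring \<open>F[x]\<close> over the subring \<open>F[x\<^sup>p]\<close>\<close>

lemma bezout_euclidean_ring:
  fixes a b :: "'r::euclidean_ring"
  obtains g s t where "g = s * a + t * b" "g dvd a" "g dvd b"
proof -
  have "\<exists>g s t. g = s * a + t * b \<and> g dvd a \<and> g dvd b"
  proof (induction "euclidean_size b" arbitrary: a b rule: less_induct)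
    case less
    show ?case
    proof (cases "b = 0")
      case True
      then have "a = 1 * a + 0 * b \<and> a dvd a \<and> a dvd b" by simp
      then show ?thesis by blast
    next
      case False
      then have "euclidean_size (a mod b) < euclidean_size b" by (rule mod_size_less)
      then obtain g s t where g: "g = s * b + t * (a mod b)" "g dvd b" "g dvd a mod b"
        using less by metis
      have "g = t * a + (s - t * (a div b)) * b"
        using g(1) by (simp add: algebra_simps flip: minus_div_mult_eq_mod)
      moreover have "g dvd a"
        using dvd_add[OF dvd_mult[OF g(2), of "a div b"] g(3)] by simp
      ultimately show ?thesis using g(2) by blast
    qed
  qed
  then show ?thesis using that by blast
qed

lemma at_xp_0 [simp]: "at_xp p 0 = 0"
  and at_xp_add: "at_xp p (f + g) = at_xp p f + at_xp p g"
  and at_xp_mult: "at_xp p (f * g) = at_xp p f * at_xp p g"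
  by (simp_all add: at_xp_def pcompose_add pcompose_mult)

lemma at_xp_pCons: "at_xp p (pCons c f) = [:c:] + monom 1 p * at_xp p f"
  by (simp add: at_xp_def pcompose_pCons)

lemma higher_pderiv_const_mult:
  fixes c f :: "'a::field poly"
  assumes "pderiv c = 0"
  shows "(pderiv ^^ n) (c * f) = c * (pderiv ^^ n) f"
  by (induction n) (simp_all add: pderiv_mult assms)

lemma pderiv_power_zero:
  fixes c :: "'a::field poly"
  assumes "pderiv c = 0"
  shows "pderiv (c ^ n) = 0"
  by (induction n) (simp_all add: pderiv_mult assms)

lemma monic_dvd_antisym:
  fixes f g :: "'a::field poly"
  assumes "f dvd g" "g dvd f" "lead_coeff f = 1" "lead_coeff g = 1"
  shows "f = g"
proof -
  obtain c where c: "g = f * c" using assms(1) by blast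
  have nz: "f \<noteq> 0" "g \<noteq> 0" using assms(3,4) by auto
  then have "degree f = degree g"
    using assms(1,2) by (intro antisym dvd_imp_degree_le)
  then have "degree c = 0" using nz by (simp add: c degree_mult_eq)
  moreover have "lead_coeff c = 1" using assms(3,4) by (simp add: c lead_coeff_mult)
  ultimately have "c = 1" by (metis monom_0 monom_eq_1 degree_0_id)
  then show ?thesis by (simp add: c)
qed

text \<open>The dummy parameter fixes the field whose characteristic is \<open>p\<close>.\<close>

locale positive_char =
  fixes p :: nat and ty :: "'a::field itself"
  assumes char: "CHAR('a) = p" and p_pos: "p > 0"
begin

lemma prime_p: "prime p"
  using prime_CHAR_semidom[where ?'a = 'a] p_pos char by simp

lemma of_nat_eq_0: "of_nat n = (0 :: 'a) \<longleftrightarrow> p dvd n"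
  using of_nat_eq_0_iff_char_dvd[where ?'a = 'a] char by simp

lemma of_nat_p_weyl: "of_nat p = (0 :: 'a weyl)"
  using of_nat_CHAR_weyl[where ?'a = 'a] char by simp

text \<open>In characteristic \<open>p\<close> the subring \<open>F[x\<^sup>p]\<close> is the kernel of the derivative; membership is
therefore inherited by exact quotients.\<close>

lemma Fxp_iff: "f \<in> Fxp p \<longleftrightarrow> pderiv (f :: 'a poly) = 0"
proof
  assume "f \<in> Fxp p"
  then obtain g where f: "f = at_xp p g" by (auto simp: Fxp_def)
  show "pderiv f = 0"
  proof (rule poly_eqI)
    fix n
    have "of_nat (Suc n) = (0 :: 'a)" if "p dvd Suc n" using that by (simp only: of_nat_eq_0)
    then show "coeff (pderiv f) n = coeff 0 n"
      unfolding f coeff_pderiv coeff_at_xp[OF p_pos] by auto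
  qed
next
  assume *: "pderiv f = 0"
  have "f = at_xp p (xp_part p 0 f)"
  proof (rule poly_eqI)
    fix n
    show "coeff f n = coeff (at_xp p (xp_part p 0 f)) n"
    proof (cases "p dvd n")
      case True
      then show ?thesis by (simp add: coeff_at_xp coeff_xp_part p_pos)
    next
      case False
      then obtain m where m: "n = Suc m" by (cases n) auto
      have "of_nat (Suc m) * coeff f (Suc m) = 0"
        using * by (metis coeff_0 coeff_pderiv)
      then show ?thesis
        using False of_nat_eq_0[of "Suc m"] by (simp add: m coeff_at_xp p_pos del: of_nat_Suc)
    qed
  qed
  then show "f \<in> Fxp p" by (simp add: Fxp_def)
qed

lemma pderiv_power_p: "pderiv ((f :: 'a poly) ^ p) = 0"
proof -
  have "of_nat p = (0 :: 'a)" by (simp add: of_nat_eq_0)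
  then show ?thesis by (simp add: pderiv_power)
qed

lemma pderiv_quotient_zero:
  fixes b c :: "'a poly"
  assumes "pderiv (b * c) = 0" "pderiv b = 0" "b \<noteq> 0"
  shows "pderiv c = 0"
  using assms by (simp add: pderiv_mult)

lemma of_nat_fact_p: "of_nat (fact (p - 1)) = (-1 :: 'a)"
proof -
  have "[fact (p - 1) = - 1] (mod int p)" using wilson_theorem[OF prime_p] .
  then have "int p dvd fact (p - 1) + 1" by (simp add: cong_iff_dvd_diff)
  then have "p dvd fact (p - 1) + 1"
    by (metis of_nat_1 of_nat_add of_nat_dvd_iff of_nat_fact)
  then have "of_nat (fact (p - 1) + 1) = (0 :: 'a)" by (simp only: of_nat_eq_0)
  then show ?thesis by (simp add: eq_neg_iff_add_eq_0 add.commute)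
qed

lemma pochhammer_p: "pochhammer (of_nat (Suc n)) (p - 1) = (if p dvd n then -1 else (0 :: 'a))"
proof (cases "p dvd n")
  case True
  then have "of_nat (Suc n) = (1 :: 'a)" using of_nat_eq_0[of n] by simp
  then have "pochhammer (of_nat (Suc n) :: 'a) (p - 1) = pochhammer (of_nat 1) (p - 1)"
    by simp
  also have "\<dots> = - 1"
    by (simp only: pochhammer_of_nat of_nat_fact_p flip: pochhammer_fact)
  finally show ?thesis using True by simp
next
  case False
  \<comment> \<open>One of the \<open>p - 1\<close> consecutive factors starting at \<open>n + 1\<close> is divisible by \<open>p\<close>.\<close>
  define k where "k = p - 1 - n mod p"
  have m: "n mod p < p" "0 < n mod p" using p_pos False by (auto simp: dvd_eq_mod_eq_0)
  then have "Suc n + k = n - n mod p + p" by (simp add: k_def)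
  then have "p dvd Suc n + k" by (simp add: minus_mod_eq_mult_div)
  then have "of_nat (Suc n + k) = (0 :: 'a)" by (simp only: of_nat_eq_0)
  moreover have "k < p - 1" using m by (simp add: k_def)
  ultimately have "pochhammer (of_nat (Suc n) :: 'a) (p - 1) = 0"
    unfolding pochhammer_prod by (intro prod_zero bexI[of _ k]) (auto simp: add.assoc)
  then show ?thesis using False by simp
qed

text \<open>By Wilson's theorem, the derivative of order \<open>p - 1\<close> is, up to sign, the projection of
\<open>f = \<Sum>\<^sub>i f\<^sub>i x\<^sup>i\<close> onto the component \<open>f\<^sub>p\<^sub>-\<^sub>1\<close>. Its kernel is the image of the derivative, since the
exponents congruent to \<open>-1\<close> are exactly those that integration cannot reach.\<close>

lemma coeff_higher_pderiv_p:
  "coeff ((pderiv ^^ (p - 1)) f) n = (if p dvd n then - coeff f (n + (p - 1)) else (0 :: 'a))"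
  by (simp add: coeff_higher_pderiv pochhammer_p del: of_nat_Suc One_nat_def)

lemma higher_pderiv_p_zero:
  assumes "(pderiv ^^ (p - 1)) (f :: 'a poly) = 0" obtains g where "f = pderiv g"
proof
  define g where "g = Abs_poly (\<lambda>n. case n of 0 \<Rightarrow> 0 | Suc m \<Rightarrow> coeff f m / of_nat n)"
  have g: "coeff g (Suc m) = coeff f m / of_nat (Suc m)" for m
    unfolding g_def
    by (subst coeff_Abs_poly[where n = "Suc (degree f)"])
      (auto split: nat.split simp: coeff_eq_0)
  show "f = pderiv g"
  proof (rule poly_eqI)
    fix m
    have "coeff f m = 0" if "p dvd Suc m"
    proof -
      obtain k where k: "Suc m = p * k" using \<open>p dvd Suc m\<close> by blast
      then obtain l where "k = Suc l" by (cases k) auto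
      then have "m = p * l + (p - 1)" using k p_pos by (simp add: algebra_simps)
      then show ?thesis
        using arg_cong[OF assms, of "\<lambda>f. coeff f (p * l)"]
        by (simp add: coeff_higher_pderiv_p del: One_nat_def)
    qed
    then show "coeff f m = coeff (pderiv g) m"
      using of_nat_eq_0[of "Suc m"] by (auto simp: coeff_pderiv g simp del: of_nat_Suc)
  qed
qed

lemma pderiv_higher_pderiv_p: "pderiv ((pderiv ^^ (p - 1)) (f :: 'a poly)) = 0"
proof (rule poly_eqI)
  fix n
  show "coeff (pderiv ((pderiv ^^ (p - 1)) f)) n = coeff 0 n"
    using of_nat_eq_0[of "Suc n"]
    by (simp add: coeff_pderiv coeff_higher_pderiv_p del: of_nat_Suc One_nat_def)
qed

lemma coeff_dp: "coeff (dp p f) n = of_nat (Suc (n div p)) * coeff (f :: 'a poly) (n + p)"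
proof -
  have "coeff (at_xp p (pderiv (xp_part p i f)) * monom 1 i) n =
      (if n mod p = i then of_nat (Suc (n div p)) * coeff f (n + p) else 0)" if "i < p" for i
  proof -
    have *: "p dvd n - i \<and> i \<le> n \<longleftrightarrow> n mod p = i"
      using that by (metis mod_eq_dvd_iff_nat mod_less mod_less_eq_dividend)
    show ?thesis
    proof (cases "n mod p = i")
      case True
      define d where "d = n div p"
      have n: "n = i + p * d" using True by (simp add: d_def flip: True)
      have "(n - i) div p = d" using p_pos by (simp add: n)
      with True * show ?thesis
        using p_pos \<open>i < p\<close>
        by (simp add: mult.commute[of _ "monom 1 i"] coeff_monom_mult coeff_at_xp coeff_xp_part
            coeff_pderiv n algebra_simps)
    next
      case False
      with * show ?thesis
        using p_pos by (auto simp: mult.commute[of _ "monom 1 i"] coeff_monom_mult coeff_at_xp)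
    qed
  qed
  then show ?thesis
    unfolding dp_def coeff_sum using p_pos by simp
qed

text \<open>The operator \<open>dp p\<close> does not commute with multiplication by \<open>x\<close>: this moves the component of index
\<open>p - 1\<close> to \<open>x\<^sup>p\<close>, whose derivative with respect to \<open>x\<^sup>p\<close> contributes that component once more.\<close>

lemma dp_x_mult: "dp p ([:0, 1:] * f) = [:0, 1:] * dp p f - (pderiv ^^ (p - 1)) (f :: 'a poly)"
proof (rule poly_eqI)
  fix n
  show "coeff (dp p ([:0, 1:] * f)) n = coeff ([:0, 1:] * dp p f - (pderiv ^^ (p - 1)) f) n"
  proof (cases n)
    case 0
    then show ?thesis
      using p_pos Suc_pred[OF p_pos]
      by (auto simp: coeff_dp coeff_higher_pderiv_p coeff_pCons simp del: One_nat_def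
          split: nat.splits)
  next
    case (Suc m)
    show ?thesis
    proof (cases "p dvd Suc m")
      case True
      then have "Suc m div p = Suc (m div p)" by (simp add: div_Suc dvd_eq_mod_eq_0)
      moreover have "Suc (m + (p - 1)) = m + p" using p_pos by simp
      ultimately show ?thesis
        using True by (simp add: coeff_dp coeff_higher_pderiv_p coeff_pCons Suc algebra_simps del: One_nat_def)
    next
      case False
      then have "Suc m div p = m div p" by (simp add: div_Suc dvd_eq_mod_eq_0)
      then show ?thesis
        using False by (simp add: coeff_dp coeff_higher_pderiv_p coeff_pCons Suc del: One_nat_def)
    qed
  qed
qed

lemma of_nat_binomial_p: "k \<le> p - 1 \<Longrightarrow> of_nat ((p - 1) choose k) = ((-1) ^ k :: 'a)"
proof (induction k)
  case (Suc k)
  have "p dvd (p choose Suc k)" using Suc.prems prime_p by (intro dvd_choose_prime) auto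
  then have "of_nat (p choose Suc k) = (0 :: 'a)" by (simp only: of_nat_eq_0)
  moreover have "p choose Suc k = ((p - 1) choose k) + ((p - 1) choose Suc k)"
    using p_pos binomial_Suc_Suc[of "p - 1" k] by simp
  ultimately have "(-1) ^ k + of_nat ((p - 1) choose Suc k) = (0 :: 'a)"
    using Suc by simp
  then show ?case by (simp add: eq_neg_iff_add_eq_0 add.commute)
qed simp

text \<open>Divisibility and Bezout identities of \<open>F[x\<^sup>p]\<close> are those of the isomorphic ring \<open>F[x]\<close>, so greatest
common divisors taken in the subring remain greatest common divisors in \<open>F[x]\<close>.\<close>

lemma Fxp_bezout:
  fixes a b :: "'a poly"
  assumes "a \<in> Fxp p" "b \<in> Fxp p"
  obtains g s t where "g \<in> Fxp p" "s \<in> Fxp p" "t \<in> Fxp p" "g = s * a + t * b" "g dvd a" "g dvd b"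
proof -
  obtain a' b' where ab: "a = at_xp p a'" "b = at_xp p b'" using assms by (auto simp: Fxp_def)
  obtain g s t where g: "g = s * a' + t * b'" "g dvd a'" "g dvd b'"
    by (rule bezout_euclidean_ring)
  have dvd: "at_xp p f dvd at_xp p k" if "f dvd k" for f k :: "'a poly"
    using that by (auto simp: at_xp_mult elim!: dvdE)
  show ?thesis
  proof (rule that)
    show "at_xp p g = at_xp p s * a + at_xp p t * b" by (simp add: ab g(1) at_xp_add at_xp_mult)
  qed (auto simp: Fxp_def ab intro: dvd g(2,3))
qed

lemma Fxp_sum_gcd:
  fixes P :: "nat \<Rightarrow> 'a poly"
  assumes "\<And>i. i < n \<Longrightarrow> P i \<in> Fxp p"
  obtains g s where "g \<in> Fxp p" "\<And>i. i < n \<Longrightarrow> s i \<in> Fxp p" "\<And>i. i < n \<Longrightarrow> g dvd P i"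
    "g = (\<Sum>i<n. s i * P i)"
proof -
  have "\<exists>g s. g \<in> Fxp p \<and> (\<forall>i<n. s i \<in> Fxp p) \<and> (\<forall>i<n. g dvd P i) \<and> g = (\<Sum>i<n. s i * P i)"
    using assms
  proof (induction n)
    case 0
    show ?case by (auto simp: Fxp_iff)
  next
    case (Suc n)
    then obtain g s where g: "g \<in> Fxp p" "\<forall>i<n. s i \<in> Fxp p" "\<forall>i<n. g dvd P i"
      "g = (\<Sum>i<n. s i * P i)" by force
    have Pn: "P n \<in> Fxp p" using Suc.prems by simp
    obtain d u v where d: "d \<in> Fxp p" "u \<in> Fxp p" "v \<in> Fxp p" "d = u * g + v * P n"
      "d dvd g" "d dvd P n" using Fxp_bezout[OF g(1) Pn] .
    define s' where "s' i = (if i < n then u * s i else v)" for i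
    have "\<forall>i<Suc n. s' i \<in> Fxp p"
      using g(2) d(2,3) by (auto simp: s'_def Fxp_iff pderiv_mult)
    moreover have "\<forall>i<Suc n. d dvd P i"
      using g(3) d(5,6) by (metis dvd_trans less_Suc_eq)
    moreover have "d = (\<Sum>i<Suc n. s' i * P i)"
      by (subst d(4), subst g(4)) (simp add: s'_def sum_distrib_left mult.assoc)
    ultimately show ?case using d(1) by blast
  qed
  then show ?thesis using that by blast
qed

lemma Fxp_dvd_iff:
  fixes a b :: "'a poly"
  assumes "a \<in> Fxp p" "b \<in> Fxp p"
  shows "Fxp_dvd p a b \<longleftrightarrow> a dvd b"
proof
  assume "a dvd b"
  then obtain c where c: "b = a * c" by blast
  show "Fxp_dvd p a b"
  proof (cases "a = 0")
    case True
    then have "b = a * 0" "(0 :: 'a poly) \<in> Fxp p" using c by (simp_all add: Fxp_iff)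
    then show ?thesis unfolding Fxp_dvd_def by blast
  next
    case False
    then have "c \<in> Fxp p" using assms c pderiv_quotient_zero[of a c] by (simp add: Fxp_iff)
    then show ?thesis using c unfolding Fxp_dvd_def by blast
  qed
qed (auto simp: Fxp_dvd_def)

text \<open>Let \<open>e\<close> be the greatest common divisor of \<open>g\<close> and \<open>d\<close>, and \<open>d = e d'\<close>. The least common multiple
\<open>g d'\<close> lies in \<open>F[x\<^sup>p]\<close>, and it divides \<open>f\<close> by the Bezout identity for \<open>e\<close>. As the degree of \<open>g\<close> is
maximal, \<open>d'\<close> is constant.\<close>

lemma dvd_Fxp_divisor_of_max_degree:
  fixes f g d :: "'a poly"
  assumes "f \<noteq> 0" "g \<in> Fxp p" "g dvd f" "d \<in> Fxp p" "d dvd f"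
    and max: "\<And>e. e \<in> Fxp p \<Longrightarrow> e dvd f \<Longrightarrow> degree e \<le> degree g"
  shows "d dvd g"
proof -
  obtain e s t where e: "e \<in> Fxp p" "e = s * g + t * d" "e dvd g" "e dvd d"
    using Fxp_bezout[OF assms(2,4)] by metis
  obtain a b where ab: "f = g * a" "f = d * b" using assms by (elim dvdE)
  obtain g' d' where gd: "g = e * g'" "d = e * d'" using e by (elim dvdE)
  have nz: "e \<noteq> 0" "g \<noteq> 0" "d' \<noteq> 0" using ab gd assms(1) by auto
  have d'_Fxp: "pderiv d' = 0"
    using pderiv_quotient_zero[of e d'] assms(4) e(1) nz gd by (simp add: Fxp_iff)
  have "e * f = s * g * f + t * d * f" by (simp add: e(2) distrib_right)
  also have "\<dots> = s * g * (d * b) + t * d * (g * a)" using ab by simp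
  also have "\<dots> = e * (g * d' * (s * b + t * a))" by (simp add: gd(2) algebra_simps)
  finally have "f = g * d' * (s * b + t * a)" using nz(1) by simp
  then have "g * d' dvd f" by simp
  moreover have "g * d' \<in> Fxp p" using d'_Fxp assms(2) by (simp add: Fxp_iff pderiv_mult)
  ultimately have "degree (g * d') \<le> degree g" by (intro max)
  then have "degree d' = 0" using nz by (simp add: degree_mult_eq)
  then have "d' dvd 1" using nz(3) by (simp add: is_unit_iff_degree)
  then show ?thesis using gd e(3) by (metis mult.right_neutral mult_dvd_mono dvd_refl dvd_trans)
qed

text \<open>The definite description denotes: divisors of maximal degree in \<open>F[x\<^sup>p]\<close> exist by boundedness, and
any two of them divide each other.\<close>

lemma rho_properties:
  fixes f :: "'a poly"
  assumes "f \<noteq> 0"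
  shows rho_Fxp: "rho p f \<in> Fxp p" and rho_nz: "rho p f \<noteq> 0" and rho_dvd: "rho p f dvd f"
    and dvd_rho: "\<And>d. d \<in> Fxp p \<Longrightarrow> d dvd f \<Longrightarrow> d dvd rho p f"
proof -
  define P where "P g \<longleftrightarrow> g \<in> Fxp p \<and> lead_coeff g = 1 \<and> g dvd f \<and>
     (\<forall>g'\<in>Fxp p. g' dvd f \<longrightarrow> degree g' \<le> degree g)" for g
  have P_dvd: "d dvd g" if "P g" "d \<in> Fxp p" "d dvd f" for g d
    using that assms dvd_Fxp_divisor_of_max_degree[of f g d] unfolding P_def by blast
  have ex: "\<exists>g. P g"
  proof -
    have "\<exists>g. (g \<in> Fxp p \<and> g dvd f) \<and> (\<forall>g'. g' \<in> Fxp p \<and> g' dvd f \<longrightarrow> degree g' \<le> degree g)"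
    proof (rule ex_has_greatest_nat)
      show "(1 :: 'a poly) \<in> Fxp p \<and> 1 dvd f" by (simp add: Fxp_iff)
      show "\<forall>g. g \<in> Fxp p \<and> g dvd f \<longrightarrow> degree g < Suc (degree f)"
        using assms by (auto intro: dvd_imp_degree_le simp: less_Suc_eq_le)
    qed
    then obtain g where g: "g \<in> Fxp p" "g dvd f"
      "\<forall>g'. g' \<in> Fxp p \<and> g' dvd f \<longrightarrow> degree g' \<le> degree g" by blast
    then have nz: "g \<noteq> 0" using assms by auto
    have "P (smult (inverse (lead_coeff g)) g)"
      using g nz unfolding P_def by (auto simp: Fxp_iff pderiv_smult smult_dvd_iff)
    then show ?thesis by blast
  qed
  have unique: "g = g'" if "P g" "P g'" for g g'
    using that P_dvd[of g g'] P_dvd[of g' g] by (intro monic_dvd_antisym) (auto simp: P_def)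
  have "rho p f = (THE g. P g)" unfolding rho_def P_def ..
  then have P: "P (rho p f)" using theI'[of P] ex unique by metis
  then show "rho p f \<in> Fxp p" "rho p f \<noteq> 0" "rho p f dvd f" by (auto simp: P_def)
  show "d dvd rho p f" if "d \<in> Fxp p" "d dvd f" for d using P_dvd[OF P that] .
qed

lemma rho_dvd_pderiv:
  fixes f :: "'a poly"
  assumes "f \<noteq> 0"
  shows "rho p f dvd pderiv f"
proof -
  obtain g where g: "f = rho p f * g" using rho_dvd[OF assms] by blast
  have "pderiv f = rho p f * pderiv g"
    using rho_Fxp[OF assms] by (subst g) (simp add: pderiv_mult Fxp_iff)
  then show ?thesis by simp
qed

text \<open>The quotient \<open>d\<close> of \<open>f\<^sup>p\<close> by its greatest common divisor \<open>g\<close> with \<open>e\<close> lies in \<open>F[x\<^sup>p]\<close>, and it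
divides \<open>f\<close> because \<open>f\<^sup>p\<^sup>-\<^sup>1\<close> divides \<open>g\<close>. Hence \<open>d\<close> divides \<open>rho p f\<close>, so that
\<open>f\<^sup>p div rho p f\<close> divides \<open>g\<close>.\<close>

lemma power_div_rho_dvd:
  fixes e f :: "'a poly"
  assumes "f \<noteq> 0" "pderiv e = 0" "f ^ (p - 1) dvd e"
  shows "f ^ p div rho p f dvd e"
proof -
  have fp: "f ^ p = f ^ (p - 1) * f" using p_pos by (simp flip: power_Suc2)
  have "f ^ p \<in> Fxp p" "e \<in> Fxp p" using assms by (simp_all add: Fxp_iff pderiv_power_p)
  then obtain g s t where g: "g \<in> Fxp p" "g = s * f ^ p + t * e" "g dvd f ^ p" "g dvd e"
    using Fxp_bezout by metis
  obtain d where d: "f ^ p = g * d" using g(3) by blast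
  have nz: "g \<noteq> 0" using d assms(1) by auto
  have "pderiv d = 0"
    using pderiv_quotient_zero[of g d] g(1) nz pderiv_power_p[of f] by (simp add: d Fxp_iff)
  moreover have "d dvd f"
  proof -
    have "f ^ (p - 1) dvd g" using assms(3) by (simp add: g(2) fp)
    then obtain k where k: "g = f ^ (p - 1) * k" by blast
    have "f ^ (p - 1) * f = f ^ (p - 1) * (k * d)" using d by (simp add: fp k mult.assoc)
    then have "f = k * d" using assms(1) by simp
    then show ?thesis by simp
  qed
  ultimately have "d dvd rho p f" using assms(1) by (intro dvd_rho) (simp_all add: Fxp_iff)
  then obtain c where c: "rho p f = d * c" by blast
  have "rho p f dvd f ^ p"
    using dvd_trans[OF rho_dvd[OF assms(1)] dvd_power[of p f]] p_pos by simp
  then obtain m where m: "f ^ p = rho p f * m" by blast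
  have "m dvd g"
  proof -
    have "d * g = d * (c * m)" using m d by (simp add: c mult.commute mult.left_commute)
    then have "g = c * m" using d assms(1) by auto
    then show ?thesis by simp
  qed
  moreover have "f ^ p div rho p f = m" using m rho_nz[OF assms(1)] by simp
  ultimately show ?thesis using g(4) by (metis dvd_trans)
qed

text \<open>The definite description denotes: a greatest common divisor is a combination of the components,
and it is nonzero because \<open>f\<^sup>p\<^sup>-\<^sup>1\<close> has a nonzero component.\<close>

lemma hbar_properties:
  fixes f :: "'a poly"
  assumes "f \<noteq> 0"
  shows hbar_Fxp: "hbar p f \<in> Fxp p" and hbar_nz: "hbar p f \<noteq> 0"
    and hbar_dvd: "\<And>i. i < p \<Longrightarrow> hbar p f dvd hbar_part p f i"
proof -
  define P where "P g \<longleftrightarrow> g \<in> Fxp p \<and> lead_coeff g = 1 \<and>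
      (\<forall>i<p. Fxp_dvd p g (hbar_part p f i)) \<and>
      (\<forall>d\<in>Fxp p. (\<forall>i<p. Fxp_dvd p d (hbar_part p f i)) \<longrightarrow> Fxp_dvd p d g)" for g
  have part: "hbar_part p f i \<in> Fxp p" for i by (simp add: hbar_part_def Fxp_def)
  have ex: "\<exists>g. P g"
  proof -
    obtain g s where g: "g \<in> Fxp p" "\<And>i. i < p \<Longrightarrow> g dvd hbar_part p f i"
      "g = (\<Sum>i<p. s i * hbar_part p f i)" using Fxp_sum_gcd[of p "hbar_part p f", OF part] by metis
    have nz: "g \<noteq> 0"
    proof
      assume "g = 0"
      then have "hbar_part p f i = 0" if "i < p" for i using g(2)[OF that] by simp
      then have "f ^ (p - 1) = 0"
        using xp_expansion[OF p_pos, of "f ^ (p - 1)"] by (simp add: hbar_part_def)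
      then show False using assms by simp
    qed
    have "d dvd g" if "\<forall>i<p. d dvd hbar_part p f i" for d
      using that by (subst g(3)) (intro dvd_sum dvd_mult, simp)
    then have "P (smult (inverse (lead_coeff g)) g)"
      using g(1,2) nz unfolding P_def
      by (auto simp: Fxp_iff pderiv_smult smult_dvd_iff dvd_smult part[unfolded Fxp_iff]
          Fxp_dvd_iff[unfolded Fxp_iff])
    then show ?thesis by blast
  qed
  have "g dvd g'" if "P g" "P g'" for g g'
    using that unfolding P_def by (metis Fxp_dvd_iff)
  then have unique: "g = g'" if "P g" "P g'" for g g'
    using that by (intro monic_dvd_antisym) (auto simp: P_def)
  have "hbar p f = (THE g. P g)" unfolding hbar_def P_def ..
  then have P: "P (hbar p f)" using theI'[of P] ex unique by metis
  then show "hbar p f \<in> Fxp p" "hbar p f \<noteq> 0" by (auto simp: P_def)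
  show "hbar p f dvd hbar_part p f i" if "i < p" for i
    using P that part by (auto simp: P_def Fxp_dvd_iff)
qed

lemma hbar_dvd_power:
  fixes f :: "'a poly"
  assumes "f \<noteq> 0"
  shows "hbar p f dvd f ^ (p - 1)"
proof -
  have "f ^ (p - 1) = (\<Sum>i<p. hbar_part p f i * monom 1 i)"
    using xp_expansion[OF p_pos, of "f ^ (p - 1)"] by (simp add: hbar_part_def)
  also have "hbar p f dvd \<dots>"
    by (intro dvd_sum dvd_mult2 hbar_dvd assms) simp
  finally show ?thesis .
qed

lemma higher_pderiv_p_monomial:
  assumes "m < 2 * p - 1"
  shows "(pderiv ^^ (p - 1)) (monom 1 m :: 'a poly) = (if m = p - 1 then - 1 else 0)"
proof (rule poly_eqI)
  fix n
  have "n = 0" if "p dvd n" "n + (p - 1) = m"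
    using that assms by (auto dest!: dvd_imp_le)
  then show "coeff ((pderiv ^^ (p - 1)) (monom 1 m)) n = coeff (if m = p - 1 then - 1 else 0 :: 'a poly) n"
    by (auto simp: coeff_higher_pderiv_p simp del: One_nat_def)
qed

text \<open>The derivative of order \<open>p - 1\<close> picks out, up to sign, the coefficient of \<open>x\<^sup>p\<^sup>-\<^sup>1\<close> over \<open>F[x\<^sup>p]\<close>, so
  it turns the product of \<open>f\<^sup>p\<^sup>-\<^sup>1\<close> with \<open>qbreve p q\<close> into the Bezout sum.\<close>

lemma higher_pderiv_power_qbreve:
  fixes f :: "'a poly"
  assumes "\<And>i. i < p \<Longrightarrow> q i \<in> Fxp p" "hbar p f = (\<Sum>i<p. q i * hbar_part p f i)"
  shows "(pderiv ^^ (p - 1)) (f ^ (p - 1) * qbreve p q) = hbar p f"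
proof -
  let ?d = "(pderiv ^^ (p - 1)) :: 'a poly \<Rightarrow> 'a poly"
  have sum: "?d (\<Sum>i\<in>I. F i) = (\<Sum>i\<in>I. ?d (F i))" for F and I :: "nat set"
    by (rule higher_pderiv_sum)
  have part: "pderiv (hbar_part p f i) = 0" for i
    using Fxp_iff[of "hbar_part p f i"] by (simp add: hbar_part_def Fxp_def)
  have f: "f ^ (p - 1) = (\<Sum>j<p. hbar_part p f j * monom 1 j)"
    using xp_expansion[OF p_pos, of "f ^ (p - 1)"] by (simp add: hbar_part_def)
  have "f ^ (p - 1) * qbreve p q =
      (\<Sum>i<p. \<Sum>j<p. - (q i * hbar_part p f j) * monom 1 (j + (p - 1 - i)))"
    unfolding f qbreve_def sum_negf[symmetric] sum_distrib_left sum_distrib_right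
    by (intro sum.cong refl) (auto simp: mult_ac mult_monom)
  also have "?d \<dots> = (\<Sum>i<p. \<Sum>j<p. ?d (- (q i * hbar_part p f j) * monom 1 (j + (p - 1 - i))))"
    by (simp only: sum)
  also have "\<dots> = (\<Sum>i<p. \<Sum>j<p. if j = i then q i * hbar_part p f j else 0)"
  proof (intro sum.cong refl)
    fix i j assume ij: "i \<in> {..<p}" "j \<in> {..<p}"
    then have lt: "j + (p - 1 - i) < 2 * p - 1" and eq: "j + (p - 1 - i) = p - 1 \<longleftrightarrow> j = i"
      by auto
    have const: "pderiv (- (q i * hbar_part p f j)) = 0"
      using assms(1)[of i] ij by (simp add: Fxp_iff pderiv_mult pderiv_minus part)
    show "?d (- (q i * hbar_part p f j) * monom 1 (j + (p - 1 - i))) =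
        (if j = i then q i * hbar_part p f j else 0)"
      unfolding higher_pderiv_const_mult[OF const] higher_pderiv_p_monomial[OF lt] eq by simp
  qed
  also have "\<dots> = hbar p f" by (simp add: assms(2))
  finally show ?thesis .
qed

end


section \<open>Derivations and the centre in positive characteristic\<close>

lemma derivation_on_power_step:
  assumes "derivation_on (Ah h) D" "a \<in> Ah h"
  shows "D (a ^ Suc n) = D (a ^ n) * a + a ^ n * D a"
  using derivation_on_mult[OF assms(1) Ah_power[OF assms(2)] assms(2)]
  by (simp add: power_Suc2 del: power_Suc)

lemma wcoeffs_wad_wX: "wcoeffs (wad a wX) = pderiv (wcoeffs a)"
  by (rule poly_eqI) (simp add: coeff_pderiv wc_wad_wX flip: wc_def)

context positive_char
begin

lemma derivation_on_power_p:
  fixes a :: "'a weyl"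
  assumes "derivation_on (Ah f) D" "a \<in> Ah f"
  shows "D (a ^ p) = ((\<lambda>v. v * a - a * v) ^^ (p - 1)) (D a)"
  by (rule prime_power_rule_commutator[of "\<lambda>n. D (a ^ n)", OF _ _ prime_p of_nat_p_weyl])
    (use derivation_on_wconst[OF assms(1), of 1] derivation_on_power_step[OF assms] in simp_all)

lemma of_nat_poly_eq_0: "of_nat n = (0 :: 'a poly) \<longleftrightarrow> p dvd n"
  using of_nat_eq_0[of n] by (simp add: of_nat_poly)

lemma pochhammer_p_poly:
  "pochhammer (of_nat (Suc n)) (p - 1) = (if p dvd n then -1 else (0 :: 'a poly))"
proof -
  have "of_nat k = ([:of_nat k:] :: 'a poly)" for k by (simp add: of_nat_poly)
  then have "pochhammer (of_nat (Suc n)) (p - 1) = ([:pochhammer (of_nat (Suc n)) (p - 1):] :: 'a poly)"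
    by (metis pochhammer_of_nat)
  then show ?thesis unfolding pochhammer_p by (auto simp: one_pCons)
qed

lemma wc_derivation_wX_power_p:
  fixes f :: "'a poly"
  assumes "derivation_on (Ah f) D"
  shows "wc (D (wX ^ p)) j = (if p dvd j then - wc (D wX) (j + (p - 1)) else 0)"
proof -
  have "wcoeffs (((\<lambda>v. v * wX - wX * v) ^^ n) u) = (pderiv ^^ n) (wcoeffs u)" for n and u :: "'a weyl"
    by (induction n) (simp_all add: wcoeffs_wad_wX flip: wad_def)
  then show ?thesis
    unfolding derivation_on_power_p[OF assms Ah.x] wc_def
    by (simp add: coeff_higher_pderiv pochhammer_p_poly del: of_nat_Suc One_nat_def)
qed

lemma minus_one_power_p: "(-1) ^ (p - 1) = (1 :: 'a)"
  using of_nat_binomial_p[of "p - 1"] by simp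

lemma wc_derivation_wY_power_p:
  fixes D :: "'a weyl \<Rightarrow> 'a weyl"
  assumes "derivation_on UNIV D"
  shows "wc (D (wY ^ p)) j = (pderiv ^^ (p - 1)) (wc (D wY) j)"
proof -
  have "wc (((\<lambda>v. v * wY - wY * v) ^^ n) u) j = smult ((-1) ^ n) ((pderiv ^^ n) (wc u j))"
    for n and u :: "'a weyl"
  proof (induction n)
    case (Suc n)
    have "v * wY - wY * v = - wad wY v" for v :: "'a weyl" by (simp add: wad_def)
    then show ?case using Suc by (simp add: wc_uminus wc_wad_wY pderiv_smult)
  qed simp
  moreover have "D (wY ^ p) = ((\<lambda>v. v * wY - wY * v) ^^ (p - 1)) (D wY)"
    using derivation_on_power_p[of 1 D wY] assms by (simp add: Ah_one)
  ultimately show ?thesis by (simp add: minus_one_power_p del: One_nat_def)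
qed

lemma commutes_wX_iff:
  fixes z :: "'a weyl"
  shows "wad z wX = 0 \<longleftrightarrow> (\<forall>j. \<not> p dvd j \<longrightarrow> wc z j = 0)"
proof
  assume z: "wad z wX = 0"
  show "\<forall>j. \<not> p dvd j \<longrightarrow> wc z j = 0"
  proof (intro allI impI)
    fix j assume j: "\<not> p dvd j"
    then obtain i where i: "j = Suc i" by (cases j) auto
    have "of_nat (Suc i) * wc z (Suc i) = 0"
      using z by (simp only: wc_0 flip: wc_wad_wX)
    then show "wc z j = 0"
      using j of_nat_poly_eq_0[of "Suc i"] by (simp add: i del: of_nat_Suc)
  qed
next
  assume *: "\<forall>j. \<not> p dvd j \<longrightarrow> wc z j = 0"
  show "wad z wX = 0"
  proof (rule wc_ext)
    fix j
    show "wc (wad z wX) j = wc 0 j"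
      using * of_nat_poly_eq_0[of "Suc j"] by (cases "p dvd Suc j") (simp_all add: wc_wad_wX)
  qed
qed

lemma center_iff:
  fixes z :: "'a weyl"
  shows "z \<in> weyl_center UNIV \<longleftrightarrow> (\<forall>j. \<not> p dvd j \<longrightarrow> wc z j = 0) \<and> (\<forall>j. pderiv (wc z j) = 0)"
proof -
  have "wad wY z = 0 \<longleftrightarrow> (\<forall>j. pderiv (wc z j) = 0)"
    by (metis wc_0 wc_ext wc_wad_wY)
  then show ?thesis by (simp only: weyl_center_UNIV_iff commutes_wX_iff)
qed

lemma wpoly_center: "pderiv (f :: 'a poly) = 0 \<Longrightarrow> wpoly f \<in> weyl_center UNIV"
  by (auto simp: center_iff wc_wpoly)

lemma z_h_power: "z_h p (f :: 'a poly) ^ n = wpoly (f ^ (p * n)) * wY ^ (p * n)"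
proof -
  have "wc (wY ^ p) j = (if j = p then 1 else 0 :: 'a poly)" for j
    using wc_monomial[of 1 p j] by simp
  then have "wY ^ p \<in> weyl_center (UNIV :: 'a weyl set)"
    by (simp add: center_iff)
  then have central: "wY ^ p * a = a * wY ^ p" for a :: "'a weyl"
    by (simp add: weyl_center_UNIV_mult)
  show ?thesis
  proof (induction n)
    case (Suc n)
    have "z_h p f ^ Suc n = wpoly (f ^ p) * (wY ^ p * wpoly (f ^ (p * n))) * wY ^ (p * n)"
      unfolding power_Suc Suc by (simp only: z_h_def mult.assoc)
    also have "\<dots> = (wpoly (f ^ p) * wpoly (f ^ (p * n))) * (wY ^ p * wY ^ (p * n))"
      by (simp only: central[of "wpoly (f ^ (p * n))"] mult.assoc)
    also have "\<dots> = wpoly (f ^ (p * Suc n)) * wY ^ (p * Suc n)"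
      by (simp only: power_add mult_Suc_right flip: wpoly_mult)
    finally show ?case .
  qed simp
qed

end

locale Ah_char = positive_char p "TYPE('a::field)" for p :: nat +
  fixes h :: "'a::field poly"
  assumes h_nz: "h \<noteq> 0"
begin

abbreviation Z :: "'a weyl set" where "Z \<equiv> weyl_center (Ah h)"

lemma Z_iff:
  "z \<in> Z \<longleftrightarrow> (\<forall>j. h ^ j dvd wc z j) \<and> (\<forall>j. \<not> p dvd j \<longrightarrow> wc z j = 0) \<and> (\<forall>j. pderiv (wc z j) = 0)"
  unfolding weyl_center_Ah[OF h_nz] Int_iff Ah_iff center_iff ..

lemma Z_mult_commute: "z \<in> Z \<Longrightarrow> z * a = a * z"
  using weyl_center_UNIV_mult weyl_center_Ah[OF h_nz] by blast

lemma Z_Ah: "z \<in> Z \<Longrightarrow> z \<in> Ah h"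
  by (simp add: weyl_center_def)

lemma Z_0: "0 \<in> Z"
  by (simp add: weyl_center_def Ah_0)

lemma Z_add: "y \<in> Z \<Longrightarrow> z \<in> Z \<Longrightarrow> y + z \<in> Z"
  by (simp add: weyl_center_def Ah.add distrib_left distrib_right)

lemma Z_mult: "y \<in> Z \<Longrightarrow> z \<in> Z \<Longrightarrow> y * z \<in> Z"
proof -
  assume y: "y \<in> Z" and z: "z \<in> Z"
  have "y * z * a = a * (y * z)" for a
  proof -
    have "y * z * a = y * (a * z)" by (simp only: Z_mult_commute[OF z, of a] mult.assoc)
    also have "\<dots> = (y * a) * z" by (simp only: mult.assoc)
    also have "\<dots> = a * (y * z)" by (simp only: Z_mult_commute[OF y, of a] mult.assoc)
    finally show ?thesis .
  qed
  then show "y * z \<in> Z"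
    using Ah.mult[OF Z_Ah[OF y] Z_Ah[OF z]] unfolding weyl_center_def by blast
qed

lemma Z_wpoly: "pderiv f = 0 \<Longrightarrow> wpoly f \<in> Z"
  using wpoly_center Ah_wpoly weyl_center_Ah[OF h_nz] by blast

lemma pderiv_h_power: "p dvd j \<Longrightarrow> pderiv (h ^ j) = 0"
  by (elim dvdE) (simp only: power_mult pderiv_power_zero pderiv_power_p)

lemma z_h_Z: "z_h p h \<in> Z"
  by (auto simp: Z_iff z_h_def wc_monomial pderiv_h_power)

lemma wX_power_p: "wX ^ p = wpoly (monom (1 :: 'a) p)"
proof -
  have "monom 1 p = [:0, 1 :: 'a:] ^ p" by (simp add: monom_altdef)
  then show ?thesis by (simp only: wpoly_power wpoly_X)
qed

lemma wX_power_p_Z: "wX ^ p \<in> Z"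
  unfolding wX_power_p
  using of_nat_eq_0[of p] by (intro Z_wpoly) (simp add: pderiv_monom)

text \<open>The centre is generated by the constants, \<open>x\<^sup>p\<close> and \<open>z\<^sub>h\<close>: the coefficient of a central element at
\<open>y\<^sup>p\<^sup>n\<close> is \<open>h\<^sup>p\<^sup>n g\<close> with \<open>g\<close> in \<open>F[x\<^sup>p]\<close>, and \<open>h\<^sup>p\<^sup>n y\<^sup>p\<^sup>n\<close> is the power of exponent \<open>n\<close> of \<open>z\<^sub>h\<close>.\<close>

lemma derivation_zero_on_Z:
  assumes D: "derivation_on (Ah h) D" "D (wX ^ p) = 0" "D (z_h p h) = 0" and z: "z \<in> Z"
  shows "D z = 0"
proof -
  define T where "T = {a \<in> Ah h. D a = 0}"
  have T_add: "a + b \<in> T" and T_mult: "a * b \<in> T" if "a \<in> T" "b \<in> T" for a b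
    using that by (auto simp: T_def derivation_onD[OF D(1)] intro: Ah.add Ah.mult)
  have T_const: "wconst c \<in> T" for c
    using derivation_on_wconst[OF D(1)] by (simp add: T_def Ah.const)
  have T_x: "wpoly (monom 1 p) \<in> T"
    using D(2) Ah_wpoly by (simp add: T_def wX_power_p)
  have T_at_xp: "wpoly (at_xp p f) \<in> T" for f
  proof (induction f)
    case 0
    then show ?case using T_const[of 0] by simp
  next
    case (pCons c f)
    then show ?case by (simp add: at_xp_pCons wpoly_add wpoly_mult wpoly_const T_add T_mult T_const T_x)
  qed
  have T_z: "z_h p h ^ n \<in> T" for n
  proof (induction n)
    case 0
    then show ?case using T_const[of 1] by simp
  next
    case (Suc n)
    have "z_h p h \<in> T" using D(3) z_h_Z by (simp add: T_def Z_Ah)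
    with Suc show ?case by (simp add: T_mult)
  qed
  have T_term: "wpoly (wc z j) * wY ^ j \<in> T" for j
  proof (cases "p dvd j")
    case False
    then show ?thesis using z T_const[of 0] by (simp add: Z_iff)
  next
    case True
    then obtain n where n: "j = p * n" by blast
    have "h ^ j dvd wc z j" using z by (simp add: Z_iff)
    then obtain g where g: "wc z j = h ^ j * g" by blast
    have "pderiv g = 0"
      using pderiv_quotient_zero[of "h ^ j" g] z h_nz pderiv_h_power[OF True]
      by (simp add: Z_iff flip: g)
    then obtain f where f: "g = at_xp p f" using Fxp_iff[of g] by (auto simp: Fxp_def)
    have "wpoly (wc z j) * wY ^ j = wpoly (at_xp p f) * z_h p h ^ n"
      unfolding g f unfolding z_h_power n by (simp only: mult.commute[of _ "at_xp p f"] wpoly_mult mult.assoc)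
    then show ?thesis using T_mult[OF T_at_xp T_z] by simp
  qed
  have T_sum: "(\<Sum>j\<le>n. wpoly (wc z j) * wY ^ j) \<in> T" for n
    using T_term[of 0] by (induction n) (simp_all add: T_add T_term del: power_Suc)
  obtain n where "\<And>j. n < j \<Longrightarrow> wc z j = 0" using wc_bound[of z] by blast
  then have "z \<in> T" using wc_expansion[of n z] T_sum[of n] by simp
  then show ?thesis by (simp add: T_def)
qed

lemma derivation_on_lmult_Z: "derivation_on (Ah h) D \<Longrightarrow> z \<in> Z \<Longrightarrow> derivation_on (Ah h) (\<lambda>a. z * D a)"
  using derivation_on_lmult Z_mult_commute by blast

lemma h_power_p: "h ^ p = h ^ (p - 1) * h"
  using p_pos by (simp flip: power_Suc2)

lemma h_power_p_Z: "wpoly (h ^ p) \<in> Z"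
  by (intro Z_wpoly pderiv_power_p)

text \<open>A derivation that kills \<open>x\<close> and sends \<open>yhat h = y h\<close> to \<open>w\<close> must send \<open>y\<close> to \<open>w / h\<close>, which exists
only after localisation. Multiplication by the central element \<open>h\<^sup>p\<close> clears the denominator.\<close>

lemma derivation_clear_denominator:
  assumes "wad w wX = 0"
  obtains E where "E \<in> Der UNIV" "E wX = 0" "E wY = wpoly (h ^ (p - 1)) * w"
    "E (yhat h) = wpoly (h ^ p) * w"
proof -
  define v where "v = wpoly (h ^ (p - 1)) * w"
  have v: "wad v wX = 0"
    using assms by (simp add: commutes_wX_iff v_def wc_wpoly_mult)
  then have "wad v wX = wad 0 wY" by (simp add: wad_def)
  then obtain E where E: "E \<in> Der UNIV" "E wX = 0" "E wY = v"
    by (rule weyl_derivation_exists)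
  then have E': "derivation_on UNIV E" by (simp add: Der_iff)
  have "E (wpoly h) = 0"
    using derivation_on_wpoly_zero[of h E h] derivation_on_subset[OF E'] E(2) by blast
  then have "E (yhat h) = v * wpoly h"
    using derivation_on_mult[OF E'] E(3) by (simp add: yhat_def)
  also have "\<dots> = wpoly h * v" using v by (rule commutes_wpoly)
  also have "\<dots> = wpoly (h ^ p) * w"
    by (simp only: v_def h_power_p wpoly_mult wpoly_commute[of "h ^ (p - 1)" h] mult.assoc)
  finally show ?thesis using E that by (simp add: v_def)
qed

text \<open>The derivation agrees on \<open>A\<^sub>h\<close> with one of the Weyl algebra up to the factor \<open>h\<^sup>p\<close>. The value of
the latter at \<open>h\<^sup>p y\<^sup>p\<close> is an iterated commutator with \<open>y\<close>, and the factor cancels.\<close>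

lemma derivation_killing_wX:
  assumes D: "derivation_on (Ah h) D" "D wX = 0"
  shows commutes_derivation_yhat: "wad (D (yhat h)) wX = 0"
    and wc_derivation_z_h: "wc (D (z_h p h)) j = (pderiv ^^ (p - 1)) (h ^ (p - 1) * wc (D (yhat h)) j)"
proof -
  define w where "w = D (yhat h)"
  have yx: "yhat h * wX = wX * yhat h + wpoly h"
    using Ah_relation[of h] by (simp add: algebra_simps)
  have "D (yhat h * wX) = D (wX * yhat h) + D (wpoly h)"
    unfolding yx by (intro derivation_on_add[OF D(1)] Ah.intros Ah_wpoly)
  then show w: "wad w wX = 0"
    using derivation_on_wpoly_zero[OF D]
    by (simp add: derivation_on_mult[OF D(1)] Ah.intros D(2) wad_def w_def)
  obtain E where E: "E \<in> Der UNIV" "E wX = 0" "E wY = wpoly (h ^ (p - 1)) * w"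
    "E (yhat h) = wpoly (h ^ p) * w" using derivation_clear_denominator[OF w] .
  then have E': "derivation_on UNIV E" by (simp add: Der_iff)
  have EA: "derivation_on (Ah h) E" using derivation_on_subset[OF E'] by blast
  have "wpoly (h ^ p) * D a = E a" if "a \<in> Ah h" for a
    by (rule derivation_on_Ah_eq[OF derivation_on_lmult_Z[OF D(1) h_power_p_Z] EA _ _ that])
      (simp_all add: D(2) E w_def)
  then have "wpoly (h ^ p) * D (z_h p h) = E (wpoly (h ^ p) * wY ^ p)"
    using z_h_Z by (simp add: Z_Ah flip: z_h_def)
  also have "\<dots> = wpoly (h ^ p) * E (wY ^ p)"
    using derivation_on_mult[OF E'] derivation_on_wpoly_zero[OF EA E(2)] by simp
  finally have "D (z_h p h) = E (wY ^ p)" using h_nz wpoly_mult_cancel[of "h ^ p"] by simp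
  then show "wc (D (z_h p h)) j = (pderiv ^^ (p - 1)) (h ^ (p - 1) * wc w j)"
    by (simp add: wc_derivation_wY_power_p[OF E'] E(3) wc_wpoly_mult del: One_nat_def)
qed

text \<open>The derivation of the Weyl algebra with \<open>x \<mapsto> 0\<close> and \<open>y \<mapsto> h\<^sup>p\<^sup>-\<^sup>1 r\<close> maps the generators of
\<open>A\<^sub>h\<close> into \<open>h\<^sup>p A\<^sub>h\<close>, hence all of \<open>A\<^sub>h\<close>; dividing by \<open>h\<^sup>p\<close> gives \<open>D\<^sub>r\<close>.\<close>

lemma Dr_properties:
  shows Dr_Der: "Dr h r \<in> Der (Ah h)" and Dr_wX: "Dr h r wX = 0"
    and Dr_yhat: "Dr h r (yhat h) = wpoly r"
proof -
  have "wad (wpoly r) wX = 0" by (simp add: wad_def wpoly_commute_wX)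
  then obtain E where E: "E \<in> Der UNIV" "E wX = 0" "E (yhat h) = wpoly (h ^ p) * wpoly r"
    using derivation_clear_denominator by metis
  then have E': "derivation_on (Ah h) E"
    using derivation_on_subset[of UNIV] by (simp add: Der_iff)
  have divisible: "\<exists>b\<in>Ah h. E a = wpoly (h ^ p) * b" if "a \<in> Ah h" for a
    using that
  proof (induction rule: Ah.induct)
    case (const c)
    have "E (wconst c) = wpoly (h ^ p) * 0" using derivation_on_wconst[OF E'] by simp
    then show ?case using Ah_0 by blast
  next
    case x
    have "E wX = wpoly (h ^ p) * 0" using E by simp
    then show ?case using Ah_0 by blast
  next
    case yhat
    then show ?case using E Ah_wpoly by blast
  next
    case (add a b)
    then obtain c d where "c \<in> Ah h" "d \<in> Ah h" "E a = wpoly (h ^ p) * c" "E b = wpoly (h ^ p) * d"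
      by blast
    then have "E (a + b) = wpoly (h ^ p) * (c + d)" "c + d \<in> Ah h"
      using derivation_on_add[OF E' add.hyps] by (simp_all add: distrib_left Ah.add)
    then show ?case by blast
  next
    case (mult a b)
    then obtain c d where cd: "c \<in> Ah h" "d \<in> Ah h" "E a = wpoly (h ^ p) * c" "E b = wpoly (h ^ p) * d"
      by blast
    have "a * (wpoly (h ^ p) * d) = wpoly (h ^ p) * (a * d)"
      using Z_mult_commute[OF h_power_p_Z, of a] by (simp add: mult.assoc flip: mult.assoc)
    then have "E (a * b) = wpoly (h ^ p) * (c * b + a * d)" "c * b + a * d \<in> Ah h"
      using derivation_on_mult[OF E' mult.hyps] cd mult.hyps
      by (simp_all add: distrib_left mult.assoc Ah.add Ah.mult)
    then show ?case by blast
  qed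
  have cancel: "wpoly (h ^ p) * a = wpoly (h ^ p) * b \<Longrightarrow> a = b" for a b
    using wpoly_mult_cancel[of "h ^ p"] h_nz by simp
  \<comment> \<open>The chosen quotient is unique, since \<open>h\<^sup>p\<close> can be cancelled.\<close>
  define D where "D = restr (Ah h) (\<lambda>a. SOME b. b \<in> Ah h \<and> E a = wpoly (h ^ p) * b)"
  have D: "D a \<in> Ah h" "wpoly (h ^ p) * D a = E a" if "a \<in> Ah h" for a
  proof -
    have "\<exists>b. b \<in> Ah h \<and> E a = wpoly (h ^ p) * b" using divisible[OF that] by blast
    from someI_ex[OF this] show "D a \<in> Ah h" "wpoly (h ^ p) * D a = E a"
      by (simp_all add: D_def restr_def that)
  qed
  have "derivation_on (Ah h) D"
  proof (rule derivation_onI; rule cancel)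
    fix a b assume ab: "a \<in> Ah h" "b \<in> Ah h"
    then show "wpoly (h ^ p) * D (a + b) = wpoly (h ^ p) * (D a + D b)"
      by (simp add: D distrib_left derivation_on_add[OF E'] Ah.add)
    have "a * E b = wpoly (h ^ p) * (a * D b)"
      using Z_mult_commute[OF h_power_p_Z, of a] D(2)[OF ab(2)] by (metis mult.assoc)
    moreover have "E a * b = wpoly (h ^ p) * (D a * b)"
      using D(2)[OF ab(1)] by (metis mult.assoc)
    ultimately show "wpoly (h ^ p) * D (a * b) = wpoly (h ^ p) * (D a * b + a * D b)"
      using ab by (simp add: D distrib_left derivation_on_mult[OF E'] Ah.mult)
  next
    fix c a assume a: "a \<in> Ah h"
    have "wpoly (h ^ p) * (wconst c * D a) = wconst c * E a"
      using D(2)[OF a] wconst_commute[of c "wpoly (h ^ p)"] by (metis mult.assoc)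
    then show "wpoly (h ^ p) * D (wconst c * a) = wpoly (h ^ p) * (wconst c * D a)"
      using a by (simp add: D derivation_on_scale[OF E'] Ah.mult Ah.const)
  qed
  moreover have "D wX = 0"
    by (rule cancel) (simp add: D Ah.x E)
  moreover have "D (yhat h) = wpoly r"
    by (rule cancel) (simp add: D Ah.yhat E)
  ultimately have *: "D \<in> Der (Ah h) \<and> D wX = 0 \<and> D (yhat h) = wpoly r"
    using D(1) by (simp add: Der_iff) (simp add: D_def restr_def)
  have "Dr h r \<in> Der (Ah h) \<and> Dr h r wX = 0 \<and> Dr h r (yhat h) = wpoly r"
    unfolding Dr_def by (rule theI2[of _ D]) (use * Der_Ah_eqI in metis)+
  then show "Dr h r \<in> Der (Ah h)" "Dr h r wX = 0" "Dr h r (yhat h) = wpoly r" by auto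
qed

lemma Dr_derivation: "derivation_on (Ah h) (Dr h r)"
  using Dr_Der by (simp add: Der_iff)

lemma Dr_z_h: "Dr h r (z_h p h) = wpoly ((pderiv ^^ (p - 1)) (h ^ (p - 1) * r))"
  by (rule wc_ext)
    (simp add: wc_derivation_z_h[OF Dr_derivation Dr_wX] Dr_yhat wc_wpoly del: One_nat_def)

lemma Dr_wX_power_p: "Dr h r (wX ^ p) = 0"
  by (rule wc_ext) (simp add: wc_derivation_wX_power_p[OF Dr_derivation] Dr_wX)

end


section \<open>The derivation \<open>E\<^sub>x\<close> and its correction\<close>

lemma wc_wY_power_wpoly:
  "wc (wY ^ n * wpoly f) j = (if j \<le> n then smult (of_nat (n choose j)) ((pderiv ^^ (n - j)) f) else 0)"
proof (induction n arbitrary: j)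
  case (Suc n)
  have "wc (wY ^ Suc n * wpoly f) j =
      pderiv (wc (wY ^ n * wpoly f) j) + (if j = 0 then 0 else wc (wY ^ n * wpoly f) (j - 1))"
    by (simp add: mult.assoc wc_wY_mult)
  also have "\<dots> = (if j \<le> Suc n then
      smult (of_nat (Suc n choose j)) ((pderiv ^^ (Suc n - j)) f) else 0)"
  proof (cases "j \<le> n")
    case True
    show ?thesis
    proof (cases j)
      case 0
      then show ?thesis by (simp add: Suc.IH)
    next
      case (Suc i)
      then have "n - i = Suc (n - Suc i)" using True by simp
      then show ?thesis using True by (simp add: Suc Suc.IH pderiv_smult smult_add_left)
    qed
  next
    case False
    then show ?thesis by (auto simp: Suc.IH le_Suc_eq)
  qed
  finally show ?case .
qed (auto simp: wc_wpoly)

lemma higher_pderiv_pCons: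
  "(pderiv ^^ Suc n) (pCons c f) =
     [:0, 1:] * (pderiv ^^ Suc n) f + smult (of_nat (Suc n)) ((pderiv ^^ n) (f :: 'a::field poly))"
proof (induction n)
  case (Suc n)
  define g where "g = (pderiv ^^ Suc n) f"
  have "(pderiv ^^ Suc (Suc n)) (pCons c f) = pderiv ((pderiv ^^ Suc n) (pCons c f))" by simp
  also have "\<dots> = [:0, 1:] * pderiv g + (g + smult (of_nat (Suc n)) g)"
    unfolding Suc.IH pderiv_add pderiv_mult pderiv_smult
    by (simp add: g_def pderiv_pCons del: of_nat_Suc)
  also have "g + smult (of_nat (Suc n)) g = smult (of_nat (Suc (Suc n))) g"
    by (simp only: of_nat_Suc[of "Suc n"] smult_add_left smult_1_left)
  finally show ?case by (simp add: g_def)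
qed (simp add: pderiv_pCons)

context positive_char
begin

text \<open>The coefficient of \<open>y\<^sup>j\<close> in \<open>E\<^sub>x (f)\<close>.\<close>

definition Ex_coeff :: "'a poly \<Rightarrow> nat \<Rightarrow> 'a poly" where
  "Ex_coeff f j = (if j = 0 then - dp p f
     else if j < p then smult ((-1) ^ (p - j - 1) / of_nat (p - j)) ((pderiv ^^ (p - j)) f) else 0)"

lemma Ex_properties:
  shows Ex_Der: "(Ex p :: 'a weyl \<Rightarrow> 'a weyl) \<in> Der UNIV" and Ex_wX: "Ex p wX = (wY ^ (p - 1) :: 'a weyl)"
    and Ex_wY: "Ex p wY = (0 :: 'a weyl)"
proof -
  have "wad (0 :: 'a weyl) wX = wad (wY ^ (p - 1)) wY"
    by (simp add: wad_def power_commutes)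
  then obtain D :: "'a weyl \<Rightarrow> 'a weyl"
    where D: "D \<in> Der UNIV \<and> D wX = wY ^ (p - 1) \<and> D wY = 0"
    by (metis weyl_derivation_exists)
  have unique: "E = D" if "E \<in> Der UNIV \<and> E wX = wY ^ (p - 1) \<and> E wY = 0" for E
    using Der_Ah_eqI[of E 1 D] D that by (simp add: Ah_one yhat_def)
  have "\<exists>!D :: 'a weyl \<Rightarrow> 'a weyl. D \<in> Der UNIV \<and> D wX = wY ^ (p - 1) \<and> D wY = 0"
    by (rule ex1I[of _ D]) (use D unique in blast)+
  from theI'[OF this, folded Ex_def]
  show "(Ex p :: 'a weyl \<Rightarrow> 'a weyl) \<in> Der UNIV" "Ex p wX = (wY ^ (p - 1) :: 'a weyl)"
    "Ex p wY = (0 :: 'a weyl)" by auto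
qed

lemma Ex_derivation: "derivation_on A (Ex p :: 'a weyl \<Rightarrow> 'a weyl)"
  using Ex_Der derivation_on_subset[of UNIV] by (simp add: Der_iff)

lemma dp_pCons: "dp p (pCons c f) = [:0, 1:] * dp p f - (pderiv ^^ (p - 1)) (f :: 'a poly)"
proof -
  have "dp p (pCons c f) = dp p ([:0, 1:] * f)"
    using p_pos by (intro poly_eqI) (auto simp: coeff_dp coeff_pCons split: nat.splits)
  then show ?thesis by (simp only: dp_x_mult)
qed

lemma Ex_coeff_pCons:
  "Ex_coeff (pCons c f) j = wc (wY ^ (p - 1) * wpoly f) j + [:0, 1:] * Ex_coeff f j"
proof (cases "0 < j \<and> j < p")
  case True
  define k where "k = p - 1 - j"
  have k: "p - j = Suc k" "p - j - 1 = k" "p - 1 - j = k" "j \<le> p - 1" "p - 1 = k + j"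
    using True by (auto simp: k_def)
  have "Suc k < p" using True unfolding k_def by arith
  then have nz: "of_nat (Suc k) \<noteq> (0 :: 'a)"
    using of_nat_eq_0[of "Suc k"] by (auto dest: dvd_imp_le simp del: of_nat_Suc)
  have "(-1) ^ k * (-1) ^ j = (1 :: 'a)"
    using minus_one_power_p by (simp only: k flip: power_add)
  then have sign: "(-1) ^ k = ((-1) ^ j :: 'a)"
    by (metis left_minus_one_mult_self mult.assoc mult.commute mult_1)
  have binom: "of_nat ((p - 1) choose j) = ((-1) ^ k :: 'a)"
    using of_nat_binomial_p[OF k(4)] by (simp only: sign)
  have "Ex_coeff (pCons c f) j = smult ((-1) ^ k / of_nat (Suc k)) ((pderiv ^^ Suc k) (pCons c f))"
    unfolding Ex_coeff_def k using True by (simp only: if_True) simp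
  also have "\<dots> = [:0, 1:] * smult ((-1) ^ k / of_nat (Suc k)) ((pderiv ^^ Suc k) f) +
      smult ((-1) ^ k) ((pderiv ^^ k) f)"
    unfolding higher_pderiv_pCons smult_add_right mult_smult_right smult_smult
    using nz by (simp del: of_nat_Suc mult_pCons_left)
  also have "\<dots> = [:0, 1:] * Ex_coeff f j + wc (wY ^ (p - 1) * wpoly f) j"
    unfolding wc_wY_power_wpoly Ex_coeff_def binom k(3) using True k(1,2,4) by simp
  finally show ?thesis by (simp only: add.commute)
next
  case False
  then show ?thesis
    using p_pos by (auto simp: Ex_coeff_def wc_wY_power_wpoly dp_pCons simp del: One_nat_def)
qed

text \<open>Formally \<open>E\<^sub>x\<close> is the commutator with \<open>y\<^sup>p\<close> divided by \<open>p\<close>: the scalars in \<open>Ex_coeff\<close> are the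
residues of \<open>(p choose k) / p\<close> for \<open>k = p - j\<close>, and \<open>- dp p f\<close> is the residue of the derivative of
order \<open>p\<close> divided by \<open>p\<close>. The proof is the induction step \<open>f \<mapsto> c + x f\<close>.\<close>

lemma wc_Ex_wpoly: "wc (Ex p (wpoly f)) j = Ex_coeff (f :: 'a poly) j"
proof (induction f)
  case 0
  have "dp p (0 :: 'a poly) = 0" by (rule poly_eqI) (simp add: coeff_dp)
  then show ?case
    using derivation_on_wconst[of 1 "Ex p" "0 :: 'a"] Ex_derivation by (simp add: Ex_coeff_def)
next
  case (pCons c f)
  have E: "derivation_on (Ah 1) (Ex p :: 'a weyl \<Rightarrow> 'a weyl)" by (rule Ex_derivation)
  have "Ex p (wpoly (pCons c f)) = wY ^ (p - 1) * wpoly f + wX * Ex p (wpoly f)"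
    unfolding wpoly_pCons
    by (simp add: derivation_onD[OF E] derivation_on_wconst[OF E] Ah_one Ex_wX del: One_nat_def)
  then show ?case
    by (simp only: Ex_coeff_pCons wc_add wc_wX_mult pCons.IH)
qed

end

context Ah_char
begin

text \<open>The exact quotient of \<open>h\<^sup>p\<close> by the largest factor of \<open>h\<close> in \<open>F[x\<^sup>p]\<close>. It is central, and still
divisible by \<open>h\<^sup>p\<^sup>-\<^sup>1\<close>, so every normal form of degree less than \<open>p\<close> in \<open>y\<close> becomes an element of
\<open>A\<^sub>h\<close> after multiplication by it.\<close>

abbreviation h_rho :: "'a poly" where "h_rho \<equiv> h ^ p div rho p h"

lemma rho_mult_h_rho: "rho p h * h_rho = h ^ p"
  using dvd_trans[OF rho_dvd[OF h_nz] dvd_power[of p h]] p_pos by simp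

lemma h_rho_nz: "h_rho \<noteq> 0"
  using rho_mult_h_rho h_nz by auto

lemma pderiv_h_rho: "pderiv h_rho = 0"
  using pderiv_quotient_zero[of "rho p h" h_rho] rho_Fxp[OF h_nz] rho_nz[OF h_nz] pderiv_power_p[of h]
  by (simp add: Fxp_iff rho_mult_h_rho)

lemma power_dvd_h_rho: "h ^ (p - 1) dvd h_rho"
proof -
  obtain c where c: "h = rho p h * c" using rho_dvd[OF h_nz] by blast
  have "rho p h * h_rho = h ^ (p - 1) * h" by (rule trans[OF rho_mult_h_rho h_power_p])
  also have "\<dots> = h ^ (p - 1) * (rho p h * c)" by (rule arg_cong[OF c])
  also have "\<dots> = rho p h * (h ^ (p - 1) * c)" by (rule mult.left_commute)
  finally have "rho p h * h_rho = rho p h * (h ^ (p - 1) * c)" .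
  then have "h_rho = h ^ (p - 1) * c" using rho_nz[OF h_nz] by simp
  then show ?thesis by simp
qed

lemma wpoly_h_rho_Z: "wpoly h_rho \<in> Z"
  by (rule Z_wpoly[OF pderiv_h_rho])

text \<open>The value \<open>E\<^sub>x (yhat h)\<close> contains \<open>h' y\<^sup>p\<close>, which is the only term of degree at least \<open>p\<close>; the
summand with \<open>z\<^sub>h\<close> cancels it. On \<open>A\<^sub>h\<close> this is the derivation \<open>Fbreve p h\<close>, without the
truncation outside \<open>A\<^sub>h\<close>.\<close>

definition F_derivation :: "'a weyl \<Rightarrow> 'a weyl" where
  "F_derivation a = z_h p h * Dr h (pderiv h div rho p h) a - wpoly h_rho * Ex p a"

lemma F_derivation_on: "derivation_on (Ah h) F_derivation"
  unfolding F_derivation_def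
  by (intro derivation_on_minus derivation_on_lmult_Z Dr_derivation Ex_derivation z_h_Z wpoly_h_rho_Z)

lemma Fbreve_eq: "Fbreve p h = restr (Ah h) F_derivation"
  using Dr_Der by (auto simp: Fbreve_def F_derivation_def restr_def dscale_def Der_iff fun_eq_iff)

lemma F_derivation_wX: "F_derivation wX = - (wpoly h_rho * wY ^ (p - 1))"
  by (simp add: F_derivation_def Dr_wX Ex_wX del: One_nat_def)

text \<open>Up to the factor \<open>h_rho\<close>, the coefficient of \<open>y\<^sup>j\<close> in the value at \<open>yhat h\<close>.\<close>

definition F_yhat_coeff :: "nat \<Rightarrow> 'a poly" where
  "F_yhat_coeff j = (if j = 0 then dp p (pderiv h) else if j = 1 then dp p h
     else if j < p then
       smult ((-1) ^ (p - j) / (of_nat (p - j + 1) * of_nat (p - j))) ((pderiv ^^ (p - j + 1)) h)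
     else 0)"

text \<open>The two contributions to the coefficient of \<open>y\<^sup>j\<close>, from \<open>E\<^sub>x (h) y\<close> and from \<open>E\<^sub>x (h')\<close>, are multiples
of the same derivative of \<open>h\<close>, and their scalars combine by \<open>1 / k - 1 / (k + 1) = 1 / (k (k + 1))\<close>.\<close>

lemma Ex_coeff_yhat:
  "(if j = 0 then 0 else Ex_coeff h (j - 1)) + Ex_coeff (pderiv h) j =
     (if j = p then pderiv h else - F_yhat_coeff j)"
proof -
  have p1: "p > 1" using prime_p by (rule prime_gt_1_nat)
  consider "j = 0" | "j = 1" | "1 < j \<and> j < p" | "j = p" | "j > p" using p1 by linarith
  then show ?thesis
  proof cases
    case 2
    have "(pderiv ^^ (p - 1)) (pderiv h) = (pderiv ^^ Suc (p - 1)) h"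
      by (simp only: funpow_Suc_right o_apply)
    also have "\<dots> = 0" by (simp add: pderiv_higher_pderiv_p del: One_nat_def)
    finally show ?thesis using 2 p1 by (simp add: Ex_coeff_def F_yhat_coeff_def)
  next
    case 3
    define k where "k = p - j"
    have k: "p - j = k" "p - (j - 1) = Suc k" "p - (j - 1) - 1 = k" "0 < k" "Suc k < p"
      using 3 by (auto simp: k_def)
    obtain l where l: "k = Suc l" using k(4) by (cases k) auto
    have nz: "of_nat k \<noteq> (0 :: 'a)" "of_nat (Suc k) \<noteq> (0 :: 'a)"
      using of_nat_eq_0[of k] of_nat_eq_0[of "Suc k"] k(4,5)
      by (auto dest: dvd_imp_le simp del: of_nat_Suc)
    have "(pderiv ^^ k) (pderiv h) = (pderiv ^^ Suc k) h"
      by (simp only: funpow_Suc_right o_apply)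
    then have "Ex_coeff h (j - 1) + Ex_coeff (pderiv h) j =
        smult ((-1) ^ k / of_nat (Suc k) + (-1) ^ (k - 1) / of_nat k) ((pderiv ^^ Suc k) h)"
      using 3 k by (simp add: Ex_coeff_def smult_add_left del: of_nat_Suc funpow.simps)
    also have "(-1) ^ k / of_nat (Suc k) + (-1) ^ (k - 1) / of_nat k =
        - ((-1) ^ k / (of_nat (k + 1) * of_nat k) :: 'a)"
      using nz by (simp add: l divide_simps) (simp add: algebra_simps)
    finally show ?thesis
      using 3 k by (simp add: F_yhat_coeff_def del: of_nat_Suc funpow.simps)
  next
    case 4
    then show ?thesis using p1 by (simp add: Ex_coeff_def)
  qed (use p1 in \<open>auto simp: Ex_coeff_def F_yhat_coeff_def\<close>)
qed

lemma wc_F_derivation_yhat: "wc (F_derivation (yhat h)) j = h_rho * F_yhat_coeff j"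
proof -
  let ?g = "pderiv h div rho p h"
  have "z_h p h * wpoly ?g = wpoly ?g * (wpoly (h ^ p) * wY ^ p)"
    using Z_mult_commute[OF z_h_Z, of "wpoly ?g"] by (simp only: z_h_def)
  then have "z_h p h * wpoly ?g = wpoly (?g * h ^ p) * wY ^ p"
    by (simp only: wpoly_mult mult.assoc)
  moreover have "?g * h ^ p = h_rho * pderiv h"
  proof -
    have "h_rho * pderiv h = h_rho * (rho p h * ?g)" using rho_dvd_pderiv[OF h_nz] by simp
    also have "\<dots> = ?g * (rho p h * h_rho)" by (simp only: mult_ac)
    finally show ?thesis by (simp only: rho_mult_h_rho)
  qed
  ultimately have "wc (z_h p h * Dr h ?g (yhat h)) j = (if j = p then h_rho * pderiv h else 0)"
    by (simp add: Dr_yhat wc_monomial)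
  moreover have "wc (Ex p (yhat h)) j = (if j = p then pderiv h else - F_yhat_coeff j)"
  proof -
    have E: "derivation_on UNIV (Ex p :: 'a weyl \<Rightarrow> 'a weyl)" by (rule Ex_derivation)
    have "Ex p (yhat h) = Ex p (wpoly h) * wY + Ex p (wpoly (pderiv h))"
      by (simp add: yhat_eq derivation_onD[OF E] Ex_wY)
    then show ?thesis
      by (simp only: wc_add wc_mult_wY wc_Ex_wpoly Ex_coeff_yhat)
  qed
  moreover have "F_yhat_coeff p = 0"
    using prime_gt_1_nat[OF prime_p] by (simp add: F_yhat_coeff_def)
  ultimately show ?thesis
    by (simp add: F_derivation_def wc_diff wc_wpoly_mult)
qed

lemma F_derivation_yhat:
  "F_derivation (yhat h) =
     wpoly h_rho *
       (\<Sum>k = 1..p - 2. wpoly (smult ((-1) ^ k / (of_nat (k + 1) * of_nat k)) ((pderiv ^^ (k + 1)) h))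
          * wY ^ (p - k))
     + wpoly h_rho * (wpoly (dp p h) * wY + wpoly (dp p (pderiv h)))"
proof (rule wc_ext)
  fix j
  let ?c = "\<lambda>k. smult ((-1) ^ k / (of_nat (k + 1) * of_nat k)) ((pderiv ^^ (k + 1)) h)"
  have p1: "p > 1" using prime_p by (rule prime_gt_1_nat)
  have "(\<Sum>k = 1..p - 2. wc (wpoly (?c k) * wY ^ (p - k)) j) =
      (\<Sum>k = 1..p - 2. if k = p - j \<and> 1 < j \<and> j < p then ?c (p - j) else 0)"
    by (intro sum.cong refl) (auto simp: wc_monomial)
  also have "\<dots> = (if 1 < j \<and> j < p then ?c (p - j) else 0)"
  proof (cases "1 < j \<and> j < p")
    case True
    then have "p - j \<in> {1..p - 2}" by auto
    then show ?thesis using True by (simp only: simp_thms if_True sum.delta' finite_atLeastAtMost sum.delta)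
  next
    case False
    then show ?thesis by (simp only: simp_thms if_False sum.neutral_const)
  qed
  finally have sum: "(\<Sum>k = 1..p - 2. wc (wpoly (?c k) * wY ^ (p - k)) j) =
    (if 1 < j \<and> j < p then ?c (p - j) else 0)" .
  \<comment> \<open>The sum covers the exponents \<open>2, \<dots>, p - 1\<close>; the remaining terms are the exponents \<open>0\<close> and \<open>1\<close>.\<close>
  define S where "S = (\<Sum>k = 1..p - 2. wpoly (?c k) * wY ^ (p - k))"
  define T where "T = wpoly (dp p h) * wY + wpoly (dp p (pderiv h))"
  have S: "wc S j = (if 1 < j \<and> j < p then ?c (p - j) else 0)"
    unfolding S_def wc_sum by (rule sum)
  have T: "wc T j = (if j = 0 then dp p (pderiv h) else if j = 1 then dp p h else 0)"
    by (auto simp: T_def wc_add wc_mult_wY wc_wpoly)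
  have "F_yhat_coeff j = wc S j + wc T j"
    unfolding S T F_yhat_coeff_def using p1 by auto
  then have "wc (F_derivation (yhat h)) j = wc (wpoly h_rho * S + wpoly h_rho * T) j"
    by (simp only: wc_F_derivation_yhat wc_add wc_wpoly_mult distrib_left)
  then show "wc (F_derivation (yhat h)) j = wc (wpoly h_rho * (\<Sum>k = 1..p - 2. wpoly (?c k) * wY ^ (p - k))
     + wpoly h_rho * (wpoly (dp p h) * wY + wpoly (dp p (pderiv h)))) j"
    by (simp only: S_def T_def)
qed

lemma Fbreve_Der: "Fbreve p h \<in> Der (Ah h)"
  unfolding Fbreve_eq
proof (rule restr_in_Der[OF F_derivation_on])
  have dvd: "h ^ j dvd h_rho * f" if "j < p" for j f
    using that dvd_trans[OF le_imp_power_dvd[of j "p - 1" h] power_dvd_h_rho] by (intro dvd_mult2) simp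
  show "F_derivation wX \<in> Ah h"
    unfolding F_derivation_wX
    by (rule Ah_uminus) (auto simp: Ah_iff wc_monomial power_dvd_h_rho simp del: One_nat_def)
  show "F_derivation (yhat h) \<in> Ah h"
    unfolding Ah_iff wc_F_derivation_yhat
  proof
    fix j
    show "h ^ j dvd h_rho * F_yhat_coeff j"
    proof (cases "j < p")
      case True
      then show ?thesis by (rule dvd)
    next
      case False
      then have "F_yhat_coeff j = 0"
        using prime_gt_1_nat[OF prime_p] by (simp add: F_yhat_coeff_def)
      then show ?thesis by simp
    qed
  qed
qed

lemma Fbreve_wX: "Fbreve p h wX = - (wpoly h_rho * wY ^ (p - 1))"
  by (simp add: Fbreve_eq restr_def Ah.x F_derivation_wX)

lemma Fbreve_yhat: "Fbreve p h (yhat h) = F_derivation (yhat h)"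
  by (simp add: Fbreve_eq restr_def Ah.yhat)

lemma Fbreve_wX_power_p: "Fbreve p h (wX ^ p) = wpoly h_rho"
proof (rule wc_ext)
  fix j
  have F: "derivation_on (Ah h) (Fbreve p h)" using Fbreve_Der by (simp add: Der_iff)
  show "wc (Fbreve p h (wX ^ p)) j = wc (wpoly h_rho) j"
    unfolding wc_derivation_wX_power_p[OF F] Fbreve_wX
    by (auto simp: wc_uminus wc_monomial wc_wpoly simp del: One_nat_def)
qed

end


section \<open>Derivations with prescribed restriction to the centre\<close>

context Ah_char
begin

lemma Der_derivation: "D \<in> Der (Ah h) \<Longrightarrow> derivation_on (Ah h) D"
  by (simp add: Der_iff)

lemma Der_Ah: "D \<in> Der (Ah h) \<Longrightarrow> a \<in> Ah h \<Longrightarrow> D a \<in> Ah h"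
  by (simp add: Der_iff)

lemma Der_preserves_Z:
  assumes D: "D \<in> Der (Ah h)" and z: "z \<in> Z"
  shows "D z \<in> Z"
proof -
  note D' = Der_derivation[OF D]
  have "D z * a = a * D z" if a: "a \<in> Ah h" for a
  proof -
    have "D z * a + z * D a = D a * z + a * D z"
      using derivation_on_mult[OF D' Z_Ah[OF z] a] derivation_on_mult[OF D' a Z_Ah[OF z]]
        Z_mult_commute[OF z, of a] by simp
    then show ?thesis using Z_mult_commute[OF z, of "D a"] by simp
  qed
  then show ?thesis using Der_Ah[OF D Z_Ah[OF z]] by (simp add: weyl_center_def)
qed

text \<open>A coefficient at \<open>y\<^sup>j\<close> of the form \<open>h\<^sup>j e\<close> with \<open>e\<close> in \<open>F[x\<^sup>p]\<close> divisible by \<open>h\<^sup>p\<^sup>-\<^sup>1\<close> is automatically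
divisible by the larger polynomial \<open>h\<^sup>j h_rho\<close>.\<close>

lemma Z_multiple_of_h_rho:
  assumes d: "d \<in> Z" and dvd: "\<And>j. p dvd j \<Longrightarrow> h ^ (j + (p - 1)) dvd wc d j"
  obtains z where "z \<in> Z" "d = z * wpoly h_rho"
proof -
  have "\<exists>g. wc d j = h ^ j * (h_rho * g) \<and> pderiv g = 0 \<and> (\<not> p dvd j \<longrightarrow> g = 0)" for j
  proof (cases "p dvd j")
    case False
    then have "wc d j = h ^ j * (h_rho * 0) \<and> pderiv (0 :: 'a poly) = 0" using d by (simp add: Z_iff)
    then show ?thesis by blast
  next
    case True
    obtain k where k: "wc d j = h ^ (j + (p - 1)) * k" using dvd[OF True] by blast
    define e where "e = h ^ (p - 1) * k"
    have e: "wc d j = h ^ j * e" by (simp only: k e_def power_add mult.assoc)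
    have "pderiv (h ^ j * e) = 0" using d by (simp add: Z_iff flip: e)
    then have e': "pderiv e = 0"
      using pderiv_quotient_zero pderiv_h_power[OF True] h_nz by (metis power_not_zero)
    have "h ^ (p - 1) dvd e" by (simp add: e_def)
    then have "h_rho dvd e" by (rule power_div_rho_dvd[OF h_nz e'])
    then obtain g where g: "e = h_rho * g" by blast
    have "pderiv g = 0" using pderiv_quotient_zero[of h_rho g] e' pderiv_h_rho h_rho_nz by (simp add: g)
    then show ?thesis using e g True by blast
  qed
  then obtain g where g: "\<And>j. wc d j = h ^ j * (h_rho * g j)" "\<And>j. pderiv (g j) = 0"
    "\<And>j. \<not> p dvd j \<Longrightarrow> g j = 0" by metis
  obtain n where n: "\<And>j. n < j \<Longrightarrow> wc d j = 0" using wc_bound[of d] by blast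
  have "h ^ j * g j = 0" if "n < j" for j using n[OF that] g(1)[of j] h_nz h_rho_nz by simp
  then obtain z where z: "\<And>j. wc z j = h ^ j * g j" using wc_exists[of n "\<lambda>j. h ^ j * g j"] by blast
  have "pderiv (wc z j) = 0" for j
    using g(2,3)[of j] pderiv_h_power[of j] by (cases "p dvd j") (simp_all add: z pderiv_mult)
  then have "z \<in> Z" using g(3) by (simp add: Z_iff z)
  moreover have "d = wpoly h_rho * z"
    by (rule wc_ext) (simp add: wc_wpoly_mult z g(1) mult_ac)
  ultimately show ?thesis using that Z_mult_commute[of z "wpoly h_rho"] by simp
qed

text \<open>The coefficients of \<open>D (x\<^sup>p)\<close> are, up to sign, those of \<open>D x\<close> shifted by \<open>p - 1\<close>, so they carry
\<open>p - 1\<close> more factors \<open>h\<close> than membership in \<open>A\<^sub>h\<close> demands.\<close>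

lemma Der_wX_power_p:
  assumes D: "D \<in> Der (Ah h)"
  obtains z where "z \<in> Z" "D (wX ^ p) = z * wpoly h_rho"
proof (rule Z_multiple_of_h_rho)
  show "D (wX ^ p) \<in> Z" by (rule Der_preserves_Z[OF D wX_power_p_Z])
  fix j assume "p dvd j"
  moreover have "h ^ (j + (p - 1)) dvd wc (D wX) (j + (p - 1))"
    using Der_Ah[OF D Ah.x] by (simp add: Ah_iff)
  ultimately show "h ^ (j + (p - 1)) dvd wc (D (wX ^ p)) j"
    by (simp add: wc_derivation_wX_power_p[OF Der_derivation[OF D]] del: One_nat_def)
qed (rule that)

text \<open>Integration with respect to \<open>y\<close>: if \<open>D\<close> kills \<open>x\<^sup>p\<close>, no exponent congruent to \<open>-1\<close> occurs in
  \<open>D x\<close>, so \<open>D x\<close> is a commutator of \<open>x\<close> with some \<open>a = c y\<close>. The element \<open>a\<close> need not lie in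
  \<open>A\<^sub>h\<close>; the coefficients of \<open>[a, yhat h]\<close> at the exponents divisible by \<open>p\<close> are divisible
  as for an element of \<open>A\<^sub>h\<close> all the same, since the commutators of \<open>A\<^sub>h\<close> lie in the ideal
  generated by \<open>h\<close>.\<close>

lemma Der_reduce_by_wad:
  assumes D: "D \<in> Der (Ah h)" "D (wX ^ p) = 0"
  obtains a where "D wX = wad a wX" "wad (D (yhat h) - wad a (yhat h)) wX = 0"
    "D (yhat h) - wad a (yhat h) \<in> Ah h"
proof -
  note D' = Der_derivation[OF D(1)]
  define u where "u = D wX"
  have u: "u \<in> Ah h" using Der_Ah[OF D(1) Ah.x] by (simp add: u_def)
  have u_zero: "wc u i = 0" if "p dvd Suc i" for i
  proof -
    have "p \<le> Suc i" using that by (simp add: dvd_imp_le)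
    then have i: "i = (Suc i - p) + (p - 1)" using p_pos by simp
    have "p dvd Suc i - p" using that by (simp add: dvd_diff_nat)
    then have "wc u ((Suc i - p) + (p - 1)) = 0"
      using wc_derivation_wX_power_p[OF D', of "Suc i - p"] by (simp add: D(2) u_def del: One_nat_def)
    then show ?thesis using i by simp
  qed
  obtain n where n: "\<And>j. n < j \<Longrightarrow> wc u j = 0" using wc_bound[of u] by blast
  \<comment> \<open>Division by zero only meets the vanishing coefficients of \<open>u\<close>.\<close>
  obtain c where c: "\<And>j. wc c j = smult (inverse (of_nat (Suc j))) (wc u j)"
    using wc_exists[of n "\<lambda>j. smult (inverse (of_nat (Suc j))) (wc u j)"] n by force
  have c_Ah: "c \<in> Ah h"
    using u unfolding Ah_iff c by (blast intro: dvd_smult)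
  define a where "a = c * wY"
  define w where "w = D (yhat h) - wad a (yhat h)"
  have wX: "D wX = wad a wX"
  proof (rule wc_ext)
    fix j
    show "wc (D wX) j = wc (wad a wX) j"
      using u_zero[of j] of_nat_eq_0[of "Suc j"]
      by (cases "p dvd Suc j")
        (simp_all add: wc_wad_wX a_def wc_mult_wY c of_nat_poly flip: u_def del: of_nat_Suc)
  qed
  have E: "derivation_on (Ah h) (\<lambda>v. D v - wad a v)"
    by (rule derivation_on_minus[OF D' derivation_on_wad])
  have w: "wad w wX = 0"
    using commutes_derivation_yhat[OF E] by (simp add: wX w_def)
  obtain e1 where e1: "e1 \<in> Ah h" "wad c (yhat h) = wpoly h * e1"
    using Ah_commutator[OF c_Ah Ah.yhat] .
  obtain e2 where e2: "e2 \<in> Ah h" "wad c (wpoly (pderiv h)) = wpoly h * e2"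
    using Ah_commutator[OF c_Ah Ah_wpoly] .
  have a_yhat: "wad a (yhat h) =
      (wpoly h * e1 + wpoly h * e2 + wpoly (pderiv h) * c) * wY + c * wpoly (pderiv (pderiv h))"
  proof -
    have "wpoly h * wY = yhat h - wpoly (pderiv h)" by (simp add: yhat_eq)
    then have "yhat h * wY = wY * (yhat h - wpoly (pderiv h))"
      by (simp only: yhat_def mult.assoc)
    then have y: "wY * yhat h = yhat h * wY + wY * wpoly (pderiv h)"
      by (simp add: right_diff_distrib)
    have "wad a (yhat h) = c * (wY * yhat h) - yhat h * c * wY"
      by (simp only: wad_def a_def mult.assoc)
    also have "\<dots> = wad c (yhat h) * wY + c * (wpoly (pderiv h) * wY + wpoly (pderiv (pderiv h)))"
      unfolding y wY_wpoly by (simp add: wad_def distrib_left left_diff_distrib mult.assoc)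
    also have "\<dots> = (wad c (yhat h) + wad c (wpoly (pderiv h)) + wpoly (pderiv h) * c) * wY +
        c * wpoly (pderiv (pderiv h))"
      by (simp add: wad_def algebra_simps)
    finally show ?thesis by (simp only: e1 e2)
  qed
  have "h ^ j dvd wc w j" for j
  proof (cases "p dvd j \<and> j \<noteq> 0")
    case False
    then show ?thesis using w by (auto simp: commutes_wX_iff)
  next
    case True
    then obtain i where i: "j = Suc i" by (cases j) auto
    have "wc c i = 0" using u_zero[of i] True by (simp add: c i)
    then have "wc (wad a (yhat h)) j = h * wc e1 i + h * wc e2 i + wc (c * wpoly (pderiv (pderiv h))) j"
      by (simp add: a_yhat wc_add wc_mult_wY wc_wpoly_mult i)
    moreover have "h ^ j dvd h * wc e1 i" "h ^ j dvd h * wc e2 i"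
      using e1(1) e2(1) by (simp_all add: i Ah_iff mult_dvd_mono)
    moreover have "h ^ j dvd wc (c * wpoly (pderiv (pderiv h))) j" "h ^ j dvd wc (D (yhat h)) j"
      using Ah.mult[OF c_Ah Ah_wpoly] Der_Ah[OF D(1) Ah.yhat] by (simp_all add: Ah_iff)
    ultimately show ?thesis by (simp add: w_def wc_diff)
  qed
  then have "w \<in> Ah h" by (simp add: Ah_iff)
  then show ?thesis using that wX w by (simp add: w_def)
qed

lemma wad_zero_on_Z: "z \<in> Z \<Longrightarrow> wad a z = 0"
  by (simp add: wad_def Z_mult_commute)

lemma wc_Der_z_h:
  assumes "derivation_on (Ah h) D" "D wX = wad a wX"
  shows "wc (D (z_h p h)) j = (pderiv ^^ (p - 1)) (h ^ (p - 1) * wc (D (yhat h) - wad a (yhat h)) j)"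
  using wc_derivation_z_h[OF derivation_on_minus[OF assms(1) derivation_on_wad[of _ a]], of j] assms(2)
  by (simp add: wad_zero_on_Z[OF z_h_Z] del: One_nat_def)

text \<open>After subtracting an inner derivation, \<open>D (z\<^sub>h)\<close> is the derivative of order \<open>p - 1\<close> of
\<open>h\<^sup>p\<^sup>-\<^sup>1 w\<close>. This derivative is linear over \<open>F[x\<^sup>p]\<close>, so the divisor \<open>hbar p h\<close> of \<open>h\<^sup>p\<^sup>-\<^sup>1\<close> can
be pulled out.\<close>

lemma Der_z_h:
  assumes D: "D \<in> Der (Ah h)" "D (wX ^ p) = 0"
  obtains z where "z \<in> Z" "D (z_h p h) = z * wpoly (hbar p h)"
proof -
  obtain a where a: "D wX = wad a wX" "wad (D (yhat h) - wad a (yhat h)) wX = 0"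
    "D (yhat h) - wad a (yhat h) \<in> Ah h" using Der_reduce_by_wad[OF D] .
  define w where "w = D (yhat h) - wad a (yhat h)"
  define d where "d j = (pderiv ^^ (p - 1)) (h ^ (p - 1) * wc w j)" for j
  have hbar': "pderiv (hbar p h) = 0" using hbar_Fxp[OF h_nz] by (simp add: Fxp_iff)
  obtain k where k: "h ^ (p - 1) = hbar p h * k" using hbar_dvd_power[OF h_nz] by blast
  have "\<exists>g. d j = hbar p h * (h ^ j * g) \<and> pderiv (h ^ j * g) = 0 \<and> (\<not> p dvd j \<longrightarrow> g = 0)" for j
  proof (cases "p dvd j")
    case False
    then have "wc w j = 0" using a(2) by (simp add: commutes_wX_iff w_def)
    then have "d j = 0" using higher_pderiv_const_mult[of 0 "p - 1" 0] by (simp add: d_def del: One_nat_def)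
    then have "d j = hbar p h * (h ^ j * 0) \<and> pderiv (h ^ j * 0) = 0" by simp
    then show ?thesis by blast
  next
    case True
    have "h ^ j dvd wc w j" using a(3) by (simp add: Ah_iff w_def)
    then obtain s where s: "wc w j = h ^ j * s" by blast
    define g where "g = (pderiv ^^ (p - 1)) (k * s)"
    have "h ^ (p - 1) * wc w j = hbar p h * (h ^ j * (k * s))"
      by (simp only: s k mult_ac)
    then have "d j = hbar p h * (h ^ j * g)"
      by (simp only: d_def g_def higher_pderiv_const_mult[OF hbar']
          higher_pderiv_const_mult[OF pderiv_h_power[OF True]])
    moreover have "pderiv (h ^ j * g) = 0"
      using pderiv_h_power[OF True] by (simp add: pderiv_mult g_def pderiv_higher_pderiv_p del: One_nat_def)
    ultimately show ?thesis using True by blast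
  qed
  then obtain g where g: "\<And>j. d j = hbar p h * (h ^ j * g j)" "\<And>j. pderiv (h ^ j * g j) = 0"
    "\<And>j. \<not> p dvd j \<Longrightarrow> g j = 0" by metis
  have d: "wc (D (z_h p h)) j = d j" for j
    using wc_Der_z_h[OF Der_derivation[OF D(1)] a(1)] by (simp only: d_def w_def)
  obtain n where n: "\<And>j. n < j \<Longrightarrow> wc (D (z_h p h)) j = 0" using wc_bound[of "D (z_h p h)"] by blast
  have "h ^ j * g j = 0" if "n < j" for j using n[OF that] d g(1)[of j] hbar_nz[OF h_nz] by simp
  then obtain z where z: "\<And>j. wc z j = h ^ j * g j" using wc_exists[of n "\<lambda>j. h ^ j * g j"] by blast
  have "z \<in> Z" using g(2,3) by (simp add: Z_iff z)
  moreover have "D (z_h p h) = wpoly (hbar p h) * z"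
    by (rule wc_ext) (simp only: d g(1) wc_wpoly_mult z)
  ultimately show ?thesis using that Z_mult_commute[of z "wpoly (hbar p h)"] by simp
qed

text \<open>Integration with respect to \<open>x\<close>: the remaining part of \<open>D\<close> kills \<open>x\<close> and sends
\<open>yhat h\<close> to some \<open>w\<close>. As \<open>D\<close> kills \<open>z\<^sub>h\<close>, each coefficient of \<open>h\<^sup>p\<^sup>-\<^sup>1 w\<close> is a derivative. For the
exponents from \<open>p\<close> on, the coefficient \<open>w\<^sub>j\<close> contains the factor \<open>h\<^sup>p\<close>, which turns this into
\<open>w\<^sub>j = h b'\<close>; such a term is a commutator with \<open>yhat h\<close>. The constant coefficient lacks the factor,
and it gives \<open>D\<^sub>r\<close>.\<close>

lemma Der_zero_on_center_generators:
  assumes D: "D \<in> Der (Ah h)" "D (wX ^ p) = 0" "D (z_h p h) = 0"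
  obtains a r where "\<And>v. v \<in> Ah h \<Longrightarrow> D v = Dr h r v + wad a v"
proof -
  note D' = Der_derivation[OF D(1)]
  obtain a where a: "D wX = wad a wX" "wad (D (yhat h) - wad a (yhat h)) wX = 0"
    "D (yhat h) - wad a (yhat h) \<in> Ah h" using Der_reduce_by_wad[OF D(1,2)] .
  define w where "w = D (yhat h) - wad a (yhat h)"
  have "\<exists>b. p dvd j \<and> j \<noteq> 0 \<longrightarrow> wc w j = h * pderiv b" for j
  proof (cases "p dvd j \<and> j \<noteq> 0")
    case True
    then have dvd: "p dvd j - p" and le: "p \<le> j" by (auto simp: dvd_diff_nat dvd_imp_le)
    have "h ^ j dvd wc w j" using a(3) by (simp add: Ah_iff w_def)
    then obtain s where s: "wc w j = h ^ j * s" by blast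
    have "(pderiv ^^ (p - 1)) (h ^ (p - 1) * wc w j) = 0"
      using wc_Der_z_h[OF D' a(1), of j] by (simp only: w_def D(3) wc_0)
    moreover have "h ^ (p - 1) * wc w j = h ^ j * (h ^ (p - 1) * s)" by (simp only: s mult_ac)
    ultimately have "h ^ j * (pderiv ^^ (p - 1)) (h ^ (p - 1) * s) = 0"
      using True by (simp only: higher_pderiv_const_mult[OF pderiv_h_power])
    then have "(pderiv ^^ (p - 1)) (h ^ (p - 1) * s) = 0" using h_nz by simp
    then obtain c where c: "h ^ (p - 1) * s = pderiv c" by (rule higher_pderiv_p_zero)
    have "h ^ j = h ^ (j - p) * h ^ p" using le by (simp flip: power_add)
    then have "wc w j = h * (h ^ (j - p) * (h ^ (p - 1) * s))"
      by (simp only: s h_power_p mult_ac)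
    also have "\<dots> = h * pderiv (h ^ (j - p) * c)"
      by (simp add: c pderiv_mult pderiv_h_power[OF dvd] del: One_nat_def)
    finally show ?thesis by blast
  qed blast
  then obtain b where b: "\<And>j. p dvd j \<and> j \<noteq> 0 \<Longrightarrow> wc w j = h * pderiv (b j)" by metis
  obtain n where n: "\<And>j. n < j \<Longrightarrow> wc w j = 0" using wc_bound[of w] by blast
  obtain e where e: "\<And>j. wc e j = (if p dvd j \<and> j \<noteq> 0 \<and> j \<le> n then - b j else 0)"
    using wc_exists[of n "\<lambda>j. if p dvd j \<and> j \<noteq> 0 \<and> j \<le> n then - b j else 0"] by force
  have e_wX: "wad e wX = 0" by (simp add: commutes_wX_iff e)
  define r where "r = wc w 0"
  have w: "w = wad e (yhat h) + wpoly r"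
  proof (rule wc_ext)
    fix j
    have "wc w j = 0" if "\<not> p dvd j" using a(2) that by (simp add: commutes_wX_iff w_def)
    then show "wc w j = wc (wad e (yhat h) + wpoly r) j"
      using b[of j] n[of j]
      by (auto simp: wad_yhat_commuting[OF e_wX] wc_add wc_diff wc_uminus wc_wpoly_mult wc_wad_wY e wc_wpoly
          r_def pderiv_minus)
  qed
  have add: "wad (a + e) v = wad a v + wad e v" for v
    by (simp add: wad_def algebra_simps)
  have "D v = Dr h r v + wad (a + e) v" if "v \<in> Ah h" for v
    by (rule derivation_on_Ah_eq[OF D' derivation_on_plus[OF Dr_derivation derivation_on_wad] _ _ that])
      (use w in \<open>simp_all add: Dr_wX Dr_yhat add e_wX a(1) w_def algebra_simps\<close>)
  then show ?thesis using that by blast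
qed

text \<open>The kernel of the restriction to the centre, tested on the generators of the centre.\<close>

definition Res_kernel :: "('a weyl \<Rightarrow> 'a weyl) set" where
  "Res_kernel = {D \<in> Der (Ah h). D (wX ^ p) = 0 \<and> D (z_h p h) = 0}"

lemma Theta_iff: "r \<in> Theta h \<longleftrightarrow> Dr h r (z_h p h) = 0"
proof
  assume "r \<in> Theta h"
  then have "restr Z (Dr h r) (z_h p h) = 0" by (simp add: Theta_def Res_def)
  then show "Dr h r (z_h p h) = 0" using z_h_Z by (simp add: restr_def)
next
  assume "Dr h r (z_h p h) = 0"
  then have "Dr h r z = 0" if "z \<in> Z" for z
    using derivation_zero_on_Z[OF Dr_derivation Dr_wX_power_p _ that] by simp
  then show "r \<in> Theta h" by (auto simp: Theta_def Res_def restr_def)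
qed

text \<open>Inner derivations by elements of the Weyl algebra kill the centre, which gives one inclusion. For
the other, the element \<open>a\<close> with \<open>D = D\<^sub>r + ad\<^sub>a\<close> normalizes \<open>A\<^sub>h\<close> because \<open>D\<close> and \<open>D\<^sub>r\<close> preserve
it.\<close>

lemma Res_kernel_eq: "{D + E | D E. D \<in> D_Theta h \<and> E \<in> ad_normalizer h} = Res_kernel"
proof (intro equalityI subsetI)
  fix F assume "F \<in> {D + E | D E. D \<in> D_Theta h \<and> E \<in> ad_normalizer h}"
  then obtain r a where r: "r \<in> Theta h" and a: "a \<in> weyl_normalizer (Ah h)"
    and F: "F = Dr h r + restr (Ah h) (wad a)"
    by (auto simp: D_Theta_def ad_normalizer_def)
  have inner: "restr (Ah h) (wad a) \<in> Der (Ah h)"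
    using a by (intro restr_in_Der derivation_on_wad) (auto simp: weyl_normalizer_def intro: Ah.intros)
  have "F \<in> Der (Ah h)"
    using inner Dr_Der[of r] derivation_on_plus[OF Der_derivation[OF Dr_Der] Der_derivation[OF inner]]
    by (auto simp: Der_iff F plus_fun_def intro: Ah.add)
  moreover have "F z = Dr h r z" if "z \<in> Z" for z
    using that by (simp add: F restr_def wad_zero_on_Z)
  ultimately show "F \<in> Res_kernel"
    using r wX_power_p_Z z_h_Z by (simp add: Res_kernel_def Theta_iff Dr_wX_power_p)
next
  fix D assume "D \<in> Res_kernel"
  then have D: "D \<in> Der (Ah h)" "D (wX ^ p) = 0" "D (z_h p h) = 0" by (simp_all add: Res_kernel_def)
  obtain a r where ar: "\<And>v. v \<in> Ah h \<Longrightarrow> D v = Dr h r v + wad a v"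
    using Der_zero_on_center_generators[OF D] by blast
  have "wad a v \<in> Ah h" if "v \<in> Ah h" for v
    using Ah_diff[OF Der_Ah[OF D(1) that] Der_Ah[OF Dr_Der[of r] that]] ar[OF that] by simp
  then have "a \<in> weyl_normalizer (Ah h)" by (simp add: weyl_normalizer_def)
  moreover have "r \<in> Theta h"
    using ar[OF Z_Ah[OF z_h_Z]] by (simp add: Theta_iff D(3) wad_zero_on_Z z_h_Z)
  moreover have "D = Dr h r + restr (Ah h) (wad a)"
    using ar D(1) Dr_Der[of r] by (auto simp: fun_eq_iff restr_def Der_iff)
  ultimately show "D \<in> {D + E | D E. D \<in> D_Theta h \<and> E \<in> ad_normalizer h}"
    unfolding D_Theta_def ad_normalizer_def by blast
qed

lemma Der_0: "0 \<in> Der (Ah h)"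
  by (simp add: Der_def Ah_0)

lemma Der_plus: "D \<in> Der (Ah h) \<Longrightarrow> E \<in> Der (Ah h) \<Longrightarrow> D + E \<in> Der (Ah h)"
  using derivation_on_plus[of "Ah h" D E] by (auto simp: Der_iff plus_fun_def intro: Ah.add)

lemma Der_minus: "D \<in> Der (Ah h) \<Longrightarrow> E \<in> Der (Ah h) \<Longrightarrow> D - E \<in> Der (Ah h)"
  using derivation_on_minus[of "Ah h" D E] by (auto simp: Der_iff fun_diff_def intro: Ah_diff)

lemma Der_dscale: "D \<in> Der (Ah h) \<Longrightarrow> z \<in> Z \<Longrightarrow> dscale z D \<in> Der (Ah h)"
  using derivation_on_lmult_Z[of D z] by (auto simp: Der_iff dscale_def intro: Ah.mult Z_Ah)

lemma dscale_apply: "dscale z D a = z * D a"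
  by (simp add: dscale_def)

lemma dsubmodule_cyclic: "dsubmodule Z {dscale z D | z. z \<in> Z}"
  unfolding dsubmodule_def
proof (intro conjI ballI)
  have "0 = dscale 0 D" by (simp add: dscale_def fun_eq_iff)
  then show "0 \<in> {dscale z D | z. z \<in> Z}" using Z_0 by blast
next
  fix E F assume "E \<in> {dscale z D | z. z \<in> Z}" "F \<in> {dscale z D | z. z \<in> Z}"
  then obtain y z where "y \<in> Z" "z \<in> Z" "E = dscale y D" "F = dscale z D" by blast
  then have "E + F = dscale (y + z) D" "y + z \<in> Z"
    by (simp_all add: dscale_def fun_eq_iff distrib_right Z_add)
  then show "E + F \<in> {dscale z D | z. z \<in> Z}" by blast
next
  fix y E assume y: "y \<in> Z" and "E \<in> {dscale z D | z. z \<in> Z}"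
  then obtain z where z: "z \<in> Z" "E = dscale z D" by blast
  then have "dscale y E = dscale (y * z) D" by (simp add: dscale_def fun_eq_iff mult.assoc)
  then show "dscale y E \<in> {dscale z D | z. z \<in> Z}" using Z_mult[OF y z(1)] by blast
qed

text \<open>On the pair of values at \<open>x\<^sup>p\<close> and \<open>z\<^sub>h\<close> the matrix of \<open>F\<close> and \<open>D\<^sub>q\<close> is triangular with nonzero
diagonal entries \<open>h_rho\<close> and \<open>hbar p h\<close>. The value at \<open>x\<^sup>p\<close> determines the coefficient of \<open>F\<close>, and
then the value at \<open>z\<^sub>h\<close> determines that of \<open>D\<^sub>q\<close>.\<close>

lemma direct_sum_decomposition:
  assumes q: "\<And>i. i < p \<Longrightarrow> q i \<in> Fxp p" "hbar p h = (\<Sum>i<p. q i * hbar_part p h i)"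
  shows "is_direct_sum3 Z (Der (Ah h)) {dscale z (Dr h (qbreve p q)) | z. z \<in> Z}
    {dscale z (Fbreve p h) | z. z \<in> Z} Res_kernel"
proof -
  define Dq where "Dq = Dr h (qbreve p q)"
  define F where "F = Fbreve p h"
  have Dq: "Dq \<in> Der (Ah h)" "Dq (wX ^ p) = 0" "Dq (z_h p h) = wpoly (hbar p h)"
    using higher_pderiv_power_qbreve[OF q] by (simp_all add: Dq_def Dr_Der Dr_wX_power_p Dr_z_h del: One_nat_def)
  have F: "F \<in> Der (Ah h)" "F (wX ^ p) = wpoly h_rho"
    by (simp_all add: F_def Fbreve_Der Fbreve_wX_power_p)
  have K_iff: "D \<in> Res_kernel \<longleftrightarrow> D \<in> Der (Ah h) \<and> D (wX ^ p) = 0 \<and> D (z_h p h) = 0" for D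
    by (simp add: Res_kernel_def)
  have exists: "\<exists>y\<in>Z. \<exists>z\<in>Z. D - dscale y Dq - dscale z F \<in> Res_kernel" if D: "D \<in> Der (Ah h)" for D
  proof -
    obtain z where z: "z \<in> Z" "D (wX ^ p) = z * wpoly h_rho" using Der_wX_power_p[OF D] .
    have D1: "D - dscale z F \<in> Der (Ah h)" by (intro Der_minus Der_dscale D F z)
    have D1x: "(D - dscale z F) (wX ^ p) = 0" by (simp add: dscale_def z F)
    obtain y where y: "y \<in> Z" "(D - dscale z F) (z_h p h) = y * wpoly (hbar p h)"
      using Der_z_h[OF D1 D1x] .
    have "D - dscale y Dq - dscale z F = (D - dscale z F) - dscale y Dq" by (simp add: algebra_simps)
    also have "\<dots> \<in> Res_kernel"
      unfolding K_iff using Der_minus[OF D1 Der_dscale[OF Dq(1) y(1)]] D1x y(2)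
      by (simp add: dscale_def Dq)
    finally show ?thesis using y z by blast
  qed
  have unique: "y = y' \<and> z = z'"
    if "y \<in> Z" "z \<in> Z" "y' \<in> Z" "z' \<in> Z" "K \<in> Res_kernel" "K' \<in> Res_kernel"
      and eq: "dscale y Dq + dscale z F + K = dscale y' Dq + dscale z' F + K'" for y z y' z' K K'
  proof
    have "z * wpoly h_rho = z' * wpoly h_rho"
      using fun_cong[OF eq, of "wX ^ p"] that(5,6) by (simp add: dscale_def Dq F K_iff)
    then have "wpoly h_rho * z = wpoly h_rho * z'"
      using Z_mult_commute[OF that(2), of "wpoly h_rho"] Z_mult_commute[OF that(4), of "wpoly h_rho"] by simp
    then show z: "z = z'" by (rule wpoly_mult_cancel[OF h_rho_nz])
    have "y * wpoly (hbar p h) = y' * wpoly (hbar p h)"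
      using fun_cong[OF eq, of "z_h p h"] that(5,6) by (simp add: dscale_def Dq K_iff z)
    then have "wpoly (hbar p h) * y = wpoly (hbar p h) * y'"
      using Z_mult_commute[OF that(1), of "wpoly (hbar p h)"]
        Z_mult_commute[OF that(3), of "wpoly (hbar p h)"] by simp
    then show "y = y'" by (rule wpoly_mult_cancel[OF hbar_nz[OF h_nz]])
  qed
  have "\<exists>!(D1, D2, D3). D1 \<in> {dscale z Dq | z. z \<in> Z} \<and> D2 \<in> {dscale z F | z. z \<in> Z} \<and>
      D3 \<in> Res_kernel \<and> D = D1 + D2 + D3" if D: "D \<in> Der (Ah h)" for D
  proof -
    obtain y z where yz: "y \<in> Z" "z \<in> Z" "D - dscale y Dq - dscale z F \<in> Res_kernel"
      using exists[OF D] by blast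
    show ?thesis
    proof (rule ex1I[of _ "(dscale y Dq, dscale z F, D - dscale y Dq - dscale z F)"])
      show "case (dscale y Dq, dscale z F, D - dscale y Dq - dscale z F) of (D1, D2, D3) \<Rightarrow>
          D1 \<in> {dscale z Dq | z. z \<in> Z} \<and> D2 \<in> {dscale z F | z. z \<in> Z} \<and> D3 \<in> Res_kernel \<and>
          D = D1 + D2 + D3"
        using yz by (auto simp: algebra_simps)
    next
      fix t assume t: "case t of (D1, D2, D3) \<Rightarrow>
          D1 \<in> {dscale z Dq | z. z \<in> Z} \<and> D2 \<in> {dscale z F | z. z \<in> Z} \<and> D3 \<in> Res_kernel \<and>
          D = D1 + D2 + D3"
      obtain D1 D2 D3 where t_eq: "t = (D1, D2, D3)" by (cases t)
      with t obtain y' z' where t': "y' \<in> Z" "z' \<in> Z" "D1 = dscale y' Dq" "D2 = dscale z' F"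
        "D3 \<in> Res_kernel" "D = dscale y' Dq + dscale z' F + D3" by auto
      have "dscale y' Dq + dscale z' F + D3 =
          dscale y Dq + dscale z F + (D - dscale y Dq - dscale z F)"
        by (simp add: t'(6)[symmetric])
      then have "y' = y \<and> z' = z" by (rule unique[OF t'(1,2) yz(1,2) t'(5) yz(3)])
      then show "t = (dscale y Dq, dscale z F, D - dscale y Dq - dscale z F)"
        using t_eq t' by (simp add: algebra_simps)
    qed
  qed
  moreover have "dsubmodule Z (Der (Ah h))"
    unfolding dsubmodule_def using Der_0 Der_plus Der_dscale by blast
  moreover have "dsubmodule Z Res_kernel"
    unfolding dsubmodule_def by (auto simp: K_iff dscale_apply intro: Der_0 Der_plus Der_dscale)
  ultimately show ?thesis
    unfolding is_direct_sum3_def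
    using dsubmodule_cyclic Der_dscale[OF Dq(1)] Der_dscale[OF F(1)] K_iff
    by (auto simp flip: Dq_def F_def)
qed

end

theorem theorem6p21:
  fixes h :: "'a::field poly" and p :: nat and q :: "nat \<Rightarrow> 'a poly"
  assumes char: "CHAR('a) = p" and p_pos: "p > 0"
    and h_nz: "h \<noteq> 0"
    and q_Fxp: "\<And>i. i < p \<Longrightarrow> q i \<in> Fxp p"
    and q_bezout: "hbar p h = (\<Sum>i<p. q i * hbar_part p h i)"
  shows "(\<forall>r. Dr h r \<in> Der (Ah h) \<and> Dr h r wX = 0 \<and> Dr h r (yhat h) = wpoly r)
    \<and> is_direct_sum3 (weyl_center (Ah h)) (Der (Ah h))
        {dscale z (Dr h (qbreve p q)) | z. z \<in> weyl_center (Ah h)}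
        {dscale z (Fbreve p h) | z. z \<in> weyl_center (Ah h)}
        {D + E | D E. D \<in> D_Theta h \<and> E \<in> ad_normalizer h}
    \<and> Fbreve p h wX = - (wpoly (h ^ p div rho p h) * wY ^ (p - 1))
    \<and> Fbreve p h (yhat h) =
        wpoly (h ^ p div rho p h) *
          (\<Sum>k = 1..p - 2. wpoly (smult ((-1) ^ k / (of_nat (k + 1) * of_nat k)) ((pderiv ^^ (k + 1)) h))
             * wY ^ (p - k))
        + wpoly (h ^ p div rho p h) * (wpoly (dp p h) * wY + wpoly (dp p (pderiv h)))"
proof -
  interpret Ah_char p h
    by standard (fact char p_pos h_nz)+
  show ?thesis
    unfolding Res_kernel_eq Fbreve_yhat F_derivation_yhat
    using Dr_properties direct_sum_decomposition[OF q_Fxp q_bezout] Fbreve_wX by blast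
qed

end
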